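(* Let $(\varphi_i)_{i=1}^m$ be a self-similar iterated function system on $\mathbb{R}^d$ satisfying the open set condition, let $X$ be its self-similar set, and let $\mu$ be the self-similar measure associated to it and a probability vector $(p_1,\ldots,p_m)$ with all $p_i>0$. For $\alpha\in[0,\infty]$ let $$D^{\mathrm A}_\alpha(\mu)=\{x\in\operatorname{spt}(\mu):\dim_{\mathrm A}(\mu,x)=\alpha\},\qquad U^{\mathrm A}_\alpha(\mu)=\{x\in\operatorname{spt}(\mu):\dim_{\mathrm A}(\mu,x)\le\alpha\}.$$ Then, for all $\alpha\in[\alpha_{\min},\alpha_{\max})$, $$\dim_{\mathrm H} D^{\mathrm A}_\alpha(\mu)=\dim_{\mathrm H} U^{\mathrm A}_\alpha(\mu)=\overline{f}(\alpha).$$ Moreover, $$\dim_{\mathrm H} D^{\mathrm A}_{\dim_{\mathrm A}\mu}(\mu)=\dim_{\mathrm H} U^{\mathrm A}_{\dim_{\mathrm A}\mu}(\mu)=\dim_{\mathrm H} X,$$ and for any $\alpha\notin[\alpha_{\min},\alpha_{\max}]\cup\{\dim_{\mathrm A}\mu\}$ we have $D^{\mathrm A}_\alpha(\mu)=\emptyset$.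
   Context: A self-similar iterated function system (IFS) is a finite collection $(\varphi_i)_{i=1}^m$ of contractive similarities of $\mathbb{R}^d$, with contraction ratios $r_i\in(0,1)$. Its self-similar set is the unique non-empty compact $X\subset\mathbb{R}^d$ with $X=\bigcup_{i=1}^m\varphi_i(X)$; it is normalised so that $\operatorname{diam}(X)=1$ (so $m\ge2$) and carries the Euclidean metric. The open set condition (OSC): there is a non-empty bounded open set $U\subset\mathbb{R}^d$ with $\varphi_i(U)\subset U$ for all $i$ and $\varphi_i(U)\cap\varphi_j(U)=\emptyset$ for all $i\neq j$. The self-similar measure is the unique Borel probability measure $\mu$ with $\mu=\sum_{i=1}^m p_i\,\mu\circ\varphi_i^{-1}$; its support is $X$. $B(x,r)$ denotes the closed ball. The pointwise Assouad dimension of $\mu$ at $x\in\operatorname{spt}(\mu)$ is $$\dim_{\mathrm A}(\mu,x)=\inf\Big\{s>0:\exists C>0\text{ such that }\forall\, 0<r<R,\ \tfrac{\mu(B(x,R))}{\mu(B(x,r))}\le C\big(\tfrac Rr\big)^s\Big\},$$ with $\inf\emptyset=\infty$; the constant $C$ may depend on $x$. The (global) Assouad dimension $\dim_{\mathrm A}\mu\in[0,\infty]$ is the infimum of those $s>0$ for which there is one constant $C>0$ such that the inequality holds for all $x\in\operatorname{spt}(\mu)$ and all $0<r<R$. $\alpha_{\min}=\min_{i}\frac{\log p_i}{\log r_i}$ and $\alpha_{\max}=\max_{i}\frac{\log p_i}{\log r_i}$. For $q\in\mathbb{R}$, $\tau(q)$ is the unique real number with $\sum_{i=1}^m p_i^q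 r_i^{\tau(q)}=1$. For $\alpha\in[\alpha_{\min},\alpha_{\max}]$ put $f(\alpha)=\inf_{q\in\mathbb{R}}(\alpha q+\tau(q))$ and $\overline{f}(\alpha)=\max_{\alpha_{\min}\le\beta\le\alpha}f(\beta)$. *)

theory Defs
  imports "HOL-Probability.Probability"
begin

section \<open>Hausdorff dimension\<close>

(* Only used for s > 0: for s = 0 the convention 0 powr 0 = 0 would make the premeasure
   of every singleton vanish.  Finite covers are included by padding with the empty set.
   Boundedness is required since diameter is unspecified on unbounded sets. *)
definition hausdorff_premeasure :: "real \<Rightarrow> real \<Rightarrow> 'a::metric_space set \<Rightarrow> ennreal" where
  "hausdorff_premeasure s \<delta> A =
     Inf {(\<Sum>n. ennreal (diameter (V n) powr s)) | V :: nat \<Rightarrow> 'a set.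
            A \<subseteq> (\<Union>n. V n) \<and> (\<forall>n. bounded (V n) \<and> diameter (V n) \<le> \<delta>)}"

definition hausdorff_measure :: "real \<Rightarrow> 'a::metric_space set \<Rightarrow> ennreal" where
  "hausdorff_measure s A = (SUP \<delta>\<in>{0<..}. hausdorff_premeasure s \<delta> A)"

(* The infimum is taken in [-\<infinity>, \<infinity>], so that the infimum of the empty set is \<infinity>.
   The empty set has dimension 0. *)
definition hausdorff_dim :: "'a::metric_space set \<Rightarrow> ereal" where
  "hausdorff_dim A = Inf {ereal s | s. 0 < s \<and> hausdorff_measure s A = 0}"

section \<open>Self-similar sets and measures\<close>

(* The maps of an IFS are indexed by i in {1..m}; values of \<phi>, r and p at other
   indices are irrelevant. *)
definition self_similar_ifs :: "nat \<Rightarrow> (nat \<Rightarrow> 'a::euclidean_space \<Rightarrow> 'a) \<Rightarrow> (nat \<Rightarrow> real) \<Rightarrow> bool" where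
  "self_similar_ifs m \<phi> r \<longleftrightarrow>
     (\<forall>i\<in>{1..m}. 0 < r i \<and> r i < 1 \<and> (\<forall>x y. dist (\<phi> i x) (\<phi> i y) = r i * dist x y))"

definition open_set_condition :: "nat \<Rightarrow> (nat \<Rightarrow> 'a::euclidean_space \<Rightarrow> 'a) \<Rightarrow> bool" where
  "open_set_condition m \<phi> \<longleftrightarrow>
     (\<exists>U. U \<noteq> {} \<and> bounded U \<and> open U \<and>
          (\<forall>i\<in>{1..m}. \<phi> i ` U \<subseteq> U) \<and>
          (\<forall>i\<in>{1..m}. \<forall>j\<in>{1..m}. i \<noteq> j \<longrightarrow> \<phi> i ` U \<inter> \<phi> j ` U = {}))"

definition is_self_similar_set :: "nat \<Rightarrow> (nat \<Rightarrow> 'a::euclidean_space \<Rightarrow> 'a) \<Rightarrow> 'a set \<Rightarrow> bool" where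
  "is_self_similar_set m \<phi> X \<longleftrightarrow> X \<noteq> {} \<and> compact X \<and> X = (\<Union>i\<in>{1..m}. \<phi> i ` X)"

definition probability_vector :: "nat \<Rightarrow> (nat \<Rightarrow> real) \<Rightarrow> bool" where
  "probability_vector m p \<longleftrightarrow> (\<forall>i\<in>{1..m}. 0 \<le> p i) \<and> (\<Sum>i\<in>{1..m}. p i) = 1"

definition is_self_similar_measure ::
    "nat \<Rightarrow> (nat \<Rightarrow> 'a::euclidean_space \<Rightarrow> 'a) \<Rightarrow> (nat \<Rightarrow> real) \<Rightarrow> 'a measure \<Rightarrow> bool" where
  "is_self_similar_measure m \<phi> p \<mu> \<longleftrightarrow>
     prob_space \<mu> \<and> sets \<mu> = sets borel \<and>
     (\<forall>A\<in>sets borel. measure \<mu> A = (\<Sum>i\<in>{1..m}. p i * measure \<mu> (\<phi> i -` A)))"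

definition spt :: "'a::topological_space measure \<Rightarrow> 'a set" where
  "spt \<mu> = {x. \<forall>U. open U \<and> x \<in> U \<longrightarrow> emeasure \<mu> U > 0}"

section \<open>Assouad dimensions of measures\<close>

definition assouad_bound :: "'a::metric_space measure \<Rightarrow> 'a \<Rightarrow> real \<Rightarrow> real \<Rightarrow> bool" where
  "assouad_bound \<mu> x C s \<longleftrightarrow>
     (\<forall>r R. 0 < r \<and> r < R \<longrightarrow>
        measure \<mu> (cball x R) / measure \<mu> (cball x r) \<le> C * (R / r) powr s)"

definition assouad_dim_at :: "'a::metric_space measure \<Rightarrow> 'a \<Rightarrow> ereal" where
  "assouad_dim_at \<mu> x = Inf {ereal s | s. 0 < s \<and> (\<exists>C>0. assouad_bound \<mu> x C s)}"

definition assouad_dim :: "'a::metric_space measure \<Rightarrow> ereal" where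
  "assouad_dim \<mu> = Inf {ereal s | s. 0 < s \<and> (\<exists>C>0. \<forall>x\<in>spt \<mu>. assouad_bound \<mu> x C s)}"

definition assouad_level_set :: "'a::metric_space measure \<Rightarrow> ereal \<Rightarrow> 'a set" where
  "assouad_level_set \<mu> \<alpha> = {x \<in> spt \<mu>. assouad_dim_at \<mu> x = \<alpha>}"

definition assouad_sublevel_set :: "'a::metric_space measure \<Rightarrow> ereal \<Rightarrow> 'a set" where
  "assouad_sublevel_set \<mu> \<alpha> = {x \<in> spt \<mu>. assouad_dim_at \<mu> x \<le> \<alpha>}"

section \<open>The multifractal spectrum\<close>

definition alpha_min :: "nat \<Rightarrow> (nat \<Rightarrow> real) \<Rightarrow> (nat \<Rightarrow> real) \<Rightarrow> real" where
  "alpha_min m p r = Min ((\<lambda>i. ln (p i) / ln (r i)) ` {1..m})"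

definition alpha_max :: "nat \<Rightarrow> (nat \<Rightarrow> real) \<Rightarrow> (nat \<Rightarrow> real) \<Rightarrow> real" where
  "alpha_max m p r = Max ((\<lambda>i. ln (p i) / ln (r i)) ` {1..m})"

definition tau :: "nat \<Rightarrow> (nat \<Rightarrow> real) \<Rightarrow> (nat \<Rightarrow> real) \<Rightarrow> real \<Rightarrow> real" where
  "tau m p r q = (THE t. (\<Sum>i\<in>{1..m}. p i powr q * r i powr t) = 1)"

(* The infimum over q and the supremum below are formed in the extended reals, so neither
   depends on boundedness. *)
definition spectrum :: "nat \<Rightarrow> (nat \<Rightarrow> real) \<Rightarrow> (nat \<Rightarrow> real) \<Rightarrow> real \<Rightarrow> ereal" where
  "spectrum m p r \<alpha> = (INF q. ereal (\<alpha> * q + tau m p r q))"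

(* The supremum is a maximum, see spectrum_bar_attained. *)
definition spectrum_bar :: "nat \<Rightarrow> (nat \<Rightarrow> real) \<Rightarrow> (nat \<Rightarrow> real) \<Rightarrow> real \<Rightarrow> ereal" where
  "spectrum_bar m p r \<alpha> = (SUP \<beta>\<in>{alpha_min m p r..\<alpha>}. spectrum m p r \<beta>)"

lemma tau_exists_unique:
  fixes m :: nat and p r :: "nat \<Rightarrow> real"
  assumes "1 \<le> m" and p: "\<forall>i\<in>{1..m}. 0 < p i" and r: "\<forall>i\<in>{1..m}. 0 < r i \<and> r i < 1"
  shows "\<exists>!t. (\<Sum>i\<in>{1..m}. p i powr q * r i powr t) = 1"
proof -
  define g where "g t = (\<Sum>i\<in>{1..m}. p i powr q * r i powr t)" for t
  have ne: "{1..m} \<noteq> {}" using assms(1) by simp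
  have dec: "g t < g s" if "s < t" for s t
    unfolding g_def
  proof (rule sum_strict_mono)
    fix i assume "i \<in> {1..m}"
    then have "0 < p i" "0 < r i" "r i < 1" using p r by auto
    then show "p i powr q * r i powr t < p i powr q * r i powr s"
      using that by (simp add: powr_less_mono')
  qed (use ne in auto)
  define u where "u i = (ln (1 / real m) - q * ln (p i)) / ln (r i)" for i
  have u: "p i powr q * r i powr u i = 1 / real m" if "i \<in> {1..m}" for i
  proof -
    have "0 < p i" "0 < r i" "r i < 1" "0 < real m" using p r that by auto
    then have "p i powr q * r i powr u i = exp (ln (1 / real m))"
      by (simp add: powr_def u_def flip: exp_add)
    also have "\<dots> = 1 / real m" using \<open>0 < real m\<close> by (subst exp_ln) auto
    finally show ?thesis .
  qed
  define a b where "a = Min (u ` {1..m})" and "b = Max (u ` {1..m})"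
  have ab: "a \<le> u i" "u i \<le> b" if "i \<in> {1..m}" for i
    using that by (auto simp: a_def b_def)
  have sum1: "(\<Sum>i\<in>{1..m}. 1 / real m) = 1" using assms(1) by simp
  have "g b \<le> (\<Sum>i\<in>{1..m}. 1 / real m)"
    unfolding g_def
  proof (rule sum_mono)
    fix i assume i: "i \<in> {1..m}"
    have "r i powr b \<le> r i powr u i"
      using r i ab(2)[OF i] by (intro powr_mono') (auto simp: less_imp_le)
    then show "p i powr q * r i powr b \<le> 1 / real m"
      using u[OF i] by (metis mult_left_mono powr_ge_zero)
  qed
  moreover have "(\<Sum>i\<in>{1..m}. 1 / real m) \<le> g a"
    unfolding g_def
  proof (rule sum_mono)
    fix i assume i: "i \<in> {1..m}"
    have "r i powr u i \<le> r i powr a"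
      using r i ab(1)[OF i] by (intro powr_mono') (auto simp: less_imp_le)
    then show "1 / real m \<le> p i powr q * r i powr a"
      using u[OF i] by (metis mult_left_mono powr_ge_zero)
  qed
  moreover have "a \<le> b" using ne ab by (meson all_not_in_conv order_trans)
  moreover have "continuous_on {a..b} g"
    unfolding g_def using r by (intro continuous_intros) force+
  ultimately obtain t where "g t = 1"
    using IVT2'[of g b 1 a] sum1 by auto
  moreover have "s = t" if "g s = 1" "g t = 1" for s t
    using dec[of s t] dec[of t s] that by (cases s t rule: linorder_cases) auto
  ultimately show ?thesis unfolding g_def by blast
qed

lemma spectrum_bar_attained:
  assumes "alpha_min m p r \<le> \<alpha>"
  shows "\<exists>\<beta>\<in>{alpha_min m p r..\<alpha>}. spectrum_bar m p r \<alpha> = spectrum m p r \<beta>"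
proof -
  let ?K = "{alpha_min m p r..\<alpha>}" and ?f = "spectrum m p r"
  have "?f ` ?K \<noteq> {}" using assms by auto
  then obtain y :: "nat \<Rightarrow> ereal" where y: "incseq y" "range y \<subseteq> ?f ` ?K" "Sup (?f ` ?K) = (SUP n. y n)"
    using Sup_countable_SUP by metis
  have "\<forall>n. \<exists>b\<in>?K. y n = ?f b" using y(2) by blast
  then obtain b where b: "\<And>n. b n \<in> ?K" "\<And>n. y n = ?f (b n)" by metis
  obtain l h where l: "l \<in> ?K" "strict_mono h" "(b \<circ> h) \<longlonglongrightarrow> l"
    using compact_Icc[of "alpha_min m p r" \<alpha>] b(1) unfolding compact_def by meson
  have lim: "(\<lambda>n. y (h n)) \<longlonglongrightarrow> spectrum_bar m p r \<alpha>"
    using LIMSEQ_subseq_LIMSEQ[OF LIMSEQ_SUP[OF y(1)] l(2)] y(3)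
    by (simp add: spectrum_bar_def o_def)
  have "spectrum_bar m p r \<alpha> \<le> ?f l"
    unfolding spectrum_def
  proof (rule INF_greatest)
    fix q
    have "(\<lambda>n. ereal (b (h n) * q + tau m p r q)) \<longlonglongrightarrow> ereal (l * q + tau m p r q)"
      using l(3) by (auto intro!: tendsto_intros simp: o_def)
    moreover have "y (h n) \<le> ereal (b (h n) * q + tau m p r q)" for n
      unfolding b(2) spectrum_def by (rule INF_lower) simp
    ultimately show "spectrum_bar m p r \<alpha> \<le> ereal (l * q + tau m p r q)"
      using lim by (intro LIMSEQ_le[OF lim]) blast+
  qed
  moreover have "?f l \<le> spectrum_bar m p r \<alpha>"
    unfolding spectrum_bar_def using l(1) by (rule SUP_upper)
  ultimately show ?thesis using l(1) by (intro bexI[of _ l]) auto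
qed

end

theory Submission
  imports Defs "HOL-Library.Sublist"
begin

text \<open>
  Write \<open>r\<^sub>w\<close>, \<open>p\<^sub>w\<close> and \<open>X\<^sub>w\<close> for the contraction ratio, the weight and the cylinder of a word \<open>w\<close>.
  Iterating the invariance of \<open>\<mu>\<close> shows that \<open>\<mu>\<close> lives on \<open>X\<close>, that \<open>X\<^sub>w\<close> has mass at least \<open>p\<^sub>w\<close>, and
  that a ball of radius \<open>R\<close> has mass at most the sum of the \<open>p\<^sub>u\<close> over the cylinders of size about
  \<open>R\<close> that it meets. The open set condition enters only through the fact that the number of these
  cylinders is bounded (\<open>antichain_count\<close>). A word with the largest number of neighbours of its own
  size is an isolator: if \<open>v\<close> is that word, then \<open>X\<^sub>a\<^sub>v\<close> stays away from \<open>X\<^sub>u\<close> for all words \<open>u\<close>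
  that are incomparable with \<open>a\<close> (\<open>isolating_word_exists\<close>, an argument of Bandt, Graf and Schief). At
  points whose code shows \<open>v\<close> after \<open>a\<close>, the mass of a ball of size about \<open>r\<^sub>a\<close> is therefore
  \<open>p\<^sub>a\<close> up to a constant.

  Possible values. The mass of a ball of radius \<open>R\<close> is at most a constant times \<open>R\<close> to the power \<open>\<alpha>\<^sub>m\<^sub>i\<^sub>n\<close>, so no point
  has a smaller dimension. If a point has finite dimension, its dimension is at most \<open>\<alpha>\<^sub>m\<^sub>a\<^sub>x\<close>: the
  heaviest cylinder near a ball loses mass at rate at most \<open>\<alpha>\<^sub>m\<^sub>a\<^sub>x\<close>, and a pigeonhole argument over
  rapidly decreasing scales shows that changing from one heaviest cylinder to another is too rare to
  affect the exponent (\<open>assouad_bound_finite_imp_amax\<close>). If the global dimension exceeds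
  \<open>\<alpha>\<^sub>m\<^sub>a\<^sub>x\<close>, then there are adjacent cylinders of comparable size with arbitrarily large mass ratio, and
  reproducing such a pair inside the cylinders of a point forces its dimension to be infinite. So the
  global dimension is \<open>\<alpha>\<^sub>m\<^sub>a\<^sub>x\<close> or \<open>\<infinity>\<close>, and it is attained at every point whose code contains certain
  countably many words (\<open>bad_words_exist\<close>).

  Upper bounds. A point of dimension at most \<open>\<alpha>\<close> has balls of mass at least about \<open>R\<close> to the power
  \<open>\<alpha>\<close>. For \<open>q \<ge> 0\<close>, the weights \<open>p\<^sub>w\<close> to the power \<open>q\<close> times \<open>r\<^sub>w\<close> to the power \<open>\<tau> q\<close> sum to
  one over a partition into cylinders, which limits the number of heavy cylinders and gives the bound
  \<open>\<alpha> q + \<tau> q\<close> for the dimension (\<open>dim_sublevel_le\<close>). By convexity of \<open>\<tau>\<close>, in the form of Gibbs'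
  inequality \<open>tangent\<close>, the infimum over \<open>q \<ge> 0\<close> is the increasing hull of the spectrum.

  Lower bounds. Concatenating words of one letter count, chosen near the Gibbs weights
  (\<open>homogeneous_blocks\<close>) and followed by the isolator, gives Cantor sets whose dimension is close to
  the spectrum and on which masses at different scales can be compared exactly, since all blocks have
  the same ratio and the same mass. Rare insertions of a further block tune the pointwise dimension
  to be exactly \<open>\<alpha>\<close> (\<open>dim_level_mid_ge\<close>), and rare insertions of the countably many special words give
  the global dimension (\<open>dim_level_top_ge\<close>); rare insertions lower the Hausdorff dimension arbitrarily little
  (\<open>dim_mixed_blocks_ge\<close>). At \<open>\<alpha>\<^sub>m\<^sub>i\<^sub>n\<close> the isolator is too light to be repeated; there the letters of
  minimal exponent suffice, because no neighbouring cylinder can be heavier.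
\<close>

section \<open>Words and cut sets\<close>

definition wt :: "(nat \<Rightarrow> real) \<Rightarrow> nat list \<Rightarrow> real" where
  "wt f w = prod_list (map f w)"

lemma wt_simps [simp]:
  "wt f [] = 1" "wt f (i # w) = f i * wt f w" "wt f (u @ w) = wt f u * wt f w"
  by (simp_all add: wt_def)

lemma wt_pos: "w \<in> lists J \<Longrightarrow> (\<And>i. i \<in> J \<Longrightarrow> 0 < f i) \<Longrightarrow> 0 < wt f w"
  by (induction w) auto

lemma wt_mset: "mset u = mset w \<Longrightarrow> wt f u = wt f w"
  by (simp add: wt_def flip: prod_mset_prod_list)

lemma wt_le_power:
  assumes "w \<in> lists J" "\<And>i. i \<in> J \<Longrightarrow> 0 \<le> f i \<and> f i \<le> c"
  shows "wt f w \<le> c ^ length w"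
  using assms(1)
proof (induction w)
  case (Cons i w)
  then have i: "0 \<le> f i" "f i \<le> c" and "0 \<le> wt f w"
    using assms(2) by (auto simp: wt_def intro!: prod_list_nonneg)
  then show ?case using Cons by (auto intro!: mult_mono)
qed simp

lemma wt_powr:
  "w \<in> lists J \<Longrightarrow> (\<And>i. i \<in> J \<Longrightarrow> 0 < f i) \<Longrightarrow> wt (\<lambda>i. f i powr t) w = wt f w powr t"
proof (induction w)
  case (Cons i w)
  then show ?case using wt_pos[of w J f] by (simp add: powr_mult less_imp_le)
qed simp

lemma wt_mult: "wt (\<lambda>i. f i * g i) w = wt f w * wt g w"
  by (induction w) (auto simp: algebra_simps)

lemma wt_replicate: "wt f (replicate n i) = f i ^ n"
  by (induction n) auto

definition antichain :: "nat list set \<Rightarrow> bool" where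
  "antichain Q \<longleftrightarrow> (\<forall>u\<in>Q. \<forall>w\<in>Q. prefix u w \<longrightarrow> u = w)"

lemma antichain_subset: "antichain Q \<Longrightarrow> Q' \<subseteq> Q \<Longrightarrow> antichain Q'"
  by (auto simp: antichain_def)

text \<open>The sets of leaves of the finite complete trees over the alphabet; every infinite
  code passes through exactly one leaf of such a tree, which is why the weights of the leaves sum to
  one.\<close>
inductive cut :: "nat set \<Rightarrow> nat list set \<Rightarrow> bool" for J where
  root: "cut J {[]}"
| branch: "(\<And>i. i \<in> J \<Longrightarrow> cut J (C i)) \<Longrightarrow> cut J (\<Union>i\<in>J. (#) i ` C i)"

lemma cut_sum_gen:
  assumes "cut J Q" "finite J"
    and "\<And>w. w \<in> lists J \<Longrightarrow> h w = (\<Sum>i\<in>J. h (w @ [i]))"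
  shows "finite Q \<and> Q \<subseteq> lists J \<and> (\<Sum>w\<in>Q. h w) = h []"
  using assms(1,3)
proof (induction arbitrary: h)
  case root
  then show ?case by simp
next
  case (branch C)
  have IH: "finite (C i)" "C i \<subseteq> lists J" "(\<Sum>w\<in>C i. h (i # w)) = h [i]" if "i \<in> J" for i
  proof -
    have "h (i # w) = (\<Sum>j\<in>J. h (i # (w @ [j])))" if "w \<in> lists J" for w
      using branch.prems[of "i # w"] that \<open>i \<in> J\<close> by simp
    then show "finite (C i)" "C i \<subseteq> lists J" "(\<Sum>w\<in>C i. h (i # w)) = h [i]"
      using branch.IH[OF that, of "\<lambda>w. h (i # w)"] by blast+
  qed
  have "(\<Sum>w\<in>(\<Union>i\<in>J. (#) i ` C i). h w) = (\<Sum>i\<in>J. \<Sum>w\<in>(#) i ` C i. h w)"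
    using assms(2) IH(1) by (intro sum.UNION_disjoint) auto
  also have "\<dots> = (\<Sum>i\<in>J. \<Sum>w\<in>C i. h (i # w))"
    by (rule sum.cong) (simp_all add: sum.reindex)
  also have "\<dots> = (\<Sum>i\<in>J. h [i])" using IH by simp
  also have "\<dots> = h []" using branch.prems[of "[]"] by simp
  finally have "(\<Sum>w\<in>(\<Union>i\<in>J. (#) i ` C i). h w) = h []" .
  moreover have "(#) i ` C i \<subseteq> lists J" if "i \<in> J" for i
    using IH(2)[OF that] that by (force simp: image_subset_iff)
  ultimately show ?case using IH(1) assms(2) by blast
qed

lemma cut_sum:
  assumes "cut J Q" "finite J" "(\<Sum>i\<in>J. f i) = 1"
  shows "(\<Sum>w\<in>Q. wt f w) = 1"
proof -
  have "wt f w = (\<Sum>i\<in>J. wt f (w @ [i]))" for w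
    using assms(3) by (simp flip: sum_distrib_left)
  then show ?thesis using cut_sum_gen[OF assms(1,2), of "wt f"] by simp
qed

lemma cut_finite: "cut J Q \<Longrightarrow> finite J \<Longrightarrow> finite Q"
  and cut_lists: "cut J Q \<Longrightarrow> finite J \<Longrightarrow> Q \<subseteq> lists J"
  using cut_sum_gen[of J Q "\<lambda>w. 0"] by auto

definition level :: "nat set \<Rightarrow> nat \<Rightarrow> nat list set" where
  "level J n = {w \<in> lists J. length w = n}"

lemma level_Suc: "level J (Suc n) = (\<Union>i\<in>J. (#) i ` level J n)"
  by (auto simp: level_def length_Suc_conv image_iff)

lemma cut_level: "cut J (level J n)"
proof (induction n)
  case 0
  have "level J 0 = {[]}" by (auto simp: level_def)
  then show ?case by (simp add: cut.root)
next
  case (Suc n)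
  then show ?case unfolding level_Suc by (intro cut.branch)
qed

text \<open>The usual stopping set at scale \<open>\<rho>\<close>, which cuts the attractor into pieces of comparable
  size. Ratios decrease along prefixes, so the condition on the immediate prefix covers all proper
  prefixes.\<close>
definition stopping :: "nat set \<Rightarrow> (nat \<Rightarrow> real) \<Rightarrow> real \<Rightarrow> nat list set" where
  "stopping J r \<rho> = {w \<in> lists J. wt r w \<le> \<rho> \<and> (w \<noteq> [] \<longrightarrow> \<rho> < wt r (butlast w))}"

locale ratios =
  fixes J :: "nat set" and r :: "nat \<Rightarrow> real"
  assumes J_fin: "finite J" and J_ne: "J \<noteq> {}" and r01: "\<And>i. i \<in> J \<Longrightarrow> 0 < r i \<and> r i < 1"
begin

definition rmin where "rmin = Min (r ` J)"
definition rmax where "rmax = Max (r ` J)"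

lemma rmin_rmax: "0 < rmin" "rmin \<le> rmax" "rmax < 1" "\<And>i. i \<in> J \<Longrightarrow> rmin \<le> r i \<and> r i \<le> rmax"
proof -
  show *: "\<And>i. i \<in> J \<Longrightarrow> rmin \<le> r i \<and> r i \<le> rmax" using J_fin by (auto simp: rmin_def rmax_def)
  show "0 < rmin" "rmax < 1" using J_fin J_ne r01 by (auto simp: rmin_def rmax_def)
  show "rmin \<le> rmax" using * J_ne by fastforce
qed

lemma rmin_lt1: "rmin < 1" using rmin_rmax by linarith

lemma wt_r_pos: "w \<in> lists J \<Longrightarrow> 0 < wt r w"
  using r01 by (auto intro: wt_pos)

lemma wt_r_power: "w \<in> lists J \<Longrightarrow> wt r w \<le> rmax ^ length w"
  using rmin_rmax r01 by (intro wt_le_power) (auto simp: less_imp_le)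

lemma wt_r_le1: "w \<in> lists J \<Longrightarrow> wt r w \<le> 1"
  using wt_r_power[of w] rmin_rmax power_le_one[of rmax "length w"] by linarith

lemma wt_r_lt1: "w \<in> lists J \<Longrightarrow> w \<noteq> [] \<Longrightarrow> wt r w < 1"
proof (cases w)
  case (Cons i u)
  assume "w \<in> lists J"
  then have "0 < r i" "r i < 1" "wt r u \<le> 1" "0 < wt r u"
    using Cons r01 wt_r_le1 wt_r_pos by auto
  then have "r i * wt r u < 1"
    by (metis mult_left_le less_le_not_le order.strict_trans1)
  then show ?thesis using Cons by simp
qed simp

lemma wt_r_prefix: "w \<in> lists J \<Longrightarrow> prefix u w \<Longrightarrow> wt r w \<le> wt r u"
proof -
  assume "w \<in> lists J" "prefix u w"
  then obtain z where "w = u @ z" by (auto elim: prefixE)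
  with \<open>w \<in> lists J\<close> have z: "w = u @ z" "u \<in> lists J" "z \<in> lists J" by simp_all
  then show ?thesis using wt_r_le1[of z] wt_r_pos[of u] by (simp add: mult_left_le)
qed

lemma stopping_root: "1 \<le> \<rho> \<Longrightarrow> stopping J r \<rho> = {[]}"
proof -
  assume "1 \<le> \<rho>"
  moreover have "wt r (butlast w) \<le> 1" if "w \<in> lists J" for w
    using that by (intro wt_r_le1) (auto simp: in_lists_conv_set dest: in_set_butlastD)
  ultimately show ?thesis by (force simp: stopping_def)
qed

lemma stopping_branch:
  assumes "\<rho> < 1"
  shows "stopping J r \<rho> = (\<Union>i\<in>J. (#) i ` stopping J r (\<rho> / r i))" (is "_ = ?R")
proof -
  have eq: "i # w \<in> stopping J r \<rho> \<longleftrightarrow> i \<in> J \<and> w \<in> stopping J r (\<rho> / r i)" for i w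
    using r01[of i] assms by (auto simp: stopping_def field_simps)
  have "w \<in> stopping J r \<rho> \<longleftrightarrow> w \<in> ?R" for w
  proof (cases w)
    case Nil
    then show ?thesis using assms by (auto simp: stopping_def)
  next
    case (Cons i u)
    then show ?thesis using eq by auto
  qed
  then show ?thesis by blast
qed

lemma cut_stopping:
  assumes "0 < \<rho>" shows "cut J (stopping J r \<rho>)"
proof -
  have *: "rmax ^ k \<le> \<rho> \<Longrightarrow> cut J (stopping J r \<rho>)" for k \<rho>
  proof (induction k arbitrary: \<rho>)
    case 0
    then show ?case by (simp add: stopping_root cut.root)
  next
    case (Suc k)
    show ?case
    proof (cases "1 \<le> \<rho>")
      case True
      then show ?thesis by (simp add: stopping_root cut.root)
    next
      case False
      have "cut J (stopping J r (\<rho> / r i))" if "i \<in> J" for i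
      proof (rule Suc.IH)
        have i: "0 < r i" "r i \<le> rmax" using that r01 rmin_rmax by auto
        have "rmax ^ k * r i \<le> rmax ^ k * rmax"
          using i rmin_rmax by (intro mult_left_mono) auto
        then have "rmax ^ k * r i \<le> \<rho>" using Suc.prems by (simp add: mult.commute)
        then show "rmax ^ k \<le> \<rho> / r i" using i by (simp add: field_simps)
      qed
      then show ?thesis using False by (simp add: stopping_branch cut.branch)
    qed
  qed
  obtain k where "rmax ^ k < \<rho>"
    using real_arch_pow_inv[OF assms rmin_rmax(3)] by blast
  then show ?thesis using * by (meson less_imp_le)
qed

lemma stopping_words: "w \<in> stopping J r \<rho> \<Longrightarrow> w \<in> lists J"
  and stopping_le: "w \<in> stopping J r \<rho> \<Longrightarrow> wt r w \<le> \<rho>"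
  by (auto simp: stopping_def)

lemma stopping_ge:
  assumes "w \<in> stopping J r \<rho>" "\<rho> \<le> 1" shows "rmin * \<rho> \<le> wt r w"
proof (cases w rule: rev_cases)
  case Nil
  have "rmin * \<rho> \<le> rmin * 1" using assms(2) rmin_rmax(1) by (intro mult_left_mono) auto
  then show ?thesis using Nil rmin_lt1 by simp
next
  case (snoc u i)
  then have "i \<in> J" "u \<in> lists J" "\<rho> < wt r u" using assms by (auto simp: stopping_def)
  then have "rmin \<le> r i" "0 \<le> wt r u" "0 < rmin" using rmin_rmax wt_r_pos by (auto simp: less_imp_le)
  then have "rmin * \<rho> \<le> rmin * wt r u" "rmin * wt r u \<le> r i * wt r u"
    using \<open>\<rho> < wt r u\<close> by (auto intro: mult_left_mono mult_right_mono)
  then show ?thesis using snoc by (simp add: mult.commute)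
qed

lemma stopping_antichain: "antichain (stopping J r \<rho>)"
proof -
  have "u = w" if "u \<in> stopping J r \<rho>" "w \<in> stopping J r \<rho>" "prefix u w" for u w
  proof (rule ccontr)
    assume "u \<noteq> w"
    then have "prefix u (butlast w)" "w \<noteq> []"
      using that(3) by (cases w rule: rev_cases; simp)+
    then have "wt r (butlast w) \<le> wt r u"
      using that(2) by (intro wt_r_prefix) (auto simp: stopping_def in_lists_conv_set dest: in_set_butlastD)
    then show False using that \<open>w \<noteq> []\<close> by (auto simp: stopping_def)
  qed
  then show ?thesis by (auto simp: antichain_def)
qed

lemma stopping_prefix_exists:
  assumes "w \<in> lists J" "wt r w \<le> \<rho>"
  shows "\<exists>u\<in>stopping J r \<rho>. prefix u w"
  using assms
proof (induction w rule: rev_induct)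
  case Nil
  then show ?case by (auto simp: stopping_def)
next
  case (snoc i w)
  show ?case
  proof (cases "wt r w \<le> \<rho>")
    case True
    then obtain u where "u \<in> stopping J r \<rho>" "prefix u w" using snoc by auto
    then show ?thesis by (meson prefix_prefix)
  next
    case False
    then show ?thesis using snoc.prems by (intro bexI[of _ "w @ [i]"]) (auto simp: stopping_def)
  qed
qed

lemma stopping_extend:
  assumes "u \<in> stopping J r \<rho>" "a \<in> lists J" "\<rho> < 1"
  shows "a @ u \<in> stopping J r (wt r a * \<rho>)"
proof -
  have "u \<noteq> []" using assms by (auto simp: stopping_def)
  then show ?thesis using assms wt_r_pos[of a] by (auto simp: stopping_def butlast_append)
qed

end

section \<open>The open set condition\<close>

locale osc_ifs = ratios J r for J r +
  fixes \<phi> :: "nat \<Rightarrow> 'a::euclidean_space \<Rightarrow> 'a" and X :: "'a set"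
  assumes phi_dist: "\<And>i x y. i \<in> J \<Longrightarrow> dist (\<phi> i x) (\<phi> i y) = r i * dist x y"
    and osc: "\<exists>U. U \<noteq> {} \<and> open U \<and> (\<forall>i\<in>J. \<phi> i ` U \<subseteq> U) \<and>
                  (\<forall>i\<in>J. \<forall>j\<in>J. i \<noteq> j \<longrightarrow> \<phi> i ` U \<inter> \<phi> j ` U = {})"
    and X_ne: "X \<noteq> {}" and X_compact: "compact X" and X_eq: "X = (\<Union>i\<in>J. \<phi> i ` X)"
    and X_diam: "diameter X = 1"
begin

definition cyl :: "nat list \<Rightarrow> 'a set" where
  "cyl w = foldr \<phi> w ` X"

lemma word_dist: "w \<in> lists J \<Longrightarrow> dist (foldr \<phi> w x) (foldr \<phi> w y) = wt r w * dist x y"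
  by (induction w) (auto simp: phi_dist)

lemma X_dist: "x \<in> X \<Longrightarrow> y \<in> X \<Longrightarrow> dist x y \<le> 1"
  using diameter_bounded_bound[of X x y] X_compact X_diam compact_imp_bounded by auto

lemma X_pair: "\<exists>x\<in>X. \<exists>y\<in>X. dist x y = 1"
  using diameter_compact_attained[OF X_compact X_ne] X_diam by simp

lemma cyl_Nil [simp]: "cyl [] = X"
  by (simp add: cyl_def)

lemma cyl_append: "cyl (u @ w) = foldr \<phi> u ` cyl w"
  by (auto simp: cyl_def image_image)

lemma cyl_Cons: "cyl (i # w) = \<phi> i ` cyl w"
  by (auto simp: cyl_def image_image)

lemma cyl_ne: "cyl w \<noteq> {}"
  using X_ne by (simp add: cyl_def)

lemma cyl_subset_X: "w \<in> lists J \<Longrightarrow> cyl w \<subseteq> X"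
proof (induction w)
  case (Cons i w)
  then have "\<phi> i ` cyl w \<subseteq> \<phi> i ` X" "\<phi> i ` X \<subseteq> X" using X_eq by auto
  then show ?case by (auto simp: cyl_Cons)
qed simp

lemma cyl_prefix:
  assumes "w \<in> lists J" "prefix u w" shows "cyl w \<subseteq> cyl u"
proof -
  obtain z where z: "w = u @ z" using assms(2) by (auto elim: prefixE)
  then have "z \<in> lists J" using assms(1) by simp
  then show ?thesis unfolding z cyl_append using cyl_subset_X[of z] by (auto simp: cyl_def)
qed

lemma word_continuous: "w \<in> lists J \<Longrightarrow> continuous_on UNIV (foldr \<phi> w)"
proof -
  assume w: "w \<in> lists J"
  have "(wt r w)-lipschitz_on UNIV (foldr \<phi> w)"
    using wt_r_pos[OF w] by (intro lipschitz_onI) (auto simp: word_dist[OF w] less_imp_le)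
  then show ?thesis by (rule lipschitz_on_continuous_on)
qed

lemma cyl_compact: "w \<in> lists J \<Longrightarrow> compact (cyl w)"
  unfolding cyl_def
  by (intro compact_continuous_image continuous_on_subset[OF word_continuous] X_compact) auto

lemma cyl_dist:
  assumes "w \<in> lists J" "x \<in> cyl w" "y \<in> cyl w" shows "dist x y \<le> wt r w"
proof -
  obtain x' y' where "x' \<in> X" "y' \<in> X" "x = foldr \<phi> w x'" "y = foldr \<phi> w y'"
    using assms by (auto simp: cyl_def)
  then show ?thesis
    using assms(1) X_dist[of x' y'] wt_r_pos[of w] by (simp add: word_dist mult_left_le)
qed

lemma cut_cover: "cut J Q \<Longrightarrow> X \<subseteq> (\<Union>w\<in>Q. cyl w)"
proof (induction rule: cut.induct)
  case (branch C)
  show ?case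
  proof
    fix x assume "x \<in> X"
    then obtain i y where i: "i \<in> J" "y \<in> X" "x = \<phi> i y" using X_eq by blast
    then obtain w where "w \<in> C i" "y \<in> cyl w" using branch by blast
    then show "x \<in> (\<Union>w\<in>(\<Union>i\<in>J. (#) i ` C i). cyl w)"
      using i by (auto simp: cyl_Cons)
  qed
qed simp

lemma cyl_cut:
  assumes "cut J Q" "x \<in> cyl a" shows "\<exists>z\<in>Q. x \<in> cyl (a @ z)"
proof -
  obtain y where "y \<in> X" "x = foldr \<phi> a y" using assms(2) by (auto simp: cyl_def)
  then show ?thesis using cut_cover[OF assms(1)] by (force simp: cyl_append)
qed

lemma cyl_refine:
  assumes "a \<in> lists J" "x \<in> cyl a" "0 < \<rho>" "\<rho> \<le> wt r a"
  shows "\<exists>z\<in>lists J. x \<in> cyl (a @ z) \<and> rmin * \<rho> \<le> wt r (a @ z) \<and> wt r (a @ z) \<le> \<rho>"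
proof -
  have ra: "0 < wt r a" using assms(1) wt_r_pos by simp
  obtain z where z: "z \<in> stopping J r (\<rho> / wt r a)" "x \<in> cyl (a @ z)"
    using cyl_cut[OF cut_stopping assms(2)] assms(3) ra by (meson divide_pos_pos)
  have "wt r z \<le> \<rho> / wt r a" using z by (auto dest: stopping_le)
  moreover have "rmin * (\<rho> / wt r a) \<le> wt r z"
    using stopping_ge[OF z(1)] assms(4) ra by simp
  ultimately show ?thesis
    using ra z(2) stopping_words[OF z(1)] by (intro bexI[of _ z]) (auto simp: field_simps)
qed

lemma word_image_ball:
  assumes w: "w \<in> lists J"
  shows "ball (foldr \<phi> w x) (wt r w * e) \<subseteq> foldr \<phi> w ` ball x e"
proof
  fix y assume y: "y \<in> ball (foldr \<phi> w x) (wt r w * e)"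
  define c where "c = wt r w"
  have c: "0 < c" using wt_r_pos[OF w] by (simp add: c_def)
  define g where "g z = (1 / c) *\<^sub>R (foldr \<phi> w z - foldr \<phi> w 0)" for z
  have "dist (g a) (g b) = dist a b" for a b
  proof -
    have "g a - g b = (1 / c) *\<^sub>R (foldr \<phi> w a - foldr \<phi> w b)"
      by (simp add: g_def algebra_simps)
    then have "dist (g a) (g b) = (1 / c) * dist (foldr \<phi> w a) (foldr \<phi> w b)"
      using c by (simp add: dist_norm)
    then show ?thesis using c by (simp add: word_dist[OF w] c_def)
  qed
  then have "orthogonal_transformation g"
    unfolding orthogonal_transformation_isometry by (simp add: g_def)
  then have "surj g" by (rule orthogonal_transformation_surj)
  then obtain z where "(1 / c) *\<^sub>R (y - foldr \<phi> w 0) = g z" by (metis surjD)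
  then have z: "foldr \<phi> w z = y" using c by (simp add: g_def)
  have "c * dist x z < c * e" using y z by (auto simp: word_dist[OF w] c_def)
  then have "z \<in> ball x e" using c by simp
  then show "y \<in> foldr \<phi> w ` ball x e" using z by blast
qed

lemma words_disjoint:
  assumes U: "\<forall>i\<in>J. \<phi> i ` U \<subseteq> U" "\<forall>i\<in>J. \<forall>j\<in>J. i \<noteq> j \<longrightarrow> \<phi> i ` U \<inter> \<phi> j ` U = {}"
    and "u \<in> lists J" "w \<in> lists J" "\<not> prefix u w" "\<not> prefix w u"
  shows "foldr \<phi> u ` U \<inter> foldr \<phi> w ` U = {}"
  using assms(3-)
proof (induction u arbitrary: w)
  case (Cons i u)
  then obtain j w' where w: "w = j # w'" by (cases w) auto
  have iJ: "i \<in> J" "u \<in> lists J" and jJ: "j \<in> J" "w' \<in> lists J" using Cons.hyps Cons.prems(1) w by auto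
  have sub: "foldr \<phi> v ` U \<subseteq> U" if "v \<in> lists J" for v
    using that
  proof (induction v)
    case (Cons k v)
    then have "\<phi> k ` foldr \<phi> v ` U \<subseteq> \<phi> k ` U" "\<phi> k ` U \<subseteq> U" using U by auto
    then show ?case by (auto simp: image_image)
  qed simp
  have iu: "foldr \<phi> (i # u) ` U = \<phi> i ` foldr \<phi> u ` U" and jw: "foldr \<phi> w ` U = \<phi> j ` foldr \<phi> w' ` U"
    using w by (auto simp: image_image)
  show ?case
  proof (cases "i = j")
    case True
    have "inj (\<phi> i)"
    proof (rule injI)
      fix x y assume "\<phi> i x = \<phi> i y"
      then show "x = y" using phi_dist[of i x y] r01[of i] iJ by auto
    qed
    moreover have "foldr \<phi> u ` U \<inter> foldr \<phi> w' ` U = {}"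
      using Cons.IH[of w'] Cons.prems iJ jJ w True by auto
    ultimately show ?thesis using True unfolding iu jw by (simp flip: image_Int)
  next
    case False
    then have "\<phi> i ` U \<inter> \<phi> j ` U = {}" using U(2) iJ jJ by auto
    moreover have "\<phi> i ` foldr \<phi> u ` U \<subseteq> \<phi> i ` U" "\<phi> j ` foldr \<phi> w' ` U \<subseteq> \<phi> j ` U"
      using sub[of u] sub[of w'] iJ jJ by auto
    ultimately show ?thesis unfolding iu jw by blast
  qed
qed simp

text \<open>A point \<open>o'\<close> of the open set lies in it together with a ball. The images of this ball under the
  words of an antichain are disjoint, so the images of \<open>o'\<close>, rescaled by \<open>1 / \<rho>\<close>, are separated
  points of a fixed compact ball.\<close>
lemma antichain_count:
  "\<exists>N>0. \<forall>\<rho>>0. \<forall>x. \<forall>Q \<subseteq> lists J. antichain Q \<longrightarrow>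
     (\<forall>u\<in>Q. rmin * \<rho> \<le> wt r u \<and> wt r u \<le> \<rho> \<and> cyl u \<inter> cball x (2 * \<rho>) \<noteq> {}) \<longrightarrow>
     finite Q \<and> card Q \<le> N"
proof -
  obtain U where U: "U \<noteq> {}" "open U" "\<forall>i\<in>J. \<phi> i ` U \<subseteq> U"
      "\<forall>i\<in>J. \<forall>j\<in>J. i \<noteq> j \<longrightarrow> \<phi> i ` U \<inter> \<phi> j ` U = {}" using osc by blast
  obtain o' \<eta> where o: "o' \<in> U" "0 < \<eta>" "ball o' \<eta> \<subseteq> U"
    using U by (meson all_not_in_conv openE)
  obtain D where D: "\<And>y. y \<in> X \<Longrightarrow> dist o' y \<le> D"
    using X_compact compact_imp_bounded bounded_any_center[of X o'] by auto
  have D0: "0 \<le> D" using D X_ne by (metis all_not_in_conv order_trans zero_le_dist)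
  define e where "e = \<eta> * rmin / 2"
  have e: "0 < e" using o rmin_rmax by (simp add: e_def)
  obtain K where K: "finite K" "cball (0::'a) (2 + D) \<subseteq> (\<Union>k\<in>K. ball k e)"
  proof -
    have "compact (cball (0::'a) (2 + D))" by simp
    then show ?thesis using e that unfolding compact_eq_totally_bounded by meson
  qed
  have main: "finite Q \<and> card Q \<le> card K + 1"
    if \<rho>: "0 < \<rho>" and Q: "Q \<subseteq> lists J" "antichain Q"
      and H: "\<forall>u\<in>Q. rmin * \<rho> \<le> wt r u \<and> wt r u \<le> \<rho> \<and> cyl u \<inter> cball x (2 * \<rho>) \<noteq> {}" for \<rho> x Q
  proof -
    define pt where "pt u = (1 / \<rho>) *\<^sub>R (foldr \<phi> u o' - x)" for u
    have pt_dist: "dist (pt u) (pt w) = dist (foldr \<phi> u o') (foldr \<phi> w o') / \<rho>" for u w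
    proof -
      have "pt u - pt w = (1 / \<rho>) *\<^sub>R (foldr \<phi> u o' - foldr \<phi> w o')"
        by (simp add: pt_def algebra_simps)
      then show ?thesis using \<rho> by (simp add: dist_norm)
    qed
    have pt_in: "pt u \<in> cball 0 (2 + D)" if u: "u \<in> Q" for u
    proof -
      obtain y where y: "y \<in> X" "dist x (foldr \<phi> u y) \<le> 2 * \<rho>"
        using H u by (fastforce simp: cyl_def)
      have "u \<in> lists J" using u Q by blast
      then have "dist (foldr \<phi> u o') (foldr \<phi> u y) = wt r u * dist o' y" by (rule word_dist)
      also have "\<dots> \<le> \<rho> * D"
        using D[OF y(1)] H u \<rho> by (intro mult_mono) auto
      finally have "dist (foldr \<phi> u o') (foldr \<phi> u y) \<le> \<rho> * D" .
      then have "dist x (foldr \<phi> u o') \<le> 2 * \<rho> + \<rho> * D"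
        using y dist_triangle2[of x "foldr \<phi> u o'" "foldr \<phi> u y"] by (smt (verit))
      then have "norm (foldr \<phi> u o' - x) \<le> \<rho> * (2 + D)"
        by (simp add: dist_norm norm_minus_commute algebra_simps)
      then have "norm (pt u) \<le> 2 + D" using \<rho> by (simp add: pt_def divide_le_eq mult.commute)
      then show ?thesis by simp
    qed
    have sep: "2 * e \<le> dist (pt u) (pt w)" if uw: "u \<in> Q" "w \<in> Q" "u \<noteq> w" for u w
    proof -
      have "foldr \<phi> u ` U \<inter> foldr \<phi> w ` U = {}"
        using words_disjoint[OF U(3,4)] Q uw unfolding antichain_def by blast
      moreover have "ball (foldr \<phi> u o') (wt r u * \<eta>) \<subseteq> foldr \<phi> u ` U"
        using word_image_ball[of u o' \<eta>] uw Q o by blast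
      moreover have "foldr \<phi> w o' \<in> foldr \<phi> w ` U" using o by blast
      ultimately have "foldr \<phi> w o' \<notin> ball (foldr \<phi> u o') (wt r u * \<eta>)" by blast
      then have "wt r u * \<eta> \<le> dist (foldr \<phi> u o') (foldr \<phi> w o')" by simp
      moreover have "rmin * \<rho> * \<eta> \<le> wt r u * \<eta>" using H uw o by (intro mult_right_mono) auto
      ultimately have "rmin * \<rho> * \<eta> \<le> dist (foldr \<phi> u o') (foldr \<phi> w o')" by simp
      then show ?thesis using \<rho> by (simp add: pt_dist e_def field_simps)
    qed
    have "\<forall>u\<in>Q. \<exists>k\<in>K. pt u \<in> ball k e" using pt_in K by blast
    then obtain k where k: "\<And>u. u \<in> Q \<Longrightarrow> k u \<in> K \<and> dist (k u) (pt u) < e" by (metis mem_ball)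
    have "inj_on k Q"
    proof (rule inj_onI, rule ccontr)
      fix u w assume "u \<in> Q" "w \<in> Q" "k u = k w" "u \<noteq> w"
      then show False
        using sep[of u w] k[of u] k[of w] dist_triangle3[of "pt u" "pt w" "k u"] by simp
    qed
    moreover have "k ` Q \<subseteq> K" using k by blast
    ultimately have "finite Q \<and> card Q \<le> card K"
      using K(1) by (meson card_inj_on_le inj_on_finite)
    then show ?thesis by simp
  qed
  show ?thesis by (intro exI[of _ "card K + 1"]) (use main in auto)
qed

definition neighbour_bound :: nat where
  "neighbour_bound = (SOME N. N > 0 \<and> (\<forall>\<rho>>0. \<forall>x. \<forall>Q \<subseteq> lists J. antichain Q \<longrightarrow>
     (\<forall>u\<in>Q. rmin * \<rho> \<le> wt r u \<and> wt r u \<le> \<rho> \<and> cyl u \<inter> cball x (2 * \<rho>) \<noteq> {}) \<longrightarrow>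
     finite Q \<and> card Q \<le> N))"

lemma neighbour_bound_pos: "0 < neighbour_bound"
  and neighbour_bound:
    "0 < \<rho> \<Longrightarrow> Q \<subseteq> lists J \<Longrightarrow> antichain Q \<Longrightarrow>
      (\<And>u. u \<in> Q \<Longrightarrow> rmin * \<rho> \<le> wt r u \<and> wt r u \<le> \<rho> \<and> cyl u \<inter> cball x (2 * \<rho>) \<noteq> {}) \<Longrightarrow>
      finite Q \<and> card Q \<le> neighbour_bound"
  using someI_ex[OF antichain_count, folded neighbour_bound_def] by blast+

text \<open>A word \<open>w\<close> with the largest possible number of neighbouring cylinders of its own size:
  the neighbours of \<open>w\<close>, moved by a prefix \<open>a\<close>, are then already all neighbours of \<open>a @ w\<close>.\<close>
lemma isolating_word_exists:
  "\<exists>v\<in>lists J. v \<noteq> [] \<and>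
     (\<forall>a\<in>lists J. \<forall>u\<in>lists J. \<not> prefix a u \<longrightarrow> \<not> prefix u a \<longrightarrow>
        (\<forall>x\<in>cyl (a @ v). \<forall>y\<in>cyl u. wt r (a @ v) < dist x y))"
proof -
  define I where
    "I w = {u \<in> stopping J r (wt r w). \<exists>x\<in>cyl u. \<exists>y\<in>cyl w. dist x y \<le> wt r w}" for w
  have I_fin: "finite (I w) \<and> card (I w) \<le> neighbour_bound" if w: "w \<in> lists J" for w
  proof -
    obtain y0 where y0: "y0 \<in> cyl w" using cyl_ne by blast
    show ?thesis
    proof (rule neighbour_bound[where \<rho> = "wt r w" and x = y0])
      show "0 < wt r w" using w wt_r_pos by simp
      show "I w \<subseteq> lists J" by (auto simp: I_def dest: stopping_words)
      show "antichain (I w)" by (rule antichain_subset[OF stopping_antichain]) (auto simp: I_def)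
      fix u assume u: "u \<in> I w"
      then obtain x y where xy: "x \<in> cyl u" "y \<in> cyl w" "dist x y \<le> wt r w" by (auto simp: I_def)
      have "dist y0 x \<le> 2 * wt r w"
        using cyl_dist[OF w y0 xy(2)] xy(3) dist_triangle2[of y0 x y] by simp
      then have "x \<in> cyl u \<inter> cball y0 (2 * wt r w)" using xy by simp
      then show "rmin * wt r w \<le> wt r u \<and> wt r u \<le> wt r w \<and> cyl u \<inter> cball y0 (2 * wt r w) \<noteq> {}"
        using u stopping_ge[of u "wt r w"] wt_r_le1[OF w] by (auto simp: I_def stopping_le)
    qed
  qed
  obtain i0 where "i0 \<in> J" using J_ne by blast
  then have "\<exists>v. v \<in> lists J \<and> v \<noteq> []" by (intro exI[of _ "[i0]"]) simp
  moreover have "\<forall>w. w \<in> lists J \<and> w \<noteq> [] \<longrightarrow> card (I w) < Suc neighbour_bound"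
    using I_fin by (simp add: less_Suc_eq_le)
  ultimately obtain v where v: "v \<in> lists J" "v \<noteq> []"
    and vmax: "\<And>w. w \<in> lists J \<Longrightarrow> w \<noteq> [] \<Longrightarrow> card (I w) \<le> card (I v)"
    using ex_has_greatest_nat[of "\<lambda>w. w \<in> lists J \<and> w \<noteq> []" _ "\<lambda>w. card (I w)" "Suc neighbour_bound"]
    by (metis (no_types, lifting))
  have I_eq: "I (a @ v) = (@) a ` I v" if a: "a \<in> lists J" for a
  proof (rule sym, rule card_subset_eq)
    show "finite (I (a @ v))" using I_fin[of "a @ v"] a v by simp
    show "(@) a ` I v \<subseteq> I (a @ v)"
    proof
      fix w assume "w \<in> (@) a ` I v"
      then obtain u x y where u: "w = a @ u" "u \<in> stopping J r (wt r v)" "x \<in> cyl u" "y \<in> cyl v"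
          "dist x y \<le> wt r v" by (auto simp: I_def)
      have "w \<in> stopping J r (wt r (a @ v))"
        using stopping_extend[OF u(2) a] wt_r_lt1[OF v] u(1) by simp
      moreover have "foldr \<phi> a x \<in> cyl w" "foldr \<phi> a y \<in> cyl (a @ v)"
        using u by (auto simp: cyl_append)
      moreover have "dist (foldr \<phi> a x) (foldr \<phi> a y) \<le> wt r (a @ v)"
        using u(5) wt_r_pos[OF a] by (simp add: word_dist[OF a])
      ultimately show "w \<in> I (a @ v)" unfolding I_def by blast
    qed
    then have "card ((@) a ` I v) \<le> card (I (a @ v))"
      using I_fin[of "a @ v"] a v by (intro card_mono) auto
    moreover have "card ((@) a ` I v) = card (I v)" by (intro card_image inj_onI) simp
    moreover have "card (I (a @ v)) \<le> card (I v)" using vmax[of "a @ v"] a v by simp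
    ultimately show "card ((@) a ` I v) = card (I (a @ v))" by simp
  qed
  show ?thesis
  proof (intro bexI[of _ v] conjI ballI impI)
    fix a u x y
    assume a: "a \<in> lists J" and u: "u \<in> lists J" and np: "\<not> prefix a u" "\<not> prefix u a"
      and x: "x \<in> cyl (a @ v)" and y: "y \<in> cyl u"
    show "wt r (a @ v) < dist x y"
    proof (rule ccontr)
      assume close: "\<not> wt r (a @ v) < dist x y"
      let ?\<rho> = "wt r (a @ v)"
      have \<rho>: "0 < ?\<rho>" using a v wt_r_pos by simp
      obtain z where z: "z \<in> lists J" "y \<in> cyl (u @ z)" "wt r (u @ z) \<le> ?\<rho>"
      proof (cases "?\<rho> \<le> wt r u")
        case True
        then show ?thesis using cyl_refine[OF u y \<rho>] that by blast
      next
        case False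
        then show ?thesis using that[of "[]"] y by simp
      qed
      obtain u' where u': "u' \<in> stopping J r ?\<rho>" "prefix u' (u @ z)"
        using stopping_prefix_exists[of "u @ z" ?\<rho>] u z by (metis append_in_lists_conv)
      have "y \<in> cyl u'" using cyl_prefix[OF _ u'(2)] u z by auto
      then have "u' \<in> I (a @ v)" using u' x close by (auto simp: I_def dist_commute intro!: bexI)
      then have "prefix a u'" using I_eq[OF a] by auto
      then have "prefix a (u @ z)" using u'(2) by (meson prefix_order.order_trans)
      then show False using np prefix_same_cases[of a "u @ z" u] by auto
    qed
  qed (use v in auto)
qed

definition isolator where
  "isolator = (SOME v. v \<in> lists J \<and> v \<noteq> [] \<and>
     (\<forall>a\<in>lists J. \<forall>u\<in>lists J. \<not> prefix a u \<longrightarrow> \<not> prefix u a \<longrightarrow>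
        (\<forall>x\<in>cyl (a @ v). \<forall>y\<in>cyl u. wt r (a @ v) < dist x y)))"

lemma isolator_word: "isolator \<in> lists J" "isolator \<noteq> []"
  and isolator_far: "\<And>a u x y. a \<in> lists J \<Longrightarrow> u \<in> lists J \<Longrightarrow> \<not> prefix a u \<Longrightarrow> \<not> prefix u a \<Longrightarrow>
    x \<in> cyl (a @ isolator) \<Longrightarrow> y \<in> cyl u \<Longrightarrow> wt r (a @ isolator) < dist x y"
  using someI_ex[OF isolating_word_exists[unfolded Bex_def], folded isolator_def] by blast+

end

section \<open>Masses of cylinders and balls\<close>

locale self_similar_measure = osc_ifs J r \<phi> X for J r and \<phi> :: "nat \<Rightarrow> 'a::euclidean_space \<Rightarrow> 'a" and X +
  fixes p :: "nat \<Rightarrow> real" and \<mu> :: "'a measure"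
  assumes p_pos: "\<And>i. i \<in> J \<Longrightarrow> 0 < p i" and p_sum: "(\<Sum>i\<in>J. p i) = 1"
    and prob: "prob_space \<mu>" and sets_mu: "sets \<mu> = sets borel"
    and inv: "\<And>A. A \<in> sets borel \<Longrightarrow> measure \<mu> A = (\<Sum>i\<in>J. p i * measure \<mu> (\<phi> i -` A))"
begin

interpretation prob_space \<mu> by (rule prob)

lemma space_mu: "space \<mu> = UNIV"
  using sets_eq_imp_space_eq[OF sets_mu] by simp

lemma word_vimage: "w \<in> lists J \<Longrightarrow> A \<in> sets borel \<Longrightarrow> foldr \<phi> w -` A \<in> sets borel"
  using borel_measurable_continuous_onI[OF word_continuous] by (metis measurable_sets_borel)

lemma wt_p_pos: "w \<in> lists J \<Longrightarrow> 0 < wt p w"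
  using p_pos by (auto intro: wt_pos)

lemma measure_cut:
  assumes "cut J Q" "A \<in> sets borel"
  shows "measure \<mu> A = (\<Sum>w\<in>Q. wt p w * measure \<mu> (foldr \<phi> w -` A))"
proof -
  define h where "h w = wt p w * measure \<mu> (foldr \<phi> w -` A)" for w
  have "h w = (\<Sum>i\<in>J. h (w @ [i]))" if "w \<in> lists J" for w
  proof -
    have "foldr \<phi> (w @ [i]) -` A = \<phi> i -` foldr \<phi> w -` A" for i by auto
    then show ?thesis
      using inv[OF word_vimage[OF that assms(2)]]
      by (simp add: h_def sum_distrib_left mult.assoc)
  qed
  from cut_sum_gen[OF assms(1) J_fin this] show ?thesis by (simp add: h_def)
qed

text \<open>The measure might a priori charge points far from \<open>X\<close>. But long words map any large ball into a small
  neighbourhood of \<open>X\<close>, so by invariance this neighbourhood has at least the mass of the large ball.\<close>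
lemma measure_X: "measure \<mu> X = 1"
proof -
  obtain x0 where x0: "x0 \<in> X" using X_ne by blast
  define A where "A e = {y. infdist y X \<le> e}" for e
  have A_closed: "closed (A e)" for e
    unfolding A_def by (intro closed_Collect_le continuous_intros)
  have A_borel: "A e \<in> sets borel" for e using A_closed by simp
  have ball_le: "measure \<mu> (cball x0 K) \<le> measure \<mu> (A e)" if e: "0 < e" and K: "0 < K" for e K
  proof -
    obtain n where n: "rmax ^ n < e / K"
      using real_arch_pow_inv[of "e / K" rmax] e K rmin_rmax(3) by auto
    have sub: "cball x0 K \<subseteq> foldr \<phi> w -` A e" if w: "w \<in> level J n" for w
    proof
      fix y assume y: "y \<in> cball x0 K"
      have wl: "w \<in> lists J" "length w = n" using w by (auto simp: level_def)
      have "foldr \<phi> w x0 \<in> X" using cyl_subset_X[OF wl(1)] x0 by (auto simp: cyl_def)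
      then have "infdist (foldr \<phi> w y) X \<le> dist (foldr \<phi> w y) (foldr \<phi> w x0)" by (rule infdist_le)
      also have "\<dots> = wt r w * dist y x0" using wl by (simp add: word_dist)
      also have "\<dots> \<le> rmax ^ n * K"
        using wt_r_power[OF wl(1)] wl y rmin_rmax
        by (intro mult_mono) (auto simp: dist_commute)
      also have "\<dots> \<le> e" using n K by (simp add: field_simps)
      finally show "y \<in> foldr \<phi> w -` A e" by (simp add: A_def)
    qed
    have "measure \<mu> (cball x0 K) = (\<Sum>w\<in>level J n. wt p w) * measure \<mu> (cball x0 K)"
      using cut_sum[OF cut_level J_fin p_sum] by simp
    also have "\<dots> \<le> (\<Sum>w\<in>level J n. wt p w * measure \<mu> (foldr \<phi> w -` A e))"
      unfolding sum_distrib_right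
    proof (intro sum_mono mult_left_mono)
      fix w assume w: "w \<in> level J n"
      then have wl: "w \<in> lists J" by (simp add: level_def)
      show "measure \<mu> (cball x0 K) \<le> measure \<mu> (foldr \<phi> w -` A e)"
        using sub[OF w] word_vimage[OF wl A_borel] by (intro finite_measure_mono) (auto simp: sets_mu)
      show "0 \<le> wt p w" using wt_p_pos[OF wl] by simp
    qed
    also have "\<dots> = measure \<mu> (A e)" using measure_cut[OF cut_level A_borel] by simp
    finally show ?thesis .
  qed
  have A1: "measure \<mu> (A e) = 1" if e: "0 < e" for e
  proof -
    have "(\<Union>n. cball x0 (real n)) = UNIV" by (auto simp: real_arch_simple)
    moreover have "incseq (\<lambda>n. cball x0 (real n))" by (auto simp: incseq_def)
    ultimately have "(\<lambda>n. measure \<mu> (cball x0 (real n))) \<longlonglongrightarrow> measure \<mu> UNIV"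
      using finite_Lim_measure_incseq[of "\<lambda>n. cball x0 (real n)"] by (simp add: sets_mu image_subset_iff)
    moreover have "measure \<mu> UNIV = 1" using prob_space space_mu by simp
    ultimately have "(\<lambda>n. measure \<mu> (cball x0 (real n))) \<longlonglongrightarrow> 1" by simp
    moreover have "\<exists>N. \<forall>n\<ge>N. measure \<mu> (cball x0 (real n)) \<le> measure \<mu> (A e)"
      using ball_le[OF e] by (intro exI[of _ 1]) auto
    ultimately have "1 \<le> measure \<mu> (A e)" by (rule LIMSEQ_le_const2)
    then show ?thesis using prob_le_1[of "A e"] by simp
  qed
  have "(\<Inter>n. A (1 / real (Suc n))) = X"
  proof (intro set_eqI iffI)
    fix y assume "y \<in> X"
    then show "y \<in> (\<Inter>n. A (1 / real (Suc n)))" by (simp add: A_def)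
  next
    fix y assume y: "y \<in> (\<Inter>n. A (1 / real (Suc n)))"
    have "infdist y X \<le> 0"
    proof (rule field_le_epsilon)
      fix e :: real assume "0 < e"
      then obtain n where "inverse (real (Suc n)) < e" using reals_Archimedean by blast
      moreover have "y \<in> A (1 / real (Suc n))" using y by blast
      ultimately show "infdist y X \<le> 0 + e" by (simp add: A_def inverse_eq_divide)
    qed
    then have "infdist y X = 0" using infdist_nonneg[of y X] by simp
    then show "y \<in> X"
      using in_closed_iff_infdist_zero[of X y] X_compact compact_imp_closed X_ne by blast
  qed
  moreover have "decseq (\<lambda>n. A (1 / real (Suc n)))"
    unfolding decseq_def
  proof (intro allI impI subsetI)
    fix m n y assume "m \<le> n" "y \<in> A (1 / real (Suc n))"
    moreover have "1 / real (Suc n) \<le> 1 / real (Suc m)" using \<open>m \<le> n\<close> by (simp add: frac_le)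
    ultimately show "y \<in> A (1 / real (Suc m))" unfolding A_def by (auto intro: order_trans)
  qed
  moreover have "range (\<lambda>n. A (1 / real (Suc n))) \<subseteq> sets \<mu>" using A_borel by (auto simp: sets_mu)
  ultimately have "(\<lambda>n. measure \<mu> (A (1 / real (Suc n)))) \<longlonglongrightarrow> measure \<mu> X"
    using finite_Lim_measure_decseq[of "\<lambda>n. A (1 / real (Suc n))"] by simp
  moreover have "(\<lambda>n. measure \<mu> (A (1 / real (Suc n)))) \<longlonglongrightarrow> 1" using A1 by simp
  ultimately show ?thesis by (rule LIMSEQ_unique)
qed

lemma measure_ge_X: "X \<subseteq> A \<Longrightarrow> A \<in> sets borel \<Longrightarrow> measure \<mu> A = 1"
  using finite_measure_mono[of X A] measure_X prob_le_1[of A] by (auto simp: sets_mu)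

lemma measure_ge_cyl:
  assumes "a \<in> lists J" "cyl a \<subseteq> A" "A \<in> sets borel"
  shows "wt p a \<le> measure \<mu> A"
proof -
  have a: "a \<in> level J (length a)" using assms(1) by (simp add: level_def)
  have "measure \<mu> (foldr \<phi> a -` A) = 1"
    using assms by (intro measure_ge_X word_vimage) (auto simp: cyl_def)
  then have "wt p a = wt p a * measure \<mu> (foldr \<phi> a -` A)" by simp
  also have "\<dots> \<le> (\<Sum>w\<in>level J (length a). wt p w * measure \<mu> (foldr \<phi> w -` A))"
    using a cut_finite[OF cut_level J_fin] wt_p_pos
    by (intro member_le_sum) (auto simp: level_def less_imp_le)
  also have "\<dots> = measure \<mu> A" using measure_cut[OF cut_level assms(3)] by simp
  finally show ?thesis .
qed

lemma ball_mass_ge: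
  assumes "a \<in> lists J" "x \<in> cyl a" "wt r a \<le> \<rho>"
  shows "wt p a \<le> measure \<mu> (cball x \<rho>)"
  using assms cyl_dist[OF assms(1,2)] by (intro measure_ge_cyl) force+

lemma ball_mass_pos: "x \<in> X \<Longrightarrow> 0 < \<rho> \<Longrightarrow> 0 < measure \<mu> (cball x \<rho>)"
proof -
  assume x: "x \<in> X" and \<rho>: "0 < \<rho>"
  obtain z where "z \<in> lists J" "x \<in> cyl z" "wt r z \<le> \<rho>"
    using cyl_refine[of "[]" x "min \<rho> 1"] x \<rho> by auto
  then show ?thesis using ball_mass_ge wt_p_pos by (meson less_le_trans)
qed

lemma ball_mass_1: "x \<in> X \<Longrightarrow> 1 \<le> \<rho> \<Longrightarrow> measure \<mu> (cball x \<rho>) = 1"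
  using X_dist by (intro measure_ge_X) (force simp: order_trans)+

text \<open>A cylinder that misses \<open>A\<close> contributes nothing: the preimage of \<open>A\<close> is then disjoint from
  \<open>X\<close>, which carries all the mass.\<close>
lemma measure_le_cut:
  assumes Q: "cut J Q" and A: "A \<in> sets borel"
  shows "measure \<mu> A \<le> (\<Sum>w\<in>{w\<in>Q. cyl w \<inter> A \<noteq> {}}. wt p w)"
proof -
  have QJ: "finite Q" "Q \<subseteq> lists J" using cut_finite[OF Q J_fin] cut_lists[OF Q J_fin] by auto
  have "measure \<mu> (foldr \<phi> w -` A) = 0" if w: "w \<in> Q" "cyl w \<inter> A = {}" for w
  proof -
    have B: "foldr \<phi> w -` A \<in> sets borel" using w QJ A word_vimage by blast
    have "X \<inter> foldr \<phi> w -` A = {}" using w by (auto simp: cyl_def)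
    then have "measure \<mu> (X \<union> foldr \<phi> w -` A) = measure \<mu> X + measure \<mu> (foldr \<phi> w -` A)"
      using B X_compact by (intro finite_measure_Union) (auto simp: sets_mu compact_imp_closed)
    then show ?thesis
      using measure_X prob_le_1[of "X \<union> foldr \<phi> w -` A"] by (simp add: measure_le_0_iff)
  qed
  then have "measure \<mu> A = (\<Sum>w\<in>{w\<in>Q. cyl w \<inter> A \<noteq> {}}. wt p w * measure \<mu> (foldr \<phi> w -` A))"
    unfolding measure_cut[OF Q A] using QJ by (intro sum.mono_neutral_right) auto
  also have "\<dots> \<le> (\<Sum>w\<in>{w\<in>Q. cyl w \<inter> A \<noteq> {}}. wt p w)"
  proof (rule sum_mono)
    fix w assume "w \<in> {w \<in> Q. cyl w \<inter> A \<noteq> {}}"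
    then have "0 < wt p w" using QJ wt_p_pos by blast
    then show "wt p w * measure \<mu> (foldr \<phi> w -` A) \<le> wt p w" by (intro mult_left_le) auto
  qed
  finally show ?thesis .
qed

lemma stopping_near_count:
  assumes "0 < R" "R \<le> 1" "\<rho> \<le> 2 * R"
  shows "finite {u \<in> stopping J r R. cyl u \<inter> cball x \<rho> \<noteq> {}} \<and>
         card {u \<in> stopping J r R. cyl u \<inter> cball x \<rho> \<noteq> {}} \<le> neighbour_bound"
proof (rule neighbour_bound[OF assms(1), where x = x])
  show "antichain {u \<in> stopping J r R. cyl u \<inter> cball x \<rho> \<noteq> {}}"
    by (rule antichain_subset[OF stopping_antichain]) auto
  fix u assume "u \<in> {u \<in> stopping J r R. cyl u \<inter> cball x \<rho> \<noteq> {}}"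
  moreover have "cball x \<rho> \<subseteq> cball x (2 * R)" using assms by (intro subset_cball) auto
  ultimately show "rmin * R \<le> wt r u \<and> wt r u \<le> R \<and> cyl u \<inter> cball x (2 * R) \<noteq> {}"
    using stopping_ge[OF _ assms(2)] stopping_le by blast
qed (auto dest: stopping_words)

lemma ball_heaviest:
  assumes x: "x \<in> X" and R: "0 < R" "R \<le> 1" and \<rho>: "0 < \<rho>" "\<rho> \<le> 2 * R"
  shows "\<exists>u\<in>stopping J r R. cyl u \<inter> cball x \<rho> \<noteq> {} \<and>
           measure \<mu> (cball x \<rho>) \<le> neighbour_bound * wt p u"
proof -
  let ?Q = "{u \<in> stopping J r R. cyl u \<inter> cball x \<rho> \<noteq> {}}"
  have fin: "finite ?Q" "card ?Q \<le> neighbour_bound" using stopping_near_count[OF R \<rho>(2)] by auto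
  have le: "measure \<mu> (cball x \<rho>) \<le> (\<Sum>u\<in>?Q. wt p u)"
    using measure_le_cut[OF cut_stopping[OF R(1)]] by simp
  have ne: "?Q \<noteq> {}" using le ball_mass_pos[OF x \<rho>(1)] by (metis not_less sum.empty)
  define M where "M = Max (wt p ` ?Q)"
  have "M \<in> wt p ` ?Q" unfolding M_def using fin ne by (intro Max_in) auto
  then obtain u where u: "u \<in> ?Q" "M = wt p u" by auto
  have "(\<Sum>u\<in>?Q. wt p u) \<le> card ?Q * M"
    using fin by (intro sum_bounded_above) (auto simp: M_def)
  also have "\<dots> \<le> neighbour_bound * M"
    using fin u wt_p_pos[of u] stopping_words[of u R] by (intro mult_right_mono) auto
  finally show ?thesis using u le by auto
qed

text \<open>Among the words of the length of \<open>a\<close>, only \<open>a\<close> itself can reach the ball.\<close>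
lemma isolated_ball_mass:
  assumes "a \<in> lists J" "x \<in> cyl (a @ isolator)" "\<rho> \<le> wt r (a @ isolator)"
  shows "measure \<mu> (cball x \<rho>) \<le> wt p a"
proof -
  let ?Q = "{w \<in> level J (length a). cyl w \<inter> cball x \<rho> \<noteq> {}}"
  have "?Q \<subseteq> {a}"
  proof
    fix u assume u: "u \<in> ?Q"
    then obtain y where y: "y \<in> cyl u" "dist x y \<le> \<rho>" by auto
    have ul: "u \<in> lists J" "length u = length a" using u by (auto simp: level_def)
    show "u \<in> {a}"
    proof (rule ccontr)
      assume "u \<notin> {a}"
      then have "\<not> prefix a u" "\<not> prefix u a" using ul(2) by (auto simp: prefix_def)
      then show False using isolator_far[OF assms(1) ul(1) _ _ assms(2) y(1)] y(2) assms(3) by auto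
    qed
  qed
  then have "(\<Sum>w\<in>?Q. wt p w) \<le> (\<Sum>w\<in>{a}. wt p w)"
    using assms(1) wt_p_pos by (intro sum_mono2) (auto simp: less_imp_le)
  then show ?thesis using measure_le_cut[OF cut_level, of "cball x \<rho>" "length a"] by simp
qed

lemma spt_eq: "spt \<mu> = X"
proof (intro set_eqI iffI)
  fix x assume x: "x \<in> spt \<mu>"
  show "x \<in> X"
  proof (rule ccontr)
    assume "x \<notin> X"
    moreover have "open (- X)" using X_compact compact_imp_closed by auto
    ultimately have "0 < emeasure \<mu> (- X)" using x by (auto simp: spt_def)
    moreover have "measure \<mu> (space \<mu> - X) = 1 - measure \<mu> X"
      using X_compact by (intro prob_compl) (auto simp: sets_mu compact_imp_closed)
    ultimately show False by (simp add: measure_X space_mu emeasure_eq_measure Compl_eq_Diff_UNIV)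
  qed
next
  fix x assume x: "x \<in> X"
  show "x \<in> spt \<mu>"
    unfolding spt_def
  proof (intro CollectI allI impI)
    fix U assume U: "open U \<and> x \<in> U"
    then obtain e where e: "0 < e" "cball x e \<subseteq> U" using open_contains_cball by blast
    then have "measure \<mu> (cball x e) \<le> measure \<mu> U"
      using U by (intro finite_measure_mono) (auto simp: sets_mu)
    then show "0 < emeasure \<mu> U" using ball_mass_pos[OF x e(1)] by (simp add: emeasure_eq_measure)
  qed
qed

subsection \<open>The extreme local exponents\<close>

definition amin where "amin = Min ((\<lambda>i. ln (p i) / ln (r i)) ` J)"
definition amax where "amax = Max ((\<lambda>i. ln (p i) / ln (r i)) ` J)"

lemma p_lt1: "i \<in> J \<Longrightarrow> p i < 1"
proof (rule ccontr)
  assume i: "i \<in> J" and "\<not> p i < 1"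
  have "J = {i}"
  proof (rule ccontr)
    assume "J \<noteq> {i}"
    then have "0 < (\<Sum>j\<in>J - {i}. p j)" using i J_fin p_pos by (intro sum_pos) auto
    moreover have "(\<Sum>j\<in>J. p j) = p i + (\<Sum>j\<in>J - {i}. p j)" using J_fin i by (rule sum.remove)
    ultimately show False using p_sum \<open>\<not> p i < 1\<close> by simp
  qed
  then have X1: "X = \<phi> i ` X" using X_eq by simp
  obtain x y where xy: "x \<in> X" "y \<in> X" "dist x y = 1" using X_pair by blast
  obtain x' y' where "x' \<in> X" "y' \<in> X" "x = \<phi> i x'" "y = \<phi> i y'" using X1 xy by (metis imageE)
  then have "dist x y \<le> r i"
    using phi_dist[OF i, of x' y'] X_dist[of x' y'] r01[OF i] by (simp add: mult_left_le)
  then show False using xy(3) r01[OF i] by simp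
qed

lemma p_eq_powr: "i \<in> J \<Longrightarrow> p i = r i powr (ln (p i) / ln (r i))"
  using p_pos[of i] r01[of i] by (simp add: powr_def)

lemma amin_amax:
  "i \<in> J \<Longrightarrow> amin \<le> ln (p i) / ln (r i)" "i \<in> J \<Longrightarrow> ln (p i) / ln (r i) \<le> amax"
  "\<exists>i\<in>J. ln (p i) / ln (r i) = amin" "\<exists>i\<in>J. ln (p i) / ln (r i) = amax"
proof -
  show "i \<in> J \<Longrightarrow> amin \<le> ln (p i) / ln (r i)" "i \<in> J \<Longrightarrow> ln (p i) / ln (r i) \<le> amax"
    using J_fin by (auto simp: amin_def amax_def)
  have "amin \<in> (\<lambda>i. ln (p i) / ln (r i)) ` J" "amax \<in> (\<lambda>i. ln (p i) / ln (r i)) ` J"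
    unfolding amin_def amax_def using J_fin J_ne by (intro Min_in Max_in; simp)+
  then show "\<exists>i\<in>J. ln (p i) / ln (r i) = amin" "\<exists>i\<in>J. ln (p i) / ln (r i) = amax"
    by (blast elim: imageE dest: sym)+
qed

lemma amin_pos: "0 < amin"
proof -
  obtain i where i: "i \<in> J" "ln (p i) / ln (r i) = amin" using amin_amax(3) by blast
  then show ?thesis using p_lt1[OF i(1)] p_pos[OF i(1)] r01[OF i(1)]
    by (metis divide_neg_neg ln_less_zero)
qed

lemma amin_le_amax: "amin \<le> amax"
  using amin_amax(1,2) J_ne by (meson all_not_in_conv order_trans)

lemma amax_pos: "0 < amax"
  using amin_pos amin_le_amax by simp

lemma p_bounds: "i \<in> J \<Longrightarrow> r i powr amax \<le> p i \<and> p i \<le> r i powr amin"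
  using p_eq_powr[of i] amin_amax(1,2)[of i] r01[of i] by (metis less_imp_le powr_mono')

lemma wt_p_bounds:
  assumes "w \<in> lists J" shows "wt r w powr amax \<le> wt p w" "wt p w \<le> wt r w powr amin"
proof -
  have "wt r w powr amax \<le> wt p w \<and> wt p w \<le> wt r w powr amin"
    using assms
  proof (induction w)
    case (Cons i w)
    then have "0 < wt r w" "0 < r i" "0 < p i" "0 < wt p w" using wt_r_pos r01 p_pos wt_p_pos by auto
    then show ?case using Cons p_bounds[of i] by (auto simp: powr_mult intro!: mult_mono)
  qed simp
  then show "wt r w powr amax \<le> wt p w" "wt p w \<le> wt r w powr amin" by auto
qed

subsection \<open>Pointwise Assouad bounds\<close>

lemma assouad_bound_iff:
  assumes "x \<in> X"
  shows "assouad_bound \<mu> x C s \<longleftrightarrow> (\<forall>\<rho> R. 0 < \<rho> \<and> \<rho> < R \<longrightarrow>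
           measure \<mu> (cball x R) \<le> C * (R / \<rho>) powr s * measure \<mu> (cball x \<rho>))"
  unfolding assouad_bound_def using ball_mass_pos[OF assms]
  by (simp add: pos_divide_le_eq)

lemma assouad_boundI:
  assumes x: "x \<in> X" and "1 \<le> C" "0 \<le> s"
    and H: "\<And>\<rho> R. 0 < \<rho> \<Longrightarrow> \<rho> < R \<Longrightarrow> R \<le> 1 \<Longrightarrow>
           measure \<mu> (cball x R) \<le> C * (R / \<rho>) powr s * measure \<mu> (cball x \<rho>)"
  shows "assouad_bound \<mu> x C s"
  unfolding assouad_bound_iff[OF x]
proof (intro allI impI)
  fix \<rho> R :: real assume \<rho>R: "0 < \<rho> \<and> \<rho> < R"
  have ge1: "1 \<le> C * (R / \<rho>) powr s"
  proof -
    have "1 \<le> (R / \<rho>) powr s" using \<rho>R assms(3) by (intro ge_one_powr_ge_zero) auto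
    then have "1 * 1 \<le> C * (R / \<rho>) powr s" using assms(2) by (intro mult_mono) auto
    then show ?thesis by simp
  qed
  consider "R \<le> 1" | "1 \<le> \<rho>" | "1 < R" "\<rho> < 1" by linarith
  then show "measure \<mu> (cball x R) \<le> C * (R / \<rho>) powr s * measure \<mu> (cball x \<rho>)"
  proof cases
    case 1
    then show ?thesis using H \<rho>R by blast
  next
    case 2
    then show ?thesis using ge1 ball_mass_1[OF x] \<rho>R by simp
  next
    case 3
    have "measure \<mu> (cball x R) = measure \<mu> (cball x 1)" using ball_mass_1[OF x] 3 by simp
    also have "\<dots> \<le> C * (1 / \<rho>) powr s * measure \<mu> (cball x \<rho>)" using H[of \<rho> 1] \<rho>R 3 by simp
    also have "\<dots> \<le> C * (R / \<rho>) powr s * measure \<mu> (cball x \<rho>)"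
      using \<rho>R 3 assms by (intro mult_right_mono mult_left_mono powr_mono2) (auto simp: divide_right_mono)
    finally show ?thesis .
  qed
qed

lemma powr_bound_exponent:
  fixes C e :: real
  assumes "\<And>t. 0 < t \<Longrightarrow> t < 1 \<Longrightarrow> 1 \<le> C * t powr e"
  shows "e \<le> 0"
proof (rule ccontr)
  assume "\<not> e \<le> 0"
  then have e: "0 < e" by simp
  have "((\<lambda>t. C * t powr e) \<longlongrightarrow> C * 0) (at_right 0)"
    using e by (intro tendsto_intros tendsto_powr2[THEN tendsto_eq_rhs]) (auto simp: eventually_at_right_less less_imp_le intro: eventually_mono[OF eventually_at_right_less])
  moreover have "\<forall>\<^sub>F t in at_right (0::real). 1 \<le> C * t powr e"
    using assms by (auto simp: eventually_at_right_field intro!: exI[of _ 1])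
  ultimately have "1 \<le> C * 0" by (intro tendsto_lowerbound) auto
  then show False by simp
qed

lemma assouad_bound_ge_amin:
  assumes x: "x \<in> X" and b: "assouad_bound \<mu> x C s" and "0 < C"
  shows "amin \<le> s"
proof -
  have "1 \<le> (C * 2 powr s * neighbour_bound) * t powr (amin - s)" if t: "0 < t" "t < 1" for t
  proof -
    obtain u where u: "u \<in> stopping J r t" "measure \<mu> (cball x t) \<le> neighbour_bound * wt p u"
      using ball_heaviest[OF x, of t t] t by auto
    have ul: "u \<in> lists J" "wt r u \<le> t" using stopping_words[OF u(1)] stopping_le[OF u(1)] by auto
    have "wt p u \<le> wt r u powr amin" using wt_p_bounds[OF ul(1)] by simp
    also have "\<dots> \<le> t powr amin" using ul amin_pos wt_r_pos[OF ul(1)] by (intro powr_mono2) auto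
    finally have m: "measure \<mu> (cball x t) \<le> neighbour_bound * t powr amin"
      using u(2) by (meson mult_left_mono of_nat_0_le_iff order_trans)
    have "1 = measure \<mu> (cball x 2)" using ball_mass_1[OF x] by simp
    also have "\<dots> \<le> C * (2 / t) powr s * measure \<mu> (cball x t)"
      using b[unfolded assouad_bound_iff[OF x]] t by simp
    also have "\<dots> \<le> C * (2 / t) powr s * (neighbour_bound * t powr amin)"
      using m assms(3) by (intro mult_left_mono) auto
    also have "\<dots> = (C * 2 powr s * neighbour_bound) * t powr (amin - s)"
      using t by (simp add: powr_divide powr_diff)
    finally show ?thesis .
  qed
  from powr_bound_exponent[OF this] show ?thesis by simp
qed

end

section \<open>The possible values of the pointwise Assouad dimension\<close>

context self_similar_measure
begin

text \<open>A cylinder close to the centre keeps supplying mass at the rate \<open>amax\<close> as the ball shrinks, as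
  long as the radius exceeds twice the distance: the ball then contains a whole subcylinder of
  comparable size.\<close>
lemma ball_mass_ge_inside:
  assumes u: "u \<in> lists J" "y \<in> cyl u" "wt r u \<le> R" and d: "2 * dist x y \<le> \<rho>" "0 < \<rho>" "\<rho> \<le> R"
  shows "wt p u * (rmin * \<rho> / (2 * R)) powr amax \<le> measure \<mu> (cball x \<rho>)"
proof -
  have ru: "0 < wt r u" "0 < wt p u" using wt_r_pos wt_p_pos u by auto
  define q where "q = rmin * \<rho> / (2 * R)"
  have q: "0 < q" "q \<le> 1"
  proof -
    have "rmin * \<rho> \<le> 1 * \<rho>" using d rmin_lt1 by (intro mult_right_mono) auto
    then have "rmin * \<rho> \<le> 2 * R" using d by linarith
    then show "0 < q" "q \<le> 1" using d rmin_rmax(1) by (auto simp: q_def divide_le_eq)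
  qed
  have "\<exists>z\<in>lists J. y \<in> cyl (u @ z) \<and> wt r (u @ z) \<le> \<rho> / 2 \<and> q \<le> wt r z"
  proof (cases "\<rho> / 2 \<le> wt r u")
    case True
    then obtain z where z: "z \<in> lists J" "y \<in> cyl (u @ z)" "rmin * (\<rho> / 2) \<le> wt r (u @ z)"
        "wt r (u @ z) \<le> \<rho> / 2"
      using cyl_refine[OF u(1,2), of "\<rho> / 2"] d by auto
    have "wt r u * wt r z \<le> R * wt r z"
      using u(3) wt_r_pos[OF z(1)] by (intro mult_right_mono) auto
    then have "rmin * \<rho> / 2 \<le> R * wt r z" using z(3) by simp
    then have "q \<le> wt r z" using d by (simp add: q_def field_simps)
    then show ?thesis using z by blast
  next
    case False
    then show ?thesis using u q by (intro bexI[of _ "[]"]) auto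
  qed
  then obtain z where z: "z \<in> lists J" "y \<in> cyl (u @ z)" "wt r (u @ z) \<le> \<rho> / 2" "q \<le> wt r z"
    by blast
  have uz: "u @ z \<in> lists J" using u z by simp
  have "cyl (u @ z) \<subseteq> cball x \<rho>"
  proof
    fix a assume "a \<in> cyl (u @ z)"
    then have "dist y a \<le> \<rho> / 2" using cyl_dist[OF uz z(2)] z(3) by fastforce
    then show "a \<in> cball x \<rho>" using d(1) dist_triangle[of x a y] by simp
  qed
  then have "wt p (u @ z) \<le> measure \<mu> (cball x \<rho>)" using uz by (intro measure_ge_cyl) auto
  moreover have "q powr amax \<le> wt p z"
    using wt_p_bounds(1)[OF z(1)] z(4) q amax_pos powr_mono2[of amax q "wt r z"] by simp
  ultimately show ?thesis
    using ru by (smt (verit) mult_left_mono q_def wt_simps(3))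
qed

text \<open>Let \<open>x\<close> have finite pointwise dimension at most \<open>s\<close>. A heavy cylinder at scale \<open>R\<close> may miss
  \<open>x\<close>, at a distance \<open>d\<close>. Down to radius \<open>2 * d\<close> it gives the exponent \<open>amax\<close>, and below \<open>2 * d\<close> the
  argument starts afresh, at the price of a constant factor. As boundedly many cylinders of this
  scale are near \<open>x\<close>, the pigeonhole principle gives some \<open>j \<le> N\<close> with no distance between
  \<open>\<eta> (Suc j) * R\<close> and \<open>\<eta> j * R\<close>. The heaviest cylinder that meets the ball of radius \<open>\<eta> j * R\<close> then
  satisfies \<open>d \<le> \<eta> (Suc j) * R\<close>. By the bound with exponent \<open>s\<close>, replacing the radius \<open>R\<close> by
  \<open>\<eta> j * R\<close> costs a factor of order \<open>\<eta> j powr s\<close>, and \<open>\<eta> (Suc j)\<close> is chosen so small that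
  \<open>(2 * d / R) powr \<epsilon>\<close> absorbs it.\<close>
lemma assouad_bound_finite_imp_amax:
  assumes x: "x \<in> X" and b: "assouad_bound \<mu> x C s" and C: "0 < C" and s: "0 < s" and \<epsilon>: "0 < \<epsilon>"
  shows "\<exists>C'>0. assouad_bound \<mu> x C' (amax + \<epsilon>)"
proof -
  let ?M = "\<lambda>\<rho>. measure \<mu> (cball x \<rho>)"
  define N where "N = neighbour_bound"
  have N: "0 < N" by (simp add: N_def neighbour_bound_pos)
  define B where "B = max C 1"
  have B: "1 \<le> B" by (simp add: B_def)
  have doubling: "?M R \<le> B * \<eta> powr - s * ?M (\<eta> * R)" if "0 < \<eta>" "\<eta> \<le> 1" "0 < R" for \<eta> R
  proof (cases "\<eta> = 1")
    case True
    have "1 * ?M R \<le> B * ?M R" using B by (intro mult_right_mono) auto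
    then show ?thesis using True by simp
  next
    case False
    then have "?M R \<le> C * (R / (\<eta> * R)) powr s * ?M (\<eta> * R)"
      using b[unfolded assouad_bound_iff[OF x], rule_format, of "\<eta> * R" R] that by simp
    also have "R / (\<eta> * R) = 1 / \<eta>" using that by simp
    also have "(1 / \<eta>) powr s = \<eta> powr - s" using that by (simp add: powr_divide powr_minus_divide)
    also have "C * \<eta> powr - s * ?M (\<eta> * R) \<le> B * \<eta> powr - s * ?M (\<eta> * R)"
      by (intro mult_right_mono) (auto simp: B_def)
    finally show ?thesis .
  qed
  define k0 where "k0 = (rmin / 2) powr amax / (N * B)"
  have k0: "0 < k0" "k0 \<le> 1"
  proof -
    have "(rmin / 2) powr amax \<le> 1" using rmin_rmax(1) rmin_lt1 amax_pos by (intro powr_le1) auto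
    moreover have "1 * 1 \<le> N * B" using N B by (intro mult_mono) auto
    ultimately show "0 < k0" "k0 \<le> 1" using rmin_rmax(1) N B by (auto simp: k0_def divide_le_eq)
  qed
  define step where "step h = min (h / 4) ((k0 * h powr s) powr (1 / \<epsilon>) / 2)" for h
  define \<eta> where "\<eta> n = (step ^^ n) 1" for n
  have \<eta>_Suc: "\<eta> (Suc n) = step (\<eta> n)" and \<eta>_0: "\<eta> 0 = 1" for n by (auto simp: \<eta>_def)
  have \<eta>_pos: "0 < \<eta> n" for n
    using k0 by (induction n) (auto simp: \<eta>_0 \<eta>_Suc step_def)
  have \<eta>_4: "\<eta> (Suc n) \<le> \<eta> n / 4" for n by (simp add: \<eta>_Suc step_def)
  have \<eta>_dec: "decseq \<eta>"
  proof (rule decseq_SucI)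
    show "\<eta> (Suc n) \<le> \<eta> n" for n using \<eta>_4[of n] \<eta>_pos[of n] by linarith
  qed
  have \<eta>_le1: "\<eta> n \<le> 1" for n using \<eta>_dec \<eta>_0 by (metis decseqD le0)
  have \<eta>_small: "(2 * \<eta> (Suc n)) powr \<epsilon> \<le> k0 * \<eta> n powr s" for n
  proof -
    have "2 * \<eta> (Suc n) \<le> (k0 * \<eta> n powr s) powr (1 / \<epsilon>)" by (simp add: \<eta>_Suc step_def)
    then have "(2 * \<eta> (Suc n)) powr \<epsilon> \<le> ((k0 * \<eta> n powr s) powr (1 / \<epsilon>)) powr \<epsilon>"
      using \<epsilon> \<eta>_pos[of "Suc n"] by (intro powr_mono2) auto
    also have "\<dots> = k0 * \<eta> n powr s" using \<epsilon> k0 \<eta>_pos[of n] by (simp add: powr_powr)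
    finally show ?thesis .
  qed
  define c where "c = k0 * \<eta> N powr s"
  have c: "0 < c" "c \<le> 1"
  proof -
    have "\<eta> N powr s \<le> 1" using \<eta>_pos[of N] \<eta>_le1[of N] s by (intro powr_le1) auto
    then have "k0 * \<eta> N powr s \<le> 1 * 1" using k0 by (intro mult_mono) auto
    then show "0 < c" "c \<le> 1" using k0 \<eta>_pos[of N] by (auto simp: c_def)
  qed
  define a where "a = amax + \<epsilon>"
  have key: "\<exists>j d. j \<le> N \<and> 0 \<le> d \<and> d \<le> \<eta> (Suc j) * R \<and>
      (\<forall>\<rho>. 2 * d \<le> \<rho> \<longrightarrow> 0 < \<rho> \<longrightarrow> \<rho> \<le> R \<longrightarrow> k0 * \<eta> j powr s * (\<rho> / R) powr amax * ?M R \<le> ?M \<rho>)"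
    if R: "0 < R" "R \<le> 1" for R
  proof -
    define Q where "Q = {u \<in> stopping J r R. cyl u \<inter> cball x R \<noteq> {}}"
    have Q: "finite Q" "card Q \<le> N" using stopping_near_count[OF R, of R x] R by (auto simp: Q_def N_def)
    have "\<forall>u\<in>lists J. \<exists>y\<in>cyl u. infdist x (cyl u) = dist x y"
    proof
      fix u assume "u \<in> lists J"
      then show "\<exists>y\<in>cyl u. infdist x (cyl u) = dist x y"
        using infdist_attains_inf[of "cyl u" x] cyl_compact[of u] cyl_ne[of u] compact_imp_closed
        by metis
    qed
    then obtain y where y: "\<And>u. u \<in> lists J \<Longrightarrow> y u \<in> cyl u \<and> infdist x (cyl u) = dist x (y u)"
      by metis
    have "\<exists>j\<le>N. \<forall>u\<in>Q. \<not> (\<eta> (Suc j) * R < dist x (y u) \<and> dist x (y u) \<le> \<eta> j * R)"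
    proof (rule ccontr)
      assume "\<not> ?thesis"
      then obtain w where w: "\<And>j. j \<le> N \<Longrightarrow>
          w j \<in> Q \<and> \<eta> (Suc j) * R < dist x (y (w j)) \<and> dist x (y (w j)) \<le> \<eta> j * R" by metis
      have "inj_on w {..N}"
      proof (rule linorder_inj_onI)
        fix i j assume "i < j" "i \<in> {..N}" "j \<in> {..N}"
        then have "\<eta> j * R \<le> \<eta> (Suc i) * R" using decseqD[OF \<eta>_dec, of "Suc i" j] R by simp
        then show "w i \<noteq> w j" using w[of i] w[of j] \<open>i \<in> {..N}\<close> \<open>j \<in> {..N}\<close> by force
      qed auto
      moreover have "w ` {..N} \<subseteq> Q" using w by auto
      ultimately have "card {..N} \<le> card Q" using Q(1) by (metis card_inj_on_le)
      then show False using Q(2) by simp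
    qed
    then obtain j where j: "j \<le> N"
      "\<And>u. u \<in> Q \<Longrightarrow> dist x (y u) \<le> \<eta> j * R \<Longrightarrow> dist x (y u) \<le> \<eta> (Suc j) * R"
      by (meson not_le)
    have \<eta>R: "0 < \<eta> j * R" "\<eta> j * R \<le> R" using \<eta>_pos[of j] \<eta>_le1[of j] R by (auto simp: mult_le_cancel_right1)
    then have "\<eta> j * R \<le> 2 * R" using R by linarith
    then obtain u where u: "u \<in> stopping J r R" "cyl u \<inter> cball x (\<eta> j * R) \<noteq> {}"
        "?M (\<eta> j * R) \<le> N * wt p u"
      using ball_heaviest[OF x R \<eta>R(1)] unfolding N_def by blast
    have ul: "u \<in> lists J" "wt r u \<le> R" using u(1) stopping_words stopping_le by auto
    have "u \<in> Q" using u \<eta>R subset_cball[of "\<eta> j * R" R x] by (auto simp: Q_def)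
    moreover have "dist x (y u) \<le> \<eta> j * R"
    proof -
      obtain z where z: "z \<in> cyl u" "dist x z \<le> \<eta> j * R" using u(2) by auto
      have "infdist x (cyl u) \<le> dist x z" using z(1) by (rule infdist_le)
      then show ?thesis using y[OF ul(1)] z(2) by simp
    qed
    ultimately have d: "dist x (y u) \<le> \<eta> (Suc j) * R" using j(2) by blast
    have MR: "?M R * \<eta> j powr s / (N * B) \<le> wt p u"
    proof -
      have "?M R \<le> B * \<eta> j powr - s * ?M (\<eta> j * R)" using doubling \<eta>_pos \<eta>_le1 R by blast
      also have "\<dots> \<le> B * \<eta> j powr - s * (N * wt p u)" using u(3) B by (intro mult_left_mono) auto
      finally have "?M R * \<eta> j powr s \<le> B * \<eta> j powr - s * (N * wt p u) * \<eta> j powr s"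
        by (intro mult_right_mono) auto
      also have "\<dots> = N * B * wt p u" using \<eta>_pos[of j] by (simp add: powr_minus field_simps)
      finally show ?thesis using N B by (simp add: divide_le_eq mult.commute mult.left_commute)
    qed
    have "k0 * \<eta> j powr s * (\<rho> / R) powr amax * ?M R \<le> ?M \<rho>"
      if \<rho>: "2 * dist x (y u) \<le> \<rho>" "0 < \<rho>" "\<rho> \<le> R" for \<rho>
    proof -
      have "(rmin * \<rho> / (2 * R)) powr amax = (rmin / 2) powr amax * (\<rho> / R) powr amax"
        using \<rho> R rmin_rmax(1) by (simp flip: powr_mult)
      then have "k0 * \<eta> j powr s * (\<rho> / R) powr amax * ?M R
          = ?M R * \<eta> j powr s / (N * B) * (rmin * \<rho> / (2 * R)) powr amax"
        by (simp add: k0_def)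
      also have "\<dots> \<le> wt p u * (rmin * \<rho> / (2 * R)) powr amax" using MR by (intro mult_right_mono) auto
      also have "\<dots> \<le> ?M \<rho>" using ball_mass_ge_inside[OF ul(1) _ ul(2)] y[OF ul(1)] \<rho> by blast
      finally show ?thesis .
    qed
    then show ?thesis using j(1) d by (intro exI[of _ j] exI[of _ "dist x (y u)"]) auto
  qed
  have main: "c * (\<rho> / R) powr a * ?M R \<le> ?M \<rho>"
    if "0 < \<rho>" "\<rho> < R" "R \<le> 1" "R \<le> 2 ^ n * \<rho>" for n \<rho> R
    using that
  proof (induction n arbitrary: R)
    case (Suc n)
    have R: "0 < R" using Suc.prems by simp
    obtain j d where j: "j \<le> N" "0 \<le> d" "d \<le> \<eta> (Suc j) * R"
      and J: "\<And>\<rho>. 2 * d \<le> \<rho> \<Longrightarrow> 0 < \<rho> \<Longrightarrow> \<rho> \<le> R \<Longrightarrow>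
                 k0 * \<eta> j powr s * (\<rho> / R) powr amax * ?M R \<le> ?M \<rho>"
      using key[OF R Suc.prems(3)] by metis
    show ?case
    proof (cases "2 * d \<le> \<rho>")
      case True
      have "\<eta> N powr s \<le> \<eta> j powr s"
        using decseqD[OF \<eta>_dec j(1)] \<eta>_pos[of N] s by (intro powr_mono2) auto
      then have "c \<le> k0 * \<eta> j powr s" using k0 by (simp add: c_def)
      moreover have "(\<rho> / R) powr a \<le> (\<rho> / R) powr amax"
        using Suc.prems R \<epsilon> by (intro powr_mono') (auto simp: a_def)
      ultimately have "c * (\<rho> / R) powr a * ?M R \<le> k0 * \<eta> j powr s * (\<rho> / R) powr amax * ?M R"
        using k0 by (intro mult_mono mult_right_mono) auto
      also have "\<dots> \<le> ?M \<rho>" using J[of \<rho>] True Suc.prems by simp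
      finally show ?thesis .
    next
      case False
      define R' where "R' = 2 * d"
      have "\<eta> (Suc j) * R \<le> (1 / 4) * R"
        using \<eta>_4[of j] \<eta>_le1[of j] R by (intro mult_right_mono) auto
      then have "d \<le> R / 4" using j(3) by linarith
      then have R': "\<rho> < R'" "R' \<le> R / 2" "0 < R'" using False j Suc.prems by (auto simp: R'_def)
      have "(R' / R) powr \<epsilon> \<le> (2 * \<eta> (Suc j)) powr \<epsilon>"
        using R R' j \<epsilon> by (intro powr_mono2) (auto simp: R'_def divide_le_eq)
      then have "(R' / R) powr \<epsilon> \<le> k0 * \<eta> j powr s" using \<eta>_small[of j] by simp
      then have "(R' / R) powr \<epsilon> * (R' / R) powr amax * ?M R \<le> k0 * \<eta> j powr s * (R' / R) powr amax * ?M R"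
        by (intro mult_right_mono) auto
      also have "\<dots> \<le> ?M R'" using J[of R'] R' R by (simp add: R'_def)
      also have "(R' / R) powr \<epsilon> * (R' / R) powr amax = (R' / R) powr a"
        by (simp add: a_def add.commute flip: powr_add)
      finally have 1: "(R' / R) powr a * ?M R \<le> ?M R'" .
      have 2: "c * (\<rho> / R') powr a * ?M R' \<le> ?M \<rho>"
        using Suc.prems R' R by (intro Suc.IH) auto
      have "(\<rho> / R) powr a = (\<rho> / R') powr a * (R' / R) powr a"
        using Suc.prems R R' by (simp flip: powr_mult)
      then have "c * (\<rho> / R) powr a * ?M R = c * (\<rho> / R') powr a * ((R' / R) powr a * ?M R)" by simp
      also have "\<dots> \<le> c * (\<rho> / R') powr a * ?M R'" using 1 c by (intro mult_left_mono) auto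
      finally show ?thesis using 2 by simp
    qed
  qed simp
  have "assouad_bound \<mu> x (1 / c) a"
  proof (rule assouad_boundI[OF x])
    show "1 \<le> 1 / c" using c by simp
    show "0 \<le> a" using amax_pos \<epsilon> by (simp add: a_def)
    fix \<rho> R :: real assume \<rho>: "0 < \<rho>" "\<rho> < R" "R \<le> 1"
    obtain n where "R / \<rho> < 2 ^ n" using real_arch_pow[of 2 "R / \<rho>"] by auto
    then have "R \<le> 2 ^ n * \<rho>" using \<rho> by (simp add: field_simps)
    then have m: "c * (\<rho> / R) powr a * ?M R \<le> ?M \<rho>" using main \<rho> by blast
    have "(R / \<rho>) powr a * (\<rho> / R) powr a = 1" using \<rho> by (simp flip: powr_mult)
    then have "?M R = 1 / c * (R / \<rho>) powr a * (c * (\<rho> / R) powr a * ?M R)" using c by simp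
    also have "\<dots> \<le> 1 / c * (R / \<rho>) powr a * ?M \<rho>" using m c by (intro mult_left_mono) auto
    finally show "?M R \<le> 1 / c * (R / \<rho>) powr a * ?M \<rho>" .
  qed
  then show ?thesis using c by (intro exI[of _ "1 / c"]) (simp add: a_def)
qed

text \<open>If adjacent cylinders of comparable size had comparable masses, the mass of a ball would be
  comparable to that of its own cylinder and decay at rate at most \<open>amax\<close>, uniformly.\<close>
lemma heavy_neighbour:
  assumes "ereal amax < assouad_dim \<mu>"
  shows "\<exists>w\<in>lists J. \<exists>u\<in>lists J. \<exists>x\<in>cyl w. \<exists>y\<in>cyl u.
           rmin * wt r u \<le> wt r w \<and> rmin * dist x y \<le> wt r w \<and> K * wt p w < wt p u"
proof (rule ccontr)
  assume "\<not> ?thesis"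
  then have H: "wt p u \<le> K * wt p w" if "w \<in> lists J" "u \<in> lists J" "x \<in> cyl w" "y \<in> cyl u"
      "rmin * wt r u \<le> wt r w" "rmin * dist x y \<le> wt r w" for w u x y
    using that by (meson not_le)
  obtain x0 where "x0 \<in> X" using X_ne by blast
  have K: "1 \<le> K" using H[of "[]" "[]" x0 x0] \<open>x0 \<in> X\<close> rmin_lt1 by simp
  define N where "N = neighbour_bound"
  have N: "1 \<le> real N" using neighbour_bound_pos by (simp add: N_def)
  define C where "C = N * K * (2 / rmin) powr amax"
  have C: "1 \<le> C"
  proof -
    have "1 \<le> (2 / rmin) powr amax"
      using rmin_rmax(1) rmin_lt1 amax_pos by (intro ge_one_powr_ge_zero) auto
    moreover have "1 * 1 \<le> N * K" using N K by (intro mult_mono) auto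
    ultimately have "1 * 1 \<le> (N * K) * (2 / rmin) powr amax" by (intro mult_mono) auto
    then show ?thesis by (simp add: C_def)
  qed
  have "assouad_bound \<mu> x C amax" if x: "x \<in> X" for x
  proof (rule assouad_boundI[OF x C])
    show "0 \<le> amax" using amax_pos by simp
    fix \<rho> R :: real assume \<rho>: "0 < \<rho>" "\<rho> < R" "R \<le> 1"
    obtain u where u: "u \<in> stopping J r R" "cyl u \<inter> cball x R \<noteq> {}"
        "measure \<mu> (cball x R) \<le> N * wt p u"
      using ball_heaviest[OF x, of R R] \<rho> by (auto simp: N_def)
    have ul: "u \<in> lists J" "wt r u \<le> R" using u(1) stopping_words stopping_le by auto
    obtain y where y: "y \<in> cyl u" "dist x y \<le> R" using u(2) by auto
    obtain w where w: "w \<in> lists J" "x \<in> cyl w" "rmin * R \<le> wt r w" "wt r w \<le> R"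
      using cyl_refine[of "[]" x R] x \<rho> by auto
    have 1: "rmin * wt r u \<le> wt r w" "rmin * dist x y \<le> wt r w"
      using ul y w(3) rmin_rmax(1) by (meson mult_left_mono less_imp_le order_trans)+
    have "(R / \<rho>) powr amax * (2 / rmin) powr amax * (rmin * \<rho> / (2 * R)) powr amax = 1"
      using \<rho> rmin_rmax(1) by (simp flip: powr_mult)
    then have "N * wt p u = N * wt p u * ((R / \<rho>) powr amax * (2 / rmin) powr amax * (rmin * \<rho> / (2 * R)) powr amax)"
      by simp
    also have "\<dots> \<le> N * (K * wt p w) * ((R / \<rho>) powr amax * (2 / rmin) powr amax * (rmin * \<rho> / (2 * R)) powr amax)"
      using H[OF w(1) ul(1) w(2) y(1) 1] by (intro mult_right_mono mult_left_mono) auto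
    also have "\<dots> = C * (R / \<rho>) powr amax * (wt p w * (rmin * \<rho> / (2 * R)) powr amax)"
      by (simp add: C_def)
    also have "\<dots> \<le> C * (R / \<rho>) powr amax * measure \<mu> (cball x \<rho>)"
      using ball_mass_ge_inside[OF w(1,2,4), of x \<rho>] \<rho> C by (intro mult_left_mono) auto
    finally show "measure \<mu> (cball x R) \<le> C * (R / \<rho>) powr amax * measure \<mu> (cball x \<rho>)"
      using u(3) by simp
  qed
  then have "assouad_dim \<mu> \<le> ereal amax"
    unfolding assouad_dim_def spt_eq using amax_pos C
    by (intro Inf_lower CollectI exI[of _ amax]) (auto intro!: exI[of _ C])
  then show False using assms by simp
qed

text \<open>A long run of a letter of maximal exponent makes the mass drop at the rate \<open>amax\<close>. The
  isolator at the end of the run guarantees that no other cylinder makes up for the drop.\<close>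
lemma bad_word_run:
  assumes "t < amax"
  shows "\<exists>z\<in>lists J. \<forall>a\<in>lists J. \<forall>x\<in>cyl (a @ z). \<not> assouad_bound \<mu> x K t"
proof -
  obtain i where i: "i \<in> J" "ln (p i) / ln (r i) = amax" using amin_amax(4) by blast
  have pi: "p i = r i powr amax" using p_eq_powr[OF i(1)] i(2) by simp
  have ri: "0 < r i" "r i < 1" using r01 i by auto
  define q where "q = r i powr (t - amax)"
  have q: "1 < q" using ri assms powr_less_mono'[of "r i" "t - amax" 0] by (simp add: q_def)
  define ri0 where "ri0 = wt r isolator"
  have isolator: "0 < ri0" "ri0 < 1" using isolator_word wt_r_pos wt_r_lt1 by (auto simp: ri0_def)
  obtain n where n: "K * (1 / ri0) powr t < q ^ n" using real_arch_pow[OF q] by blast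
  have rep: "replicate n i \<in> lists J" using i by auto
  show ?thesis
  proof (intro bexI[of _ "replicate n i @ isolator"] ballI notI)
    show "replicate n i @ isolator \<in> lists J" using rep isolator_word by simp
    fix a x assume a: "a \<in> lists J" and x: "x \<in> cyl (a @ replicate n i @ isolator)"
      and b: "assouad_bound \<mu> x K t"
    let ?w = "a @ replicate n i"
    have w: "?w \<in> lists J" "?w @ isolator \<in> lists J" using a rep isolator_word by auto
    have xX: "x \<in> X" and xa: "x \<in> cyl a"
      using x cyl_subset_X[OF w(2)] cyl_prefix[of "?w @ isolator" a] w(2) by auto
    define \<rho> where "\<rho> = wt r (?w @ isolator)"
    have \<rho>: "\<rho> = wt r a * (r i ^ n * ri0)" by (simp add: \<rho>_def ri0_def wt_replicate)
    have ra: "0 < wt r a" "0 < wt p a" using wt_r_pos wt_p_pos a by auto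
    have "r i ^ n * ri0 \<le> 1 * ri0" using ri isolator by (intro mult_right_mono power_le_one) auto
    then have "r i ^ n * ri0 < 1" using isolator by linarith
    then have lt: "0 < \<rho>" "\<rho> < wt r a" using ra ri isolator by (auto simp: \<rho>)
    have "wt p a \<le> measure \<mu> (cball x (wt r a))" using ball_mass_ge[OF a xa] by simp
    also have "\<dots> \<le> K * (wt r a / \<rho>) powr t * measure \<mu> (cball x \<rho>)"
      using b[unfolded assouad_bound_iff[OF xX]] lt by blast
    finally have 1: "wt p a \<le> K * (wt r a / \<rho>) powr t * measure \<mu> (cball x \<rho>)" .
    have rn: "(r i ^ n) powr e = (r i powr e) ^ n" for e
      using ri by (simp add: mult.commute powr_powr flip: powr_realpow)
    have "0 < K"
    proof (rule ccontr)
      assume "\<not> 0 < K"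
      then have "K * (wt r a / \<rho>) powr t * measure \<mu> (cball x \<rho>) \<le> 0"
        by (intro mult_nonpos_nonneg) auto
      then show False using 1 ra by simp
    qed
    have "measure \<mu> (cball x \<rho>) \<le> wt p ?w"
      using isolated_ball_mass[OF w(1), of x \<rho>] x by (simp add: \<rho>_def)
    then have "wt p a \<le> K * (wt r a / \<rho>) powr t * wt p ?w"
      using 1 \<open>0 < K\<close> by (meson mult_left_mono mult_nonneg_nonneg less_imp_le order_trans powr_ge_zero)
    also have "(wt r a / \<rho>) powr t = (1 / ri0) powr t * (1 / r i ^ n) powr t"
      using ra isolator ri by (simp add: \<rho> mult.commute flip: powr_mult)
    also have "wt p ?w = wt p a * (r i ^ n) powr amax"
      using pi by (simp add: wt_replicate rn)
    finally have "wt p a * 1 \<le> wt p a * (K * (1 / ri0) powr t * ((1 / r i ^ n) powr t * (r i ^ n) powr amax))"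
      by (simp only: mult_1_right ac_simps)
    then have "1 \<le> K * (1 / ri0) powr t * ((1 / r i ^ n) powr t * (r i ^ n) powr amax)"
      using ra(2) mult_le_cancel_left_pos by blast
    also have "(1 / r i ^ n) powr t * (r i ^ n) powr amax = 1 / q ^ n"
      using ri by (simp add: rn powr_divide q_def powr_diff power_divide)
    finally show False using n q by (simp add: field_simps)
  qed
qed

text \<open>The isolator places the point so that a small ball sees only the light cylinder of an
  unbalanced pair, while a ball larger by a fixed factor contains the heavy one.\<close>
lemma bad_word_neighbour:
  assumes "ereal amax < assouad_dim \<mu>"
  shows "\<exists>z\<in>lists J. \<forall>a\<in>lists J. \<forall>x\<in>cyl (a @ z). \<not> assouad_bound \<mu> x K t"
proof -
  define D where "D = 1 + 2 / rmin"
  define ri0 where "ri0 = wt r isolator"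
  have isolator: "0 < ri0" "ri0 < 1" using isolator_word wt_r_pos wt_r_lt1 by (auto simp: ri0_def)
  have D: "1 < D" using rmin_rmax(1) by (simp add: D_def)
  obtain w u y' y where w: "w \<in> lists J" and u: "u \<in> lists J" and y: "y' \<in> cyl w" "y \<in> cyl u"
    and near: "rmin * wt r u \<le> wt r w" "rmin * dist y' y \<le> wt r w"
    and heavy: "(\<bar>K\<bar> * (D / ri0) powr t) * wt p w < wt p u"
    using heavy_neighbour[OF assms, of "\<bar>K\<bar> * (D / ri0) powr t"] by blast
  show ?thesis
  proof (intro bexI[of _ "w @ isolator"] ballI notI)
    show "w @ isolator \<in> lists J" using w isolator_word by simp
    fix a x assume a: "a \<in> lists J" and x: "x \<in> cyl (a @ w @ isolator)" and b: "assouad_bound \<mu> x K t"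
    have aw: "a @ w \<in> lists J" "(a @ w) @ isolator \<in> lists J" and au: "a @ u \<in> lists J"
      using a w u isolator_word by auto
    have xX: "x \<in> X" and xa: "x \<in> cyl (a @ w)"
      using x cyl_subset_X[OF aw(2)] cyl_prefix[of "(a @ w) @ isolator" "a @ w"] aw(2) by auto
    define R where "R = D * wt r (a @ w)"
    define \<rho> where "\<rho> = wt r ((a @ w) @ isolator)"
    have pos: "0 < wt r (a @ w)" "0 < wt p a" using wt_r_pos wt_p_pos aw a by auto
    have \<rho>: "\<rho> = ri0 * wt r (a @ w)" by (simp add: \<rho>_def ri0_def)
    have lt: "0 < \<rho>" "\<rho> < R"
    proof -
      show "0 < \<rho>" using pos isolator by (simp add: \<rho>)
      show "\<rho> < R" unfolding \<rho> R_def using pos isolator D by (intro mult_strict_right_mono) auto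
    qed
    have "cyl (a @ u) \<subseteq> cball x R"
    proof
      fix y2 assume y2: "y2 \<in> cyl (a @ u)"
      have "foldr \<phi> a y' \<in> cyl (a @ w)" "foldr \<phi> a y \<in> cyl (a @ u)" using y by (auto simp: cyl_append)
      then have "dist x (foldr \<phi> a y') \<le> wt r (a @ w)" "dist (foldr \<phi> a y) y2 \<le> wt r (a @ u)"
        "dist (foldr \<phi> a y') (foldr \<phi> a y) = wt r a * dist y' y"
        using cyl_dist[OF aw(1) xa] cyl_dist[OF au _ y2] word_dist[OF a] by auto
      moreover have "wt r (a @ u) \<le> wt r (a @ w) / rmin"
        "wt r a * dist y' y \<le> wt r (a @ w) / rmin"
        using near wt_r_pos[OF a] rmin_rmax(1) by (simp_all add: field_simps)
      moreover have "R = wt r (a @ w) + wt r (a @ w) / rmin + wt r (a @ w) / rmin"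
        by (simp add: R_def D_def algebra_simps)
      ultimately show "y2 \<in> cball x R"
        using dist_triangle[of x y2 "foldr \<phi> a y'"] dist_triangle[of "foldr \<phi> a y'" y2 "foldr \<phi> a y"]
        by simp
    qed
    then have "wt p (a @ u) \<le> measure \<mu> (cball x R)" using au by (intro measure_ge_cyl) auto
    also have "\<dots> \<le> K * (R / \<rho>) powr t * measure \<mu> (cball x \<rho>)"
      using b[unfolded assouad_bound_iff[OF xX]] lt by blast
    also have "\<dots> \<le> \<bar>K\<bar> * (R / \<rho>) powr t * measure \<mu> (cball x \<rho>)" by (intro mult_right_mono) auto
    also have "\<dots> \<le> \<bar>K\<bar> * (R / \<rho>) powr t * wt p (a @ w)"
      using isolated_ball_mass[OF aw(1), of x \<rho>] x by (intro mult_left_mono) (auto simp: \<rho>_def)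
    also have "R / \<rho> = D / ri0" unfolding R_def \<rho> using pos(1) by (intro nonzero_mult_divide_mult_cancel_right) linarith
    finally have "wt p u \<le> \<bar>K\<bar> * (D / ri0) powr t * wt p w"
      using pos(2) by (simp add: mult.left_commute)
    then show False using heavy by simp
  qed
qed

lemma amax_le_assouad_dim: "ereal amax \<le> assouad_dim \<mu>"
  unfolding assouad_dim_def
proof (rule Inf_greatest, clarsimp simp: spt_eq)
  fix s C assume b: "\<forall>x\<in>X. assouad_bound \<mu> x C s"
  show "amax \<le> s"
  proof (rule ccontr)
    assume "\<not> amax \<le> s"
    then obtain z where z: "z \<in> lists J" "\<forall>a\<in>lists J. \<forall>x\<in>cyl (a @ z). \<not> assouad_bound \<mu> x C s"
      using bad_word_run[of s C] by auto
    obtain x where "x \<in> cyl z" using cyl_ne by blast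
    then show False using z b cyl_subset_X[OF z(1)] by (metis append_Nil lists.Nil subsetD)
  qed
qed

lemma assouad_dim_cases: "assouad_dim \<mu> = ereal amax \<or> assouad_dim \<mu> = \<infinity>"
proof (rule disjCI)
  assume "assouad_dim \<mu> \<noteq> \<infinity>"
  have "assouad_dim \<mu> \<le> ereal amax"
  proof (rule ccontr)
    assume "\<not> assouad_dim \<mu> \<le> ereal amax"
    then have big: "ereal amax < assouad_dim \<mu>" by simp
    have "\<not> (\<forall>x\<in>X. assouad_bound \<mu> x C s)" for C s
    proof -
      obtain z where z: "z \<in> lists J" "\<forall>a\<in>lists J. \<forall>x\<in>cyl (a @ z). \<not> assouad_bound \<mu> x C s"
        using bad_word_neighbour[OF big, of C s] by blast
      obtain x where "x \<in> cyl z" using cyl_ne by blast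
      then show ?thesis using z cyl_subset_X[OF z(1)] by (metis append_Nil lists.Nil subsetD)
    qed
    then have "{ereal s |s. 0 < s \<and> (\<exists>C>0. \<forall>x\<in>spt \<mu>. assouad_bound \<mu> x C s)} = {}"
      by (auto simp: spt_eq)
    then have "assouad_dim \<mu> = \<infinity>" unfolding assouad_dim_def by (simp only: Inf_empty top_ereal_def)
    then show False using \<open>assouad_dim \<mu> \<noteq> \<infinity>\<close> by simp
  qed
  then show "assouad_dim \<mu> = ereal amax" using amax_le_assouad_dim by simp
qed

lemma bad_word:
  assumes "ereal t < assouad_dim \<mu>"
  shows "\<exists>z\<in>lists J. \<forall>a\<in>lists J. \<forall>x\<in>cyl (a @ z). \<not> assouad_bound \<mu> x K t"
  using assouad_dim_cases assms bad_word_run bad_word_neighbour by (metis ereal_less(5) less_ereal.simps(1) PInfty_neq_ereal(1) less_ereal.simps(4) ereal_less_eq(3) leI)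

lemma assouad_dim_at_le: "x \<in> X \<Longrightarrow> assouad_dim_at \<mu> x \<le> assouad_dim \<mu>"
  unfolding assouad_dim_at_def assouad_dim_def spt_eq by (intro Inf_superset_mono) auto

lemma assouad_dim_at_ge:
  assumes "x \<in> X" shows "ereal amin \<le> assouad_dim_at \<mu> x"
  unfolding assouad_dim_at_def using assouad_bound_ge_amin[OF assms] by (intro Inf_greatest) auto

lemma assouad_dim_at_cases:
  assumes x: "x \<in> X" shows "assouad_dim_at \<mu> x \<le> ereal amax \<or> assouad_dim_at \<mu> x = \<infinity>"
proof (rule disjCI)
  assume "assouad_dim_at \<mu> x \<noteq> \<infinity>"
  then have "{ereal s |s. 0 < s \<and> (\<exists>C>0. assouad_bound \<mu> x C s)} \<noteq> {}"
    unfolding assouad_dim_at_def by (metis Inf_empty top_ereal_def)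
  then obtain s C where s: "0 < s" "0 < C" "assouad_bound \<mu> x C s" by blast
  show "assouad_dim_at \<mu> x \<le> ereal amax"
  proof (rule ereal_le_epsilon2)
    fix e :: real assume "0 < e"
    then obtain C' where "0 < C'" "assouad_bound \<mu> x C' (amax + e)"
      using assouad_bound_finite_imp_amax[OF x s(3,2,1)] by blast
    then show "assouad_dim_at \<mu> x \<le> ereal amax + ereal e"
      unfolding assouad_dim_at_def using amax_pos \<open>0 < e\<close>
      by (intro Inf_lower CollectI exI[of _ "amax + e"]) auto
  qed
qed

lemma assouad_level_set_empty:
  assumes "\<alpha> \<notin> {ereal amin..ereal amax} \<union> {assouad_dim \<mu>}"
  shows "assouad_level_set \<mu> \<alpha> = {}"
proof (rule ccontr)
  assume "assouad_level_set \<mu> \<alpha> \<noteq> {}"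
  then obtain x where x: "x \<in> X" "assouad_dim_at \<mu> x = \<alpha>" by (auto simp: assouad_level_set_def spt_eq)
  then show False
    using assouad_dim_at_ge[OF x(1)] assouad_dim_at_cases[OF x(1)] assouad_dim_at_le[OF x(1)] assms by auto
qed

end

section \<open>Covers and Hausdorff dimension\<close>

definition fine_cover :: "real \<Rightarrow> 'a::metric_space set \<Rightarrow> (nat \<Rightarrow> 'a set) \<Rightarrow> bool" where
  "fine_cover \<delta> A V \<longleftrightarrow> A \<subseteq> (\<Union>n. V n) \<and> (\<forall>n. bounded (V n) \<and> diameter (V n) \<le> \<delta>)"

lemma hausdorff_measure_eq_0_iff:
  "hausdorff_measure s A = 0 \<longleftrightarrow>
     (\<forall>\<delta>>0. \<forall>e>0. \<exists>V. fine_cover \<delta> A V \<and> (\<Sum>n. ennreal (diameter (V n) powr s)) < ennreal e)"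
proof -
  have eq: "hausdorff_premeasure s \<delta> A =
      (INF V\<in>{V. fine_cover \<delta> A V}. \<Sum>n. ennreal (diameter (V n) powr s))" for \<delta>
    unfolding hausdorff_premeasure_def fine_cover_def by (rule arg_cong[where f = Inf]) auto
  have pre: "hausdorff_premeasure s \<delta> A = 0 \<longleftrightarrow>
      (\<forall>e>0. \<exists>V. fine_cover \<delta> A V \<and> (\<Sum>n. ennreal (diameter (V n) powr s)) < ennreal e)"
    (is "?L \<longleftrightarrow> ?R") for \<delta>
  proof
    assume L: ?L
    show ?R
    proof (intro allI impI)
      fix e :: real assume "0 < e"
      then have "(INF V\<in>{V. fine_cover \<delta> A V}. \<Sum>n. ennreal (diameter (V n) powr s)) < ennreal e"
        using L eq by simp
      then show "\<exists>V. fine_cover \<delta> A V \<and> (\<Sum>n. ennreal (diameter (V n) powr s)) < ennreal e"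
        unfolding INF_less_iff by auto
    qed
  next
    assume R: ?R
    have "hausdorff_premeasure s \<delta> A \<le> 0"
    proof (rule ennreal_le_epsilon)
      fix e :: real assume "0 < e"
      then obtain V where "fine_cover \<delta> A V" "(\<Sum>n. ennreal (diameter (V n) powr s)) < ennreal e"
        using R by blast
      then show "hausdorff_premeasure s \<delta> A \<le> 0 + ennreal e"
        unfolding eq by (intro INF_lower2[of V]) (auto intro: less_imp_le)
    qed
    then show ?L by simp
  qed
  show ?thesis
    unfolding hausdorff_measure_def pre[symmetric]
    by (auto simp: SUP_eq_iff bot_ennreal[symmetric] simp del: bot_ennreal)
qed

lemma hausdorff_measure_0_mono:
  "A \<subseteq> B \<Longrightarrow> hausdorff_measure s B = 0 \<Longrightarrow> hausdorff_measure s A = 0"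
  unfolding hausdorff_measure_eq_0_iff fine_cover_def by (meson order_trans)

lemma hausdorff_dim_mono: "A \<subseteq> B \<Longrightarrow> hausdorff_dim A \<le> hausdorff_dim B"
  unfolding hausdorff_dim_def using hausdorff_measure_0_mono by (intro Inf_superset_mono) blast

lemma hausdorff_dim_nonneg: "0 \<le> hausdorff_dim A"
  unfolding hausdorff_dim_def by (intro Inf_greatest) auto

lemma hausdorff_dim_leI:
  assumes "0 \<le> t" "\<And>s. t < s \<Longrightarrow> hausdorff_measure s A = 0"
  shows "hausdorff_dim A \<le> ereal t"
proof (rule ereal_le_epsilon2)
  fix e :: real assume "0 < e"
  then show "hausdorff_dim A \<le> ereal t + ereal e"
    unfolding hausdorff_dim_def using assms by (intro Inf_lower CollectI exI[of _ "t + e"]) auto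
qed

lemma hausdorff_measure_0_UN:
  assumes "\<And>n::nat. hausdorff_measure s (A n) = 0"
  shows "hausdorff_measure s (\<Union>n. A n) = 0"
  unfolding hausdorff_measure_eq_0_iff
proof (intro allI impI)
  fix \<delta> e :: real assume "0 < \<delta>" "0 < e"
  define e' where "e' = e / 2"
  have e': "0 < e'" "e' < e" using \<open>0 < e\<close> by (auto simp: e'_def)
  have "\<exists>V. fine_cover \<delta> (A n) V \<and>
      (\<Sum>j. ennreal (diameter (V j) powr s)) < ennreal (e' * (1/2) ^ Suc n)" for n
  proof -
    have "0 < e' * (1/2) ^ Suc n" using e' by simp
    then show ?thesis using assms[of n] \<open>0 < \<delta>\<close> unfolding hausdorff_measure_eq_0_iff by blast
  qed
  then obtain V where V: "\<And>n. fine_cover \<delta> (A n) (V n)"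
      "\<And>n. (\<Sum>j. ennreal (diameter (V n j) powr s)) < ennreal (e' * (1/2) ^ Suc n)" by metis
  define W where "W k = (case prod_decode k of (n, j) \<Rightarrow> V n j)" for k
  have "fine_cover \<delta> (\<Union>n. A n) W"
    unfolding fine_cover_def
  proof (intro conjI allI subsetI)
    fix x assume "x \<in> (\<Union>n. A n)"
    then obtain n j where "x \<in> V n j" using V(1) by (force simp: fine_cover_def)
    then have "x \<in> W (prod_encode (n, j))" by (simp add: W_def)
    then show "x \<in> (\<Union>k. W k)" by blast
  next
    fix k show "bounded (W k)" "diameter (W k) \<le> \<delta>"
      using V(1) by (auto simp: W_def fine_cover_def split: prod.split)
  qed
  moreover have "(\<Sum>k. ennreal (diameter (W k) powr s)) < ennreal e"
  proof -
    let ?f = "\<lambda>(n, j). ennreal (diameter (V n j) powr s)"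
    have "(\<Sum>k. ennreal (diameter (W k) powr s)) = (\<Sum>k. ?f (prod_decode k))"
      by (simp add: W_def split_def)
    also have "\<dots> = (\<Sum>n. \<Sum>j. ?f (n, j))" by (rule suminf_ennreal_2dimen) simp
    also have "\<dots> \<le> (\<Sum>n. ennreal (e' * (1/2) ^ Suc n))"
      using V(2) by (intro suminf_le) (auto simp: less_imp_le)
    also have "\<dots> = ennreal e'"
      using sums_mult[OF power_half_series, of e'] e' by (intro suminf_ennreal_eq) auto
    also have "\<dots> < ennreal e" using e' by (simp add: ennreal_less_iff)
    finally show ?thesis .
  qed
  ultimately show "\<exists>V. fine_cover \<delta> (\<Union>n. A n) V \<and> (\<Sum>n. ennreal (diameter (V n) powr s)) < ennreal e"
    by blast
qed

lemma hausdorff_measure_0_finite_covers: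
  assumes "\<And>\<delta> e. 0 < \<delta> \<Longrightarrow> 0 < e \<Longrightarrow> \<exists>(Q :: 'b set) V. finite Q \<and> A \<subseteq> (\<Union>u\<in>Q. V u) \<and>
     (\<forall>u\<in>Q. bounded (V u) \<and> diameter (V u) \<le> \<delta>) \<and> (\<Sum>u\<in>Q. diameter (V u) powr s) < e"
  shows "hausdorff_measure s A = 0"
  unfolding hausdorff_measure_eq_0_iff
proof (intro allI impI)
  fix \<delta> e :: real assume pos: "0 < \<delta>" "0 < e"
  then obtain Q :: "'b set" and V where Q: "finite Q" "A \<subseteq> (\<Union>u\<in>Q. V u)"
     "\<forall>u\<in>Q. bounded (V u) \<and> diameter (V u) \<le> \<delta>" "(\<Sum>u\<in>Q. diameter (V u) powr s) < e"
    using assms by metis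
  obtain h where h: "bij_betw h {..<card Q} Q"
    using ex_bij_betw_nat_finite[OF Q(1)] by (auto simp: atLeast0LessThan)
  define W where "W n = (if n < card Q then V (h n) else {})" for n
  have "fine_cover \<delta> A W"
    unfolding fine_cover_def
  proof (intro conjI allI subsetI)
    fix x assume "x \<in> A"
    then obtain u where u: "u \<in> Q" "x \<in> V u" using Q by blast
    then have "u \<in> h ` {..<card Q}" using h by (simp add: bij_betw_def)
    then obtain n where "n < card Q" "h n = u" by blast
    then show "x \<in> (\<Union>n. W n)" using u by (auto simp: W_def)
  next
    fix n
    have "n < card Q \<Longrightarrow> h n \<in> Q" using h by (auto simp: bij_betw_def)
    then show "bounded (W n)" "diameter (W n) \<le> \<delta>" using Q(3) pos by (auto simp: W_def)
  qed
  moreover have "(\<Sum>n. ennreal (diameter (W n) powr s)) = ennreal (\<Sum>u\<in>Q. diameter (V u) powr s)"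
  proof -
    have "(\<Sum>n. ennreal (diameter (W n) powr s)) = (\<Sum>n<card Q. ennreal (diameter (W n) powr s))"
      by (rule suminf_finite) (auto simp: W_def)
    also have "\<dots> = (\<Sum>n<card Q. ennreal (diameter (V (h n)) powr s))" by (simp add: W_def)
    also have "\<dots> = (\<Sum>u\<in>Q. ennreal (diameter (V u) powr s))" by (rule sum.reindex_bij_betw[OF h])
    also have "\<dots> = ennreal (\<Sum>u\<in>Q. diameter (V u) powr s)" by (rule sum_ennreal) simp
    finally show ?thesis .
  qed
  ultimately show "\<exists>V. fine_cover \<delta> A V \<and> (\<Sum>n. ennreal (diameter (V n) powr s)) < ennreal e"
    using Q(4) pos by (auto simp: ennreal_less_iff sum_nonneg)
qed

section \<open>Upper bounds for the dimension\<close>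

lemma powr_small_exists:
  fixes K \<gamma> \<delta> e :: real
  assumes "0 < \<gamma>" "0 < \<delta>" "0 < e"
  shows "\<exists>\<rho>>0. \<rho> < 1 \<and> \<rho> \<le> \<delta> \<and> K * \<rho> powr \<gamma> < e"
proof -
  have "((\<lambda>t. t powr \<gamma>) \<longlongrightarrow> 0) (at_right (0::real))"
    using assms(1) by (intro tendsto_powr2[THEN tendsto_eq_rhs] tendsto_intros) (auto simp: eventually_at_right_less less_imp_le intro: eventually_mono[OF eventually_at_right_less])
  then have "((\<lambda>t. K * t powr \<gamma>) \<longlongrightarrow> K * 0) (at_right (0::real))" by (intro tendsto_intros)
  then have "\<forall>\<^sub>F t in at_right (0::real). K * t powr \<gamma> < e"
    using assms(3) order_tendstoD(2) by fastforce
  then have "\<forall>\<^sub>F t in at_right (0::real). K * t powr \<gamma> < e \<and> t \<in> {0<..<min 1 \<delta>}"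
    using assms(2) by (intro eventually_conj eventually_at_right_real) auto
  then obtain t :: real where "K * t powr \<gamma> < e" "t \<in> {0<..<min 1 \<delta>}"
    using eventually_happens'[OF trivial_limit_at_right_real] by blast
  then show ?thesis by auto
qed

context self_similar_measure
begin

text \<open>Only cylinders of mass at least of order \<open>\<rho> powr s\<close> are needed to cover the set at scale
  \<open>\<rho>\<close>; Markov's inequality for the weights \<open>p\<^sup>q r\<^sup>T\<close>, which sum to one over every cut set, bounds
  their number.\<close>
lemma hausdorff_null_heavy:
  assumes q: "0 \<le> q" and T: "(\<Sum>i\<in>J. p i powr q * r i powr T) = 1"
    and t: "0 < t" "s * q + T < t" and c: "0 < c"
    and A: "\<And>x \<rho>. x \<in> A \<Longrightarrow> 0 < \<rho> \<Longrightarrow> \<rho> < 1 \<Longrightarrow> x \<in> X \<and> c * \<rho> powr s \<le> measure \<mu> (cball x \<rho>)"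
  shows "hausdorff_measure t A = 0"
proof (rule hausdorff_measure_0_finite_covers)
  fix \<delta> e :: real assume pos: "0 < \<delta>" "0 < e"
  define N where "N = neighbour_bound"
  have N: "0 < real N" using neighbour_bound_pos by (simp add: N_def)
  define K where "K = max 1 (rmin powr - T)"
  define C where "C = 4 powr t * (N / c) powr q * K"
  define \<gamma> where "\<gamma> = t - s * q - T"
  obtain \<rho> where \<rho>: "0 < \<rho>" "\<rho> < 1" "\<rho> \<le> \<delta> / 4" "C * \<rho> powr \<gamma> < e"
    using powr_small_exists[of \<gamma> "\<delta> / 4" e C] t pos by (auto simp: \<gamma>_def)
  define S where "S = stopping J r \<rho>"
  define Q where "Q = {u\<in>S. c * \<rho> powr s \<le> N * wt p u}"
  have S_cut: "cut J S" unfolding S_def by (rule cut_stopping) (use \<rho> in simp)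
  have S: "finite S" "S \<subseteq> lists J" using cut_finite[OF S_cut J_fin] cut_lists[OF S_cut J_fin] by auto
  have S_sz: "rmin * \<rho> \<le> wt r u" "wt r u \<le> \<rho>" if "u \<in> S" for u
    using that stopping_ge[of u \<rho>] stopping_le[of u \<rho>] \<rho> by (auto simp: S_def)
  define y where "y u = (SOME y. y \<in> cyl u)" for u
  have y: "y u \<in> cyl u" for u unfolding y_def using cyl_ne some_in_eq by blast
  define V where "V u = cball (y u) (2 * \<rho>)" for u
  have diam: "diameter (V u) \<le> 4 * \<rho>" for u
    unfolding V_def
  proof (rule diameter_le)
    fix a b assume "a \<in> cball (y u) (2 * \<rho>)" "b \<in> cball (y u) (2 * \<rho>)"
    then show "norm (a - b) \<le> 4 * \<rho>" using dist_triangle3[of a b "y u"] by (simp flip: dist_norm)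
  qed (use \<rho> in simp)
  have cover: "A \<subseteq> (\<Union>u\<in>Q. V u)"
  proof
    fix x assume x: "x \<in> A"
    have xX: "x \<in> X" and m: "c * \<rho> powr s \<le> measure \<mu> (cball x \<rho>)" using A[OF x \<rho>(1,2)] by auto
    obtain u where u: "u \<in> S" "cyl u \<inter> cball x \<rho> \<noteq> {}" "measure \<mu> (cball x \<rho>) \<le> N * wt p u"
      using ball_heaviest[OF xX, of \<rho> \<rho>] \<rho> by (auto simp: S_def N_def)
    obtain z where z: "z \<in> cyl u" "dist x z \<le> \<rho>" using u(2) by auto
    have "dist (y u) z \<le> \<rho>" using cyl_dist[of u "y u" z] y z u S S_sz[of u] by fastforce
    then have "x \<in> V u" using z(2) dist_triangle2[of "y u" x z] by (simp add: V_def)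
    then show "x \<in> (\<Union>u\<in>Q. V u)" using u m by (auto simp: Q_def)
  qed
  have "(\<Sum>u\<in>Q. diameter (V u) powr t) \<le> (\<Sum>u\<in>Q. C * \<rho> powr \<gamma> * wt (\<lambda>i. p i powr q * r i powr T) u)"
  proof (rule sum_mono)
    fix u assume u: "u \<in> Q"
    then have uS: "u \<in> S" "u \<in> lists J" "c * \<rho> powr s \<le> N * wt p u" using S by (auto simp: Q_def)
    have ru: "0 < wt r u" "0 < wt p u" using uS wt_r_pos wt_p_pos by auto
    have "0 \<le> diameter (V u)" by (intro diameter_ge_0) (simp add: V_def)
    then have "diameter (V u) powr t \<le> (4 * \<rho>) powr t"
      using diam t by (intro powr_mono2) auto
    also have "\<dots> \<le> (4 * \<rho>) powr t * (((N / c) * \<rho> powr - s * wt p u) powr q * (K * \<rho> powr - T * wt r u powr T))"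
    proof -
      have "1 \<le> (N / c) * \<rho> powr - s * wt p u"
        using uS(3) c \<rho> by (simp add: powr_minus field_simps)
      then have 1: "1 \<le> ((N / c) * \<rho> powr - s * wt p u) powr q" using q by (intro ge_one_powr_ge_zero)
      have "\<rho> powr T \<le> K * wt r u powr T"
      proof (cases "0 \<le> T")
        case True
        have "\<rho> powr T = rmin powr - T * (rmin * \<rho>) powr T"
          using rmin_rmax(1) \<rho> by (simp add: powr_mult powr_minus)
        also have "\<dots> \<le> K * wt r u powr T"
          using S_sz[OF uS(1)] True rmin_rmax(1) \<rho> by (intro mult_mono powr_mono2) (auto simp: K_def)
        finally show ?thesis .
      next
        case False
        then have "1 * \<rho> powr T \<le> K * wt r u powr T"
          using S_sz[OF uS(1)] ru \<rho> by (intro mult_mono powr_mono2') (auto simp: K_def)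
        then show ?thesis by simp
      qed
      then have 2: "1 \<le> K * \<rho> powr - T * wt r u powr T" using \<rho> by (simp add: powr_minus field_simps)
      from mult_mono[OF 1 2] have "1 \<le> ((N / c) * \<rho> powr - s * wt p u) powr q * (K * \<rho> powr - T * wt r u powr T)"
        by simp
      then have "(4 * \<rho>) powr t * 1 \<le> (4 * \<rho>) powr t * (((N / c) * \<rho> powr - s * wt p u) powr q * (K * \<rho> powr - T * wt r u powr T))"
        by (intro mult_left_mono) auto
      then show ?thesis by simp
    qed
    also have "\<dots> = C * \<rho> powr \<gamma> * (wt p u powr q * wt r u powr T)"
    proof -
      have "\<rho> powr \<gamma> = \<rho> powr t * (\<rho> powr - s) powr q * \<rho> powr - T"
        using \<rho> by (simp add: \<gamma>_def powr_powr flip: powr_add)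
      moreover have "((N / c) * \<rho> powr - s * wt p u) powr q = (N / c) powr q * (\<rho> powr - s) powr q * wt p u powr q"
        using N c ru by (subst powr_mult powr_mult)+ auto
      moreover have "(4 * \<rho>) powr t = 4 powr t * \<rho> powr t" using \<rho> by (simp add: powr_mult)
      ultimately show ?thesis by (simp add: C_def)
    qed
    also have "wt p u powr q * wt r u powr T = wt (\<lambda>i. p i powr q * r i powr T) u"
      using uS(2) p_pos r01 by (simp add: wt_mult wt_powr)
    finally show "diameter (V u) powr t \<le> C * \<rho> powr \<gamma> * wt (\<lambda>i. p i powr q * r i powr T) u" .
  qed
  also have "\<dots> = C * \<rho> powr \<gamma> * (\<Sum>u\<in>Q. wt (\<lambda>i. p i powr q * r i powr T) u)"
    by (simp add: sum_distrib_left)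
  also have "\<dots> \<le> C * \<rho> powr \<gamma> * (\<Sum>u\<in>S. wt (\<lambda>i. p i powr q * r i powr T) u)"
  proof (intro mult_left_mono sum_mono2)
    show "0 \<le> C * \<rho> powr \<gamma>" by (simp add: C_def K_def)
    fix u assume "u \<in> S - Q"
    then show "0 \<le> wt (\<lambda>i. p i powr q * r i powr T) u"
      unfolding wt_def by (intro prod_list_nonneg) auto
  qed (use S in \<open>auto simp: Q_def\<close>)
  also have "\<dots> = C * \<rho> powr \<gamma>" using cut_sum[OF S_cut J_fin T] by simp
  finally have "(\<Sum>u\<in>Q. diameter (V u) powr t) < e" using \<rho>(4) by simp
  moreover have "finite Q" using S by (simp add: Q_def)
  moreover have "\<forall>u\<in>Q. bounded (V u) \<and> diameter (V u) \<le> \<delta>"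
    using diam \<rho>(3) by (auto simp: V_def intro: order_trans[OF diam])
  ultimately show "\<exists>(Q :: nat list set) V. finite Q \<and> A \<subseteq> (\<Union>u\<in>Q. V u) \<and>
     (\<forall>u\<in>Q. bounded (V u) \<and> diameter (V u) \<le> \<delta>) \<and> (\<Sum>u\<in>Q. diameter (V u) powr t) < e"
    using cover by blast
qed

lemma dim_sublevel_le:
  assumes q: "0 \<le> q" and T: "(\<Sum>i\<in>J. p i powr q * r i powr T) = 1" and nn: "0 \<le> \<alpha> * q + T"
  shows "hausdorff_dim (assouad_sublevel_set \<mu> (ereal \<alpha>)) \<le> ereal (\<alpha> * q + T)"
proof (rule hausdorff_dim_leI[OF nn])
  fix t assume t: "\<alpha> * q + T < t"
  obtain s where s: "\<alpha> < s" "s * q + T < t"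
  proof -
    define g where "g = t - \<alpha> * q - T"
    define h where "h = g / (q + 1)"
    have g: "0 < g" using t by (simp add: g_def)
    then have h: "0 < h" using q by (simp add: h_def)
    have "h * (q + 1) = g" using q by (simp add: h_def)
    then have "h * q \<le> g" using h by (simp add: algebra_simps)
    define s where "s = \<alpha> + h / 2"
    have "s * q = \<alpha> * q + (h * q) / 2" by (simp add: s_def algebra_simps)
    then have "\<alpha> < s" "s * q + T < t" using h g \<open>h * q \<le> g\<close> by (auto simp: s_def g_def)
    then show ?thesis using that by blast
  qed
  define A where "A n = {x\<in>X. \<forall>\<rho>. 0 < \<rho> \<and> \<rho> < 1 \<longrightarrow> inverse (real (Suc n)) * \<rho> powr s \<le> measure \<mu> (cball x \<rho>)}" for n
  have "hausdorff_measure t (A n) = 0" for n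
    using hausdorff_null_heavy[OF q T, of t s "inverse (real (Suc n))" "A n"] t nn s by (auto simp: A_def)
  then have "hausdorff_measure t (\<Union>n. A n) = 0" by (rule hausdorff_measure_0_UN)
  moreover have "assouad_sublevel_set \<mu> (ereal \<alpha>) \<subseteq> (\<Union>n. A n)"
  proof
    fix x assume "x \<in> assouad_sublevel_set \<mu> (ereal \<alpha>)"
    then have x: "x \<in> X" and "assouad_dim_at \<mu> x \<le> ereal \<alpha>"
      by (auto simp: assouad_sublevel_set_def spt_eq)
    then have "assouad_dim_at \<mu> x < ereal s" using s(1) by (metis ereal_less_eq(3) less_ereal.simps(1) order_le_less_trans)
    then obtain s' C where b: "s' < s" "0 < C" "assouad_bound \<mu> x C s'"
      unfolding assouad_dim_at_def Inf_less_iff by auto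
    obtain n where n: "C < real n" using reals_Archimedean2 by blast
    have "inverse (real (Suc n)) * \<rho> powr s \<le> measure \<mu> (cball x \<rho>)" if \<rho>: "0 < \<rho>" "\<rho> < 1" for \<rho>
    proof -
      have "1 = measure \<mu> (cball x 1)" using ball_mass_1[OF x] by simp
      also have "\<dots> \<le> C * (1 / \<rho>) powr s' * measure \<mu> (cball x \<rho>)"
        using b(3)[unfolded assouad_bound_iff[OF x]] \<rho> by blast
      also have "\<dots> = C * measure \<mu> (cball x \<rho>) / \<rho> powr s'" using \<rho> by (simp add: powr_divide)
      finally have "\<rho> powr s' \<le> C * measure \<mu> (cball x \<rho>)" using \<rho> by (simp add: field_simps)
      moreover have "\<rho> powr s \<le> \<rho> powr s'" using b \<rho> by (intro powr_mono') auto
      moreover have "C * measure \<mu> (cball x \<rho>) \<le> real (Suc n) * measure \<mu> (cball x \<rho>)"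
        using n by (intro mult_right_mono) auto
      ultimately have "\<rho> powr s \<le> real (Suc n) * measure \<mu> (cball x \<rho>)" by linarith
      then show ?thesis by (simp add: inverse_eq_divide divide_le_eq mult.commute)
    qed
    then show "x \<in> (\<Union>n. A n)" using x by (auto simp: A_def)
  qed
  ultimately show "hausdorff_measure t (assouad_sublevel_set \<mu> (ereal \<alpha>)) = 0"
    by (rule hausdorff_measure_0_mono[rotated])
qed

lemma dim_X_le:
  assumes T: "(\<Sum>i\<in>J. r i powr T) = 1" and nn: "0 \<le> T"
  shows "hausdorff_dim X \<le> ereal T"
proof (rule hausdorff_dim_leI[OF nn])
  fix t assume "T < t"
  have "(\<Sum>i\<in>J. p i powr 0 * r i powr T) = (\<Sum>i\<in>J. r i powr T)"
    by (intro sum.cong refl) (use p_pos in force)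
  then have T0: "(\<Sum>i\<in>J. p i powr 0 * r i powr T) = 1" using T by simp
  have "(rmin / 2) powr amax * \<rho> powr amax \<le> measure \<mu> (cball x \<rho>)"
    if x: "x \<in> X" "0 < \<rho>" "\<rho> < 1" for x \<rho>
  proof -
    obtain w where w: "w \<in> lists J" "x \<in> cyl w" "wt r w \<le> \<rho>" "rmin * \<rho> \<le> wt r w"
      using cyl_refine[of "[]" x \<rho>] x by auto
    have "(rmin / 2) powr amax * \<rho> powr amax = (rmin * \<rho> / 2) powr amax"
      using rmin_rmax(1) x by (simp flip: powr_mult)
    also have "\<dots> \<le> wt r w powr amax"
    proof -
      have "rmin * \<rho> / 2 \<le> rmin * \<rho>" using rmin_rmax(1) x by simp
      then have "rmin * \<rho> / 2 \<le> wt r w" using w(4) by linarith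
      then show ?thesis using rmin_rmax(1) x amax_pos by (intro powr_mono2) auto
    qed
    also have "\<dots> \<le> wt p w" using wt_p_bounds w by blast
    also have "\<dots> \<le> measure \<mu> (cball x \<rho>)" using ball_mass_ge w by blast
    finally show ?thesis .
  qed
  moreover have "0 < (rmin / 2) powr amax" using rmin_rmax(1) by simp
  ultimately show "hausdorff_measure t X = 0"
    using hausdorff_null_heavy[OF order_refl T0, of t amax "(rmin / 2) powr amax" X] \<open>T < t\<close> nn by auto
qed

end

section \<open>The multifractal spectrum\<close>

locale multifractal = self_similar_measure J r \<phi> X p \<mu>
  for J r and \<phi> :: "nat \<Rightarrow> 'a::euclidean_space \<Rightarrow> 'a" and X p \<mu> +
  fixes \<tau> :: "real \<Rightarrow> real"
  assumes tau_sum: "(\<Sum>i\<in>J. p i powr q * r i powr \<tau> q) = 1"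
begin

text \<open>The Gibbs weights at inverse temperature \<open>q\<close>, and the local exponent that is typical for them,
  which is \<open>- \<tau>' q\<close>.\<close>
definition tilt where "tilt q i = p i powr q * r i powr \<tau> q"

definition slope where
  "slope q = (\<Sum>i\<in>J. tilt q i * ln (p i)) / (\<Sum>i\<in>J. tilt q i * ln (r i))"

lemma tilt_pos: "i \<in> J \<Longrightarrow> 0 < tilt q i"
  using p_pos[of i] r01[of i] by (simp add: tilt_def)

lemma tilt_sum: "(\<Sum>i\<in>J. tilt q i) = 1"
  using tau_sum by (simp add: tilt_def)

lemma mean_ln_r_neg: "(\<Sum>i\<in>J. tilt q i * ln (r i)) < 0"
proof -
  have "0 < (\<Sum>i\<in>J. tilt q i * (- ln (r i)))"
    using J_fin J_ne tilt_pos r01 by (intro sum_pos mult_pos_pos) auto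
  then show ?thesis by (simp add: sum_negf)
qed

lemma slope_mean: "(\<Sum>i\<in>J. tilt q i * (ln (p i) - slope q * ln (r i))) = 0"
proof -
  have "(\<Sum>i\<in>J. tilt q i * (ln (p i) - slope q * ln (r i)))
      = (\<Sum>i\<in>J. tilt q i * ln (p i)) - slope q * (\<Sum>i\<in>J. tilt q i * ln (r i))"
    by (simp add: algebra_simps sum_subtractf sum_distrib_left)
  then show ?thesis using mean_ln_r_neg[of q] by (simp add: slope_def)
qed

text \<open>Gibbs' inequality for the weights of \<open>q\<close> and \<open>q'\<close>. It exhibits \<open>- slope q\<close> as a subgradient of
  \<open>\<tau>\<close> at \<open>q\<close>, which replaces both the convexity and the derivative of \<open>\<tau>\<close>.\<close>
lemma tangent: "slope q * q + \<tau> q \<le> slope q * q' + \<tau> q'"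
proof -
  let ?A = "\<Sum>i\<in>J. tilt q i * ln (p i)" and ?B = "\<Sum>i\<in>J. tilt q i * ln (r i)"
  have "(\<Sum>i\<in>J. tilt q i * (1 + ((q' - q) * ln (p i) + (\<tau> q' - \<tau> q) * ln (r i))))
      \<le> (\<Sum>i\<in>J. p i powr q' * r i powr \<tau> q')"
  proof (rule sum_mono)
    fix i assume i: "i \<in> J"
    have "tilt q i * (1 + ((q' - q) * ln (p i) + (\<tau> q' - \<tau> q) * ln (r i)))
        \<le> tilt q i * exp ((q' - q) * ln (p i) + (\<tau> q' - \<tau> q) * ln (r i))"
      using tilt_pos[OF i] exp_ge_add_one_self by (intro mult_left_mono) (auto simp: less_imp_le)
    also have "\<dots> = p i powr q' * r i powr \<tau> q'"
      using p_pos[OF i] r01[OF i] by (simp add: tilt_def powr_def algebra_simps flip: exp_add)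
    finally show "tilt q i * (1 + ((q' - q) * ln (p i) + (\<tau> q' - \<tau> q) * ln (r i))) \<le> p i powr q' * r i powr \<tau> q'" .
  qed
  also have "\<dots> = 1" by (rule tau_sum)
  also have "(\<Sum>i\<in>J. tilt q i * (1 + ((q' - q) * ln (p i) + (\<tau> q' - \<tau> q) * ln (r i))))
      = (\<Sum>i\<in>J. tilt q i) + (q' - q) * ?A + (\<tau> q' - \<tau> q) * ?B"
    by (simp add: algebra_simps sum.distrib sum_subtractf sum_distrib_left)
  finally have "(q' - q) * ?A + (\<tau> q' - \<tau> q) * ?B \<le> 0" by (simp add: tilt_sum)
  moreover have "?A = slope q * ?B" using mean_ln_r_neg[of q] by (simp add: slope_def)
  ultimately have "((q' - q) * slope q + (\<tau> q' - \<tau> q)) * ?B \<le> 0" by (simp add: algebra_simps)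
  then have "0 \<le> (q' - q) * slope q + (\<tau> q' - \<tau> q)"
    using mean_ln_r_neg[of q] by (meson mult_neg_neg not_le)
  then show ?thesis by (simp add: algebra_simps)
qed

lemma slope_bounds: "amin \<le> slope q" "slope q \<le> amax"
proof -
  let ?A = "\<Sum>i\<in>J. tilt q i * ln (p i)" and ?B = "\<Sum>i\<in>J. tilt q i * ln (r i)"
  have ln_r: "ln (r i) < 0" if "i \<in> J" for i using r01 that by simp
  have "?A \<le> amin * ?B"
    unfolding sum_distrib_left
  proof (rule sum_mono)
    fix i assume i: "i \<in> J"
    have "ln (p i) \<le> amin * ln (r i)" using amin_amax(1)[OF i] ln_r[OF i] by (simp add: neg_le_divide_eq)
    then show "tilt q i * ln (p i) \<le> amin * (tilt q i * ln (r i))"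
      using tilt_pos[OF i] by (simp add: mult.left_commute)
  qed
  then show "amin \<le> slope q" using mean_ln_r_neg[of q] by (simp add: slope_def neg_le_divide_eq)
  have "amax * ?B \<le> ?A"
    unfolding sum_distrib_left
  proof (rule sum_mono)
    fix i assume i: "i \<in> J"
    have "amax * ln (r i) \<le> ln (p i)" using amin_amax(2)[OF i] ln_r[OF i] by (simp add: neg_divide_le_eq)
    then show "amax * (tilt q i * ln (r i)) \<le> tilt q i * ln (p i)"
      using tilt_pos[OF i] by (simp add: mult.left_commute)
  qed
  then show "slope q \<le> amax" using mean_ln_r_neg[of q] by (simp add: slope_def neg_divide_le_eq)
qed

lemma tau_lower: "0 \<le> amin * q + \<tau> q"
proof -
  obtain i where i: "i \<in> J" "ln (p i) / ln (r i) = amin" using amin_amax(3) by blast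
  have "tilt q i \<le> (\<Sum>j\<in>J. tilt q j)"
    using i J_fin tilt_pos by (intro member_le_sum) (auto simp: less_imp_le)
  also have "\<dots> = 1" by (rule tilt_sum)
  finally have "ln (tilt q i) \<le> 0" using tilt_pos[OF i(1)] by simp
  moreover have "ln (tilt q i) = q * ln (p i) + \<tau> q * ln (r i)"
    using p_pos[OF i(1)] r01[OF i(1)] by (simp add: tilt_def ln_mult ln_powr)
  moreover have "ln (p i) = amin * ln (r i)" using i(2) r01[OF i(1)] by (auto simp: divide_eq_eq)
  ultimately have "(amin * q + \<tau> q) * ln (r i) \<le> 0" by (simp add: algebra_simps)
  moreover have "ln (r i) < 0" using r01[OF i(1)] by simp
  ultimately show ?thesis by (meson mult_neg_neg not_le)
qed

lemma tau_lipschitz: "\<bar>\<tau> q - \<tau> q'\<bar> \<le> amax * \<bar>q - q'\<bar>"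
proof -
  have "\<tau> a - \<tau> b \<le> amax * \<bar>a - b\<bar>" for a b
  proof -
    have "\<tau> a - \<tau> b \<le> slope a * (b - a)" using tangent[of a b] by (simp add: algebra_simps)
    also have "\<dots> \<le> slope a * \<bar>a - b\<bar>" using slope_bounds(1)[of a] amin_pos by (intro mult_left_mono) auto
    also have "\<dots> \<le> amax * \<bar>a - b\<bar>" using slope_bounds(2) by (intro mult_right_mono) auto
    finally show ?thesis .
  qed
  from this[of q q'] this[of q' q] show ?thesis by (simp add: abs_le_iff abs_minus_commute)
qed

lemma continuous_tau: "continuous_on UNIV \<tau>"
proof -
  have "amax-lipschitz_on UNIV \<tau>"
    using tau_lipschitz amax_pos by (intro lipschitz_onI) (auto simp: dist_real_def less_imp_le)
  then show ?thesis by (rule lipschitz_on_continuous_on)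
qed

lemma continuous_slope: "continuous_on UNIV slope"
proof -
  have "continuous_on UNIV (\<lambda>q. tilt q i)" if i: "i \<in> J" for i
    unfolding tilt_def using p_pos[OF i] r01[OF i]
    by (intro continuous_intros continuous_tau) auto
  then show ?thesis
    unfolding slope_def using mean_ln_r_neg by (intro continuous_intros) (auto simp: less_imp_neq)
qed

text \<open>The slope tends to \<open>amin\<close> as \<open>q\<close> grows, so it takes the value \<open>\<alpha>\<close> at some \<open>q \<ge> 0\<close> unless it is
  already below \<open>\<alpha>\<close> at zero. By \<open>tangent\<close> the conclusion says that \<open>q\<close> minimises \<open>\<alpha> q + \<tau> q\<close> over
  \<open>q \<ge> 0\<close>; the product is the complementary slackness condition.\<close>
lemma minimiser_exists:
  assumes "amin < \<alpha>"
  shows "\<exists>q\<ge>0. slope q \<le> \<alpha> \<and> (\<alpha> - slope q) * q = 0"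
proof (cases "slope 0 \<le> \<alpha>")
  case True
  then show ?thesis by (intro exI[of _ 0]) auto
next
  case False
  define q1 where "q1 = max 1 (\<tau> 0 / (\<alpha> - amin))"
  have q1: "0 < q1" "\<tau> 0 \<le> q1 * (\<alpha> - amin)"
    using assms by (auto simp: q1_def field_simps max_def)
  have "(slope q1 - amin) * q1 \<le> \<tau> 0"
    using tangent[of q1 0] tau_lower[of q1] by (simp add: algebra_simps)
  moreover have "q1 * (\<alpha> - amin) = (\<alpha> - amin) * q1" by (rule mult.commute)
  ultimately have "(slope q1 - amin) * q1 \<le> (\<alpha> - amin) * q1" using q1(2) by linarith
  then have "slope q1 - amin \<le> \<alpha> - amin" using q1(1) by (rule mult_right_le_imp_le)
  then have "slope q1 \<le> \<alpha>" by simp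
  moreover have "continuous_on {0..q1} slope" using continuous_slope continuous_on_subset by blast
  ultimately obtain q where "0 \<le> q" "q \<le> q1" "slope q = \<alpha>"
    using IVT2'[of slope q1 \<alpha> 0] False q1 by auto
  then show ?thesis by auto
qed

end

section \<open>Type classes of words\<close>

lemma sum_level_Suc:
  assumes "finite J"
  shows "(\<Sum>w\<in>level J (Suc n). f w) = (\<Sum>i\<in>J. \<Sum>w\<in>level J n. f (i # w))"
proof -
  have fin: "finite (level J n)" using cut_finite[OF cut_level assms] .
  have "(\<Sum>w\<in>level J (Suc n). f w) = (\<Sum>i\<in>J. \<Sum>w\<in>(#) i ` level J n. f w)"
    unfolding level_Suc using assms fin by (intro sum.UNION_disjoint) auto
  also have "\<dots> = (\<Sum>i\<in>J. \<Sum>w\<in>level J n. f (i # w))"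
    by (rule sum.cong) (simp_all add: sum.reindex)
  finally show ?thesis .
qed

lemma level_variance:
  fixes P c :: "nat \<Rightarrow> real"
  assumes J: "finite J" and P: "(\<Sum>i\<in>J. P i) = 1" and c: "(\<Sum>i\<in>J. P i * c i) = 0"
  shows "(\<Sum>w\<in>level J n. wt P w * (sum_list (map c w))\<^sup>2) = n * (\<Sum>i\<in>J. P i * (c i)\<^sup>2)"
proof (induction n)
  case 0
  have "level J 0 = {[]}" by (auto simp: level_def)
  then show ?case by simp
next
  case (Suc n)
  let ?S = "\<lambda>w. sum_list (map c w)" and ?L = "level J n"
  have one: "(\<Sum>w\<in>?L. wt P w) = 1" by (rule cut_sum[OF cut_level J P])
  have "(\<Sum>w\<in>level J (Suc n). wt P w * (?S w)\<^sup>2)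
      = (\<Sum>i\<in>J. \<Sum>w\<in>?L. P i * (c i)\<^sup>2 * wt P w + (P i * c i) * (2 * wt P w * ?S w) + P i * (wt P w * (?S w)\<^sup>2))"
    unfolding sum_level_Suc[OF J] by (intro sum.cong refl) (simp add: power2_eq_square algebra_simps)
  also have "\<dots> = (\<Sum>i\<in>J. P i * (c i)\<^sup>2) * (\<Sum>w\<in>?L. wt P w)
      + (\<Sum>i\<in>J. P i * c i) * (\<Sum>w\<in>?L. 2 * wt P w * ?S w) + (\<Sum>i\<in>J. P i) * (\<Sum>w\<in>?L. wt P w * (?S w)\<^sup>2)"
    by (simp add: sum.distrib sum_product)
  also have "\<dots> = real (Suc n) * (\<Sum>i\<in>J. P i * (c i)\<^sup>2)"
    using Suc.IH by (simp add: one P c algebra_simps)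
  finally show ?case .
qed

lemma card_types:
  assumes J: "finite J" shows "finite (mset ` level J n) \<and> card (mset ` level J n) \<le> (n + 1) ^ card J"
proof -
  define h where "h M = restrict (count M) J" for M :: "nat multiset"
  let ?T = "mset ` level J n"
  have sub: "h ` ?T \<subseteq> PiE J (\<lambda>_. {..n})"
  proof -
    have "count (mset w) i \<le> n" if "w \<in> level J n" for w i
      using that count_le_length[of w i] by (simp add: level_def count_mset)
    then show ?thesis by (auto simp: h_def)
  qed
  have inj: "inj_on h ?T"
  proof (rule inj_onI)
    fix M M' assume M: "M \<in> ?T" "M' \<in> ?T" "h M = h M'"
    show "M = M'"
    proof (rule multiset_eqI)
      fix i
      show "count M i = count M' i"
      proof (cases "i \<in> J")
        case True
        then show ?thesis using M(3) by (metis h_def restrict_apply')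
      next
        case False
        then have "i \<notin># M" "i \<notin># M'" using M by (auto simp: level_def)
        then show ?thesis by (simp add: not_in_iff)
      qed
    qed
  qed
  have fin: "finite (PiE J (\<lambda>_. {..n}))" using J by (intro finite_PiE) auto
  have "card ?T \<le> card (PiE J (\<lambda>_. {..n}))" using card_inj_on_le[OF inj sub fin] .
  also have "\<dots> = (n + 1) ^ card J" using J by (simp add: card_PiE)
  finally show ?thesis using inj_on_finite[OF inj sub fin] by blast
qed

text \<open>By Chebyshev's inequality most of the mass sits on words whose sum of \<open>c\<close> is small; as there
  are only polynomially many letter counts, one of them carries a polynomial share of this mass.\<close>
lemma type_class_exists:
  fixes P c :: "nat \<Rightarrow> real" and \<epsilon> :: real
  assumes J: "finite J" and Ppos: "\<And>i. i \<in> J \<Longrightarrow> 0 < P i" and P: "(\<Sum>i\<in>J. P i) = 1"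
    and c: "(\<Sum>i\<in>J. P i * c i) = 0" and \<epsilon>: "0 < \<epsilon>"
  shows "\<exists>n0. \<forall>n\<ge>n0. \<exists>T\<subseteq>level J n. T \<noteq> {} \<and> (\<forall>u\<in>T. \<forall>w\<in>T. mset u = mset w) \<and>
     (\<forall>w\<in>T. \<bar>sum_list (map c w)\<bar> \<le> \<epsilon> * n \<and> 1 \<le> 2 * real ((n + 1) ^ card J) * card T * wt P w)"
proof -
  define \<sigma> where "\<sigma> = (\<Sum>i\<in>J. P i * (c i)\<^sup>2)"
  obtain n0 where n0: "2 * \<sigma> / \<epsilon>\<^sup>2 < real n0" using reals_Archimedean2 by blast
  have "\<exists>T\<subseteq>level J n. T \<noteq> {} \<and> (\<forall>u\<in>T. \<forall>w\<in>T. mset u = mset w) \<and>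
     (\<forall>w\<in>T. \<bar>sum_list (map c w)\<bar> \<le> \<epsilon> * n \<and> 1 \<le> 2 * real ((n + 1) ^ card J) * card T * wt P w)"
    if n: "max n0 1 \<le> n" for n
  proof -
    let ?S = "\<lambda>w. sum_list (map c w)" and ?L = "level J n"
    define K where "K = (n + 1) ^ card J"
    have fin: "finite ?L" using cut_finite[OF cut_level J] .
    have wpos: "0 < wt P w" if "w \<in> ?L" for w
      using that Ppos by (auto simp: level_def intro: wt_pos)
    define G where "G = {w\<in>?L. \<bar>?S w\<bar> \<le> \<epsilon> * n}"
    define m where "m = (\<Sum>w\<in>?L - G. wt P w)"
    have np: "0 < real n" using n by simp
    have "m * (\<epsilon> * n)\<^sup>2 \<le> (\<Sum>w\<in>?L - G. wt P w * (?S w)\<^sup>2)"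
      unfolding m_def sum_distrib_right
    proof (rule sum_mono)
      fix w assume w: "w \<in> ?L - G"
      then have "(\<epsilon> * n)\<^sup>2 \<le> \<bar>?S w\<bar>\<^sup>2" using \<epsilon> np by (intro power_mono) (auto simp: G_def)
      then show "wt P w * (\<epsilon> * n)\<^sup>2 \<le> wt P w * (?S w)\<^sup>2"
        using wpos[of w] w by (intro mult_left_mono) auto
    qed
    also have "\<dots> \<le> (\<Sum>w\<in>?L. wt P w * (?S w)\<^sup>2)"
    proof (rule sum_mono2)
      fix w assume "w \<in> ?L - (?L - G)"
      then have "0 < wt P w" using wpos by blast
      then show "0 \<le> wt P w * (?S w)\<^sup>2" by simp
    qed (use fin in auto)
    also have "\<dots> = n * \<sigma>" unfolding \<sigma>_def by (rule level_variance[OF J P c])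
    finally have "(m * n * \<epsilon>\<^sup>2) * n \<le> \<sigma> * n" by (simp add: power2_eq_square algebra_simps)
    then have "m * n * \<epsilon>\<^sup>2 \<le> \<sigma>" using np by (rule mult_right_le_imp_le)
    moreover have "2 * \<sigma> < n * \<epsilon>\<^sup>2"
    proof -
      have "2 * \<sigma> / \<epsilon>\<^sup>2 < n" using n0 n by simp
      then show ?thesis using \<epsilon> by (simp add: divide_less_eq)
    qed
    ultimately have "m * (n * \<epsilon>\<^sup>2) < (1 / 2) * (n * \<epsilon>\<^sup>2)" by simp
    then have "m < 1 / 2" using np \<epsilon> by (subst (asm) mult_less_cancel_right_pos) auto
    moreover have "(\<Sum>w\<in>?L. wt P w) = m + (\<Sum>w\<in>G. wt P w)"
      unfolding m_def using fin by (intro sum.subset_diff) (auto simp: G_def)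
    ultimately have half: "1 / 2 < (\<Sum>w\<in>G. wt P w)" using cut_sum[OF cut_level J P, of n] by simp
    have finG: "finite G" using fin by (simp add: G_def)
    define TG where "TG = mset ` G"
    have TG: "finite TG" "card TG \<le> K"
    proof -
      have "TG \<subseteq> mset ` ?L" by (auto simp: TG_def G_def)
      then show "finite TG" "card TG \<le> K"
        using card_types[OF J, of n] card_mono[of "mset ` ?L" TG] finite_subset[of TG "mset ` ?L"]
        unfolding K_def by auto
    qed
    have "(\<Sum>w\<in>G. wt P w) = (\<Sum>M\<in>TG. \<Sum>w\<in>{w\<in>G. mset w = M}. wt P w)"
      unfolding TG_def by (rule sum.image_gen[OF finG])
    then have big: "1 / 2 < (\<Sum>M\<in>TG. \<Sum>w\<in>{w\<in>G. mset w = M}. wt P w)" using half by simp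
    have "\<exists>M\<in>TG. 1 / (2 * K) \<le> (\<Sum>w\<in>{w\<in>G. mset w = M}. wt P w)"
    proof (rule ccontr)
      assume "\<not> ?thesis"
      then have "(\<Sum>M\<in>TG. \<Sum>w\<in>{w\<in>G. mset w = M}. wt P w) \<le> (\<Sum>M\<in>TG. 1 / (2 * K))"
        by (intro sum_mono) (auto simp: not_le less_imp_le)
      also have "\<dots> = real (card TG) / (2 * K)" by simp
      also have "\<dots> \<le> real K / (2 * K)" using TG by (intro divide_right_mono) auto
      also have "\<dots> = 1 / 2" by (simp add: K_def)
      finally show False using big by simp
    qed
    then obtain M where M: "M \<in> TG" "1 / (2 * K) \<le> (\<Sum>w\<in>{w\<in>G. mset w = M}. wt P w)" by blast
    define T where "T = {w\<in>G. mset w = M}"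
    have "T \<subseteq> ?L" "T \<noteq> {}" using M(1) by (auto simp: T_def G_def TG_def)
    moreover have "1 \<le> 2 * real K * card T * wt P w" if w: "w \<in> T" for w
    proof -
      have "(\<Sum>u\<in>T. wt P u) = (\<Sum>u\<in>T. wt P w)"
        using w by (intro sum.cong refl wt_mset) (auto simp: T_def)
      then have "1 / (2 * real K) \<le> card T * wt P w" using M(2) by (simp add: T_def)
      moreover have "0 < real K" by (simp add: K_def)
      ultimately show ?thesis by (simp add: divide_le_eq algebra_simps)
    qed
    ultimately show ?thesis
      unfolding K_def by (intro exI[of _ T]) (auto simp: T_def G_def)
  qed
  then show ?thesis by blast
qed

section \<open>Lower bounds for the dimension\<close>

definition spell :: "(nat \<Rightarrow> 'b list) \<Rightarrow> nat \<Rightarrow> 'b list" where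
  "spell \<omega> n = concat (map \<omega> [0..<n])"

lemma spell_0 [simp]: "spell \<omega> 0 = []"
  and spell_Suc [simp]: "spell \<omega> (Suc n) = spell \<omega> n @ \<omega> n"
  by (simp_all add: spell_def)

lemma spell_lists: "(\<And>j. \<omega> j \<in> lists J) \<Longrightarrow> spell \<omega> n \<in> lists J"
  by (induction n) auto

lemma spell_cong: "(\<And>j. j < n \<Longrightarrow> \<omega> j = \<omega>' j) \<Longrightarrow> spell \<omega> n = spell \<omega>' n"
  by (induction n) auto

lemma spell_prefix: "n \<le> n' \<Longrightarrow> prefix (spell \<omega> n) (spell \<omega> n')"
  by (induction n' rule: dec_induct) auto

lemma wt_spell: "wt f (spell \<omega> n) = (\<Prod>j<n. wt f (\<omega> j))"
  by (induction n) (auto simp: mult.commute)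

lemma spell_antichain:
  assumes "\<And>j. antichain (\<Gamma> j)" "\<And>j. \<omega> j \<in> \<Gamma> j" "\<And>j. \<omega>' j \<in> \<Gamma> j"
    and "prefix (spell \<omega> n) (spell \<omega>' n)"
  shows "\<forall>j<n. \<omega> j = \<omega>' j"
proof -
  have "prefix (spell \<omega> n) (spell \<omega>' n) \<or> prefix (spell \<omega>' n) (spell \<omega> n) \<Longrightarrow> \<forall>j<n. \<omega> j = \<omega>' j"
  proof (induction n)
    case (Suc n)
    have "prefix (spell \<omega> n) (spell \<omega>' n) \<or> prefix (spell \<omega>' n) (spell \<omega> n)"
      using Suc.prems by (metis append_prefixD prefix_same_cases prefix_prefix prefixI spell_Suc)
    then have IH: "\<forall>j<n. \<omega> j = \<omega>' j" by (rule Suc.IH)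
    then have "spell \<omega> n = spell \<omega>' n" by (intro spell_cong) auto
    then have "prefix (\<omega> n) (\<omega>' n) \<or> prefix (\<omega>' n) (\<omega> n)" using Suc.prems by simp
    then have "\<omega> n = \<omega>' n" using assms(1)[of n] assms(2,3)[of n] by (metis antichain_def)
    then show ?case using IH by (auto simp: less_Suc_eq)
  qed simp
  then show ?thesis using assms(4) by blast
qed

context osc_ifs
begin

text \<open>A Moran set inside the attractor, with the blocks in the role of letters.\<close>
definition coded :: "(nat \<Rightarrow> nat list set) \<Rightarrow> 'a set" where
  "coded \<Gamma> = {x. \<exists>\<omega>. (\<forall>j. \<omega> j \<in> \<Gamma> j) \<and> (\<forall>n. x \<in> cyl (spell \<omega> n))}"

lemma coded_point_exists:
  assumes "\<And>j. \<omega> j \<in> lists J" shows "\<exists>x. \<forall>n. x \<in> cyl (spell \<omega> n)"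
proof -
  have "\<Inter>(range (\<lambda>n. cyl (spell \<omega> n))) \<noteq> {}"
  proof (rule compact_nest)
    fix n n' :: nat
    show "compact (cyl (spell \<omega> n))" by (intro cyl_compact spell_lists assms)
    show "cyl (spell \<omega> n) \<noteq> {}" by (rule cyl_ne)
    assume "n \<le> n'"
    then show "cyl (spell \<omega> n') \<subseteq> cyl (spell \<omega> n)"
      by (intro cyl_prefix spell_lists spell_prefix assms)
  qed
  then show ?thesis by auto
qed

text \<open>The uniform product measure on the sequences of blocks plays the role of a mass distribution.
  A set of diameter \<open>d\<close> meets boundedly many of the cylinders whose size is the last one that is
  not below \<open>d\<close>, so it is charged with at most a constant times \<open>d powr t\<close>.\<close>
lemma dim_coded_ge:
  assumes fin: "\<And>j. finite (\<Gamma> j)" and ne: "\<And>j. \<Gamma> j \<noteq> {}" and wds: "\<And>j. \<Gamma> j \<subseteq> lists J"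
    and ac: "\<And>j. antichain (\<Gamma> j)" and noNil: "\<And>j. [] \<notin> \<Gamma> j"
    and \<kappa>: "\<And>j g. g \<in> \<Gamma> j \<Longrightarrow> wt r g = \<kappa> j"
    and t: "0 < t" and C: "0 < C"
    and mass: "\<And>n. (\<Prod>j<n. 1 / card (\<Gamma> j)) \<le> C * (\<Prod>j<Suc n. \<kappa> j) powr t"
    and sub: "coded \<Gamma> \<subseteq> A"
  shows "ereal t \<le> hausdorff_dim A"
  unfolding hausdorff_dim_def
proof (rule Inf_greatest, clarsimp)
  fix s :: real assume s: "0 < s" "hausdorff_measure s A = 0"
  show "t \<le> s"
  proof (rule ccontr)
    assume "\<not> t \<le> s"
    define N where "N = neighbour_bound"
    have N: "0 < real N" using neighbour_bound_pos by (simp add: N_def)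
    define e where "e = 1 / (4 * N * C)"
    have e: "0 < e" using N C by (simp add: e_def)
    obtain V where V: "fine_cover 1 A V" and Vs: "(\<Sum>n. ennreal (diameter (V n) powr s)) < ennreal e"
      using s(2) e unfolding hausdorff_measure_eq_0_iff by (meson zero_less_one)
    define M where "M j = uniform_count_measure (\<Gamma> j)" for j
    interpret PM: product_prob_space M UNIV
      by (intro product_prob_spaceI) (simp add: M_def prob_space_uniform_count_measure fin ne)
    define PM where "PM = PiM UNIV M"
    have space_PM: "\<omega> \<in> space PM \<longleftrightarrow> (\<forall>j. \<omega> j \<in> \<Gamma> j)" for \<omega>
      by (auto simp: PM_def space_PiM M_def space_uniform_count_measure PiE_def Pi_def)
    define \<rho> where "\<rho> n = (\<Prod>j<n. \<kappa> j)" for n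
    have \<kappa>_bd: "0 < \<kappa> j \<and> \<kappa> j \<le> rmax" for j
    proof -
      obtain g where g: "g \<in> \<Gamma> j" using ne by blast
      then have gl: "g \<in> lists J" "g \<noteq> []" using wds noNil by auto
      have "rmax ^ length g \<le> rmax ^ 1"
        using gl rmin_rmax(1-3) by (intro power_decreasing) (auto simp: Suc_le_eq)
      then show ?thesis using \<kappa>[OF g] wt_r_power[OF gl(1)] wt_r_pos[OF gl(1)] by simp
    qed
    have \<rho>_pos: "0 < \<rho> n" for n using \<kappa>_bd by (auto simp: \<rho>_def intro: prod_pos)
    have \<rho>_small: "\<rho> n \<le> rmax ^ n" for n
    proof -
      have "\<rho> n \<le> (\<Prod>j<n. rmax)" unfolding \<rho>_def using \<kappa>_bd by (intro prod_mono) (auto simp: less_imp_le)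
      then show ?thesis by simp
    qed
    have wt_sp: "wt r (spell \<omega> n) = \<rho> n" if "\<omega> \<in> space PM" for \<omega> n
      using that \<kappa> unfolding wt_spell \<rho>_def space_PM by (intro prod.cong) auto
    have sp_l: "spell \<omega> n \<in> lists J" if "\<omega> \<in> space PM" for \<omega> n
      using that wds by (intro spell_lists) (auto simp: space_PM)
    obtain xp where xp: "\<And>\<omega> n. \<omega> \<in> space PM \<Longrightarrow> xp \<omega> \<in> cyl (spell \<omega> n)"
      using coded_point_exists wds unfolding space_PM by (metis subsetD)
    define B where "B c k = prod_emb UNIV M {..<k} (PiE {..<k} (\<lambda>j. {c j}))" for c k
    have B_iff: "\<omega> \<in> B c k \<longleftrightarrow> \<omega> \<in> space PM \<and> (\<forall>j<k. \<omega> j = c j)" for \<omega> c k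
      by (auto simp: B_def prod_emb_def PM_def space_PiM restrict_def PiE_iff extensional_def)
    have B_mass: "B c k \<in> sets PM \<and> emeasure PM (B c k) = ennreal (\<Prod>j<k. 1 / card (\<Gamma> j))"
      if c: "c \<in> space PM" for c k
    proof
      have cs: "{c j} \<in> sets (M j)" for j
        using c by (simp add: M_def sets_uniform_count_measure space_PM)
      show "B c k \<in> sets PM" unfolding B_def PM_def using cs by (intro sets_PiM_I) auto
      have "emeasure PM (B c k) = (\<Prod>j<k. emeasure (M j) {c j})"
        unfolding B_def PM_def using cs by (intro PM.emeasure_PiM_emb) auto
      also have "\<dots> = (\<Prod>j<k. ennreal (1 / card (\<Gamma> j)))"
        using c fin by (intro prod.cong refl) (simp add: M_def emeasure_uniform_count_measure space_PM)
      also have "\<dots> = ennreal (\<Prod>j<k. 1 / card (\<Gamma> j))" by (rule prod_ennreal) simp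
      finally show "emeasure PM (B c k) = ennreal (\<Prod>j<k. 1 / card (\<Gamma> j))" .
    qed
    have charge: "\<exists>H\<in>sets PM. {\<omega>\<in>space PM. xp \<omega> \<in> S} \<subseteq> H \<and> emeasure PM H \<le> ennreal (N * C * d powr t)"
      if S: "bounded S" "diameter S \<le> d" and d: "0 < d" "d \<le> 1" for S d
    proof -
      obtain n where "rmax ^ n < d" using real_arch_pow_inv[OF d(1) rmin_rmax(3)] by blast
      then have "\<rho> n < d" using \<rho>_small[of n] by simp
      moreover have "\<not> \<rho> 0 < d" using d by (simp add: \<rho>_def)
      ultimately obtain k where k: "\<rho> (Suc k) < d" "d \<le> \<rho> k"
        using exists_least_lemma[of "\<lambda>n. \<rho> n < d"] by (auto simp: not_less)
      define Q where "Q = {spell \<omega> k |\<omega>. \<omega> \<in> space PM \<and> cyl (spell \<omega> k) \<inter> S \<noteq> {}}"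
      have Q: "finite Q \<and> card Q \<le> N"
      proof (cases "S = {}")
        case True
        then show ?thesis by (simp add: Q_def)
      next
        case False
        then obtain v where v: "v \<in> S" by blast
        show ?thesis unfolding N_def
        proof (rule neighbour_bound[of "\<rho> k" Q v])
          show "antichain Q"
            unfolding antichain_def
          proof (intro ballI impI)
            fix u w assume "u \<in> Q" "w \<in> Q" "prefix u w"
            then obtain \<omega> \<omega>' where o: "u = spell \<omega> k" "w = spell \<omega>' k" "\<omega> \<in> space PM" "\<omega>' \<in> space PM"
              by (auto simp: Q_def)
            then have "\<forall>j<k. \<omega> j = \<omega>' j"
              using spell_antichain[of \<Gamma> \<omega> \<omega>' k, OF ac] \<open>prefix u w\<close> by (simp add: space_PM)
            then show "u = w" using o by (auto intro: spell_cong)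
          qed
          fix u assume "u \<in> Q"
          then obtain \<omega> y where u: "u = spell \<omega> k" "\<omega> \<in> space PM" "y \<in> cyl u" "y \<in> S" by (auto simp: Q_def)
          have "dist v y \<le> d" using diameter_bounded_bound[OF S(1) v u(4)] S(2) by simp
          then have "y \<in> cball v (2 * \<rho> k)" using k \<rho>_pos[of k] by simp
          moreover have "rmin * \<rho> k \<le> 1 * \<rho> k" using rmin_lt1 \<rho>_pos[of k] by (intro mult_right_mono) auto
          ultimately show "rmin * \<rho> k \<le> wt r u \<and> wt r u \<le> \<rho> k \<and> cyl u \<inter> cball v (2 * \<rho> k) \<noteq> {}"
            using wt_sp[OF u(2)] u by auto
        qed (use \<rho>_pos sp_l in \<open>auto simp: Q_def\<close>)
      qed
      have "\<forall>w\<in>Q. \<exists>\<omega>. \<omega> \<in> space PM \<and> spell \<omega> k = w" by (auto simp: Q_def)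
      then obtain c where c: "\<And>w. w \<in> Q \<Longrightarrow> c w \<in> space PM \<and> spell (c w) k = w" by metis
      define H where "H = (\<Union>w\<in>Q. B (c w) k)"
      have Hs: "H \<in> sets PM" unfolding H_def using Q B_mass c by (intro sets.finite_UN) auto
      have "{\<omega>\<in>space PM. xp \<omega> \<in> S} \<subseteq> H"
      proof
        fix \<omega> assume "\<omega> \<in> {\<omega>\<in>space PM. xp \<omega> \<in> S}"
        then have o: "\<omega> \<in> space PM" "xp \<omega> \<in> S" by auto
        then have w: "spell \<omega> k \<in> Q" using xp by (auto simp: Q_def)
        then have "\<forall>j<k. \<omega> j = c (spell \<omega> k) j"
          using spell_antichain[of \<Gamma> \<omega> "c (spell \<omega> k)" k, OF ac] c[OF w] o by (simp add: space_PM)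
        then have "\<omega> \<in> B (c (spell \<omega> k)) k" using o by (simp add: B_iff)
        then show "\<omega> \<in> H" using w by (auto simp: H_def)
      qed
      moreover have "emeasure PM H \<le> ennreal (N * C * d powr t)"
      proof -
        have "emeasure PM H \<le> (\<Sum>w\<in>Q. emeasure PM (B (c w) k))"
          unfolding H_def using Q B_mass c by (intro emeasure_subadditive_finite) auto
        also have "\<dots> = (\<Sum>w\<in>Q. ennreal (\<Prod>j<k. 1 / card (\<Gamma> j)))" using B_mass c by (intro sum.cong refl) auto
        also have "\<dots> = ennreal (card Q * (\<Prod>j<k. 1 / card (\<Gamma> j)))"
          by (simp add: ennreal_mult prod_nonneg ennreal_of_nat_eq_real_of_nat)
        also have "\<dots> \<le> ennreal (N * C * d powr t)"
        proof (rule ennreal_leI)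
          have "(\<Prod>j<k. 1 / card (\<Gamma> j)) \<le> C * \<rho> (Suc k) powr t" using mass[of k] by (simp only: \<rho>_def)
          also have "\<dots> \<le> C * d powr t"
            using k \<rho>_pos[of "Suc k"] t C by (intro mult_left_mono powr_mono2) auto
          finally have "card Q * (\<Prod>j<k. 1 / card (\<Gamma> j)) \<le> N * (C * d powr t)"
            using Q by (intro mult_mono) (auto simp: prod_nonneg)
          then show "card Q * (\<Prod>j<k. 1 / card (\<Gamma> j)) \<le> N * C * d powr t" by simp
        qed
        finally show ?thesis .
      qed
      ultimately show ?thesis using Hs by blast
    qed
    \<comment> \<open>A covering set may have diameter zero; it is charged as a set of tiny positive diameter.\<close>
    have "\<exists>d. 0 < d \<and> d \<le> 1 \<and> diameter (V n) \<le> d \<and> d powr t \<le> diameter (V n) powr s + e * (1/2) ^ Suc n" for n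
    proof (cases "diameter (V n) = 0")
      case True
      define b where "b = e * (1/2) ^ Suc n"
      have b: "0 < b" using e by (simp add: b_def)
      have "(min 1 (b powr (1 / t))) powr t \<le> (b powr (1 / t)) powr t"
        using b t by (intro powr_mono2) auto
      also have "\<dots> = b" using b t by (simp add: powr_powr)
      finally show ?thesis using True b by (intro exI[of _ "min 1 (b powr (1 / t))"]) (auto simp: b_def)
    next
      case False
      have D: "0 \<le> diameter (V n)" "diameter (V n) \<le> 1"
        using V by (auto simp: fine_cover_def diameter_ge_0)
      then have "diameter (V n) powr t \<le> diameter (V n) powr s"
        using \<open>\<not> t \<le> s\<close> by (intro powr_mono') auto
      moreover have "0 \<le> e * (1/2) ^ Suc n" using e by simp
      ultimately show ?thesis using D False by (intro exI[of _ "diameter (V n)"]) linarith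
    qed
    then obtain d where d: "\<And>n. 0 < d n \<and> d n \<le> 1 \<and> diameter (V n) \<le> d n \<and>
        d n powr t \<le> diameter (V n) powr s + e * (1/2) ^ Suc n" by metis
    have "\<forall>n. \<exists>H. H \<in> sets PM \<and> {\<omega>\<in>space PM. xp \<omega> \<in> V n} \<subseteq> H \<and>
        emeasure PM H \<le> ennreal (N * C * d n powr t)"
    proof
      fix n
      have "bounded (V n)" using V by (simp add: fine_cover_def)
      from charge[OF this, of "d n"] show "\<exists>H. H \<in> sets PM \<and> {\<omega>\<in>space PM. xp \<omega> \<in> V n} \<subseteq> H \<and>
        emeasure PM H \<le> ennreal (N * C * d n powr t)" using d[of n] by blast
    qed
    from choice[OF this] obtain H where "\<forall>n. H n \<in> sets PM \<and> {\<omega>\<in>space PM. xp \<omega> \<in> V n} \<subseteq> H n \<and>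
        emeasure PM (H n) \<le> ennreal (N * C * d n powr t)" ..
    then have H: "\<And>n. H n \<in> sets PM" "\<And>n. {\<omega>\<in>space PM. xp \<omega> \<in> V n} \<subseteq> H n"
      "\<And>n. emeasure PM (H n) \<le> ennreal (N * C * d n powr t)" by auto
    have "space PM \<subseteq> (\<Union>n. H n)"
    proof
      fix \<omega> assume o: "\<omega> \<in> space PM"
      then have "xp \<omega> \<in> A" using xp sub unfolding coded_def space_PM by blast
      then obtain n where "xp \<omega> \<in> V n" using V unfolding fine_cover_def by blast
      then show "\<omega> \<in> (\<Union>n. H n)" using H(2)[of n] o by blast
    qed
    then have "emeasure PM (space PM) \<le> emeasure PM (\<Union>n. H n)" using H by (intro emeasure_mono) auto
    also have "\<dots> \<le> (\<Sum>n. emeasure PM (H n))" using H by (intro emeasure_subadditive_countably) auto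
    also have "\<dots> \<le> (\<Sum>n. ennreal (N * C) * (ennreal (diameter (V n) powr s) + ennreal (e * (1/2) ^ Suc n)))"
    proof (rule suminf_le)
      fix n
      have "ennreal (N * C * d n powr t) \<le> ennreal (N * C * (diameter (V n) powr s + e * (1/2) ^ Suc n))"
        using d[of n] N C by (intro ennreal_leI mult_left_mono) auto
      also have "\<dots> = ennreal (N * C) * (ennreal (diameter (V n) powr s) + ennreal (e * (1/2) ^ Suc n))"
        using N C e by (simp add: ennreal_mult ennreal_plus)
      finally show "emeasure PM (H n) \<le> \<dots>" using H(3)[of n] by (rule order_trans[rotated])
    qed auto
    also have "\<dots> = ennreal (N * C) * ((\<Sum>n. ennreal (diameter (V n) powr s)) + (\<Sum>n. ennreal (e * (1/2) ^ Suc n)))"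
      by (simp add: suminf_add)
    also have "(\<Sum>n. ennreal (e * (1/2) ^ Suc n)) = ennreal e"
      using sums_mult[OF power_half_series, of e] e by (intro suminf_ennreal_eq) auto
    also have "ennreal (N * C) * ((\<Sum>n. ennreal (diameter (V n) powr s)) + ennreal e) \<le> ennreal (N * C) * (ennreal e + ennreal e)"
      using Vs by (intro mult_left_mono add_mono) auto
    also have "ennreal e + ennreal e = ennreal (e + e)" by (rule ennreal_plus[symmetric]) (use e in auto)
    also have "ennreal (N * C) * ennreal (e + e) = ennreal (N * C * (e + e))"
      by (rule ennreal_mult[symmetric]) (use N C e in auto)
    also have "N * C * (e + e) = 1 / 2" using N C by (simp add: e_def)
    finally have "emeasure PM (space PM) \<le> ennreal (1 / 2)" .
    moreover have "emeasure PM (space PM) = 1" unfolding PM_def by (rule PM.P.emeasure_space_1)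
    ultimately have "ennreal 1 \<le> ennreal (1 / 2)" by (simp only: ennreal_1)
    then show False by (subst (asm) ennreal_le_iff) auto
  qed
qed

end

section \<open>Homogeneous blocks\<close>

lemma poly_times_geometric:
  fixes x K :: real and d :: nat
  assumes "0 < x" "x < 1"
  shows "(\<lambda>n. K * real ((n + 1) ^ d) * x ^ n) \<longlonglongrightarrow> 0"
proof -
  define y where "y = x powr (1 / real (d + 1))"
  have y: "0 < y" "y < 1"
    using assms powr_less_mono2[of "1 / real (d + 1)" x 1] by (auto simp: y_def)
  have "y ^ (d + 1) = y powr real (d + 1)" using y(1) by (rule powr_realpow[symmetric])
  also have "\<dots> = x powr (1 / real (d + 1) * real (d + 1))" by (simp only: y_def powr_powr)
  also have "1 / real (d + 1) * real (d + 1) = 1" by (subst nonzero_eq_divide_eq[symmetric]) auto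
  finally have "y ^ (d + 1) = x" using assms by simp
  then have xn: "x ^ n = (y ^ n) ^ d * y ^ n" for n
    by (metis mult.commute power_mult power_add power_one_right)
  have "(\<lambda>n. real n * y ^ n + y ^ n) \<longlonglongrightarrow> 0 + 0"
    using y by (intro tendsto_add powser_times_n_limit_0 LIMSEQ_power_zero) auto
  then have 1: "(\<lambda>n. real (n + 1) * y ^ n) \<longlonglongrightarrow> 0" by (simp add: algebra_simps)
  have "(\<lambda>n. K * ((real (n + 1) * y ^ n) ^ d * y ^ n)) \<longlonglongrightarrow> K * (0 ^ d * 0)"
    using y by (intro tendsto_intros 1 LIMSEQ_power_zero) auto
  then show ?thesis by (simp add: xn power_mult_distrib mult.assoc)
qed

lemma antichain_append: "T \<subseteq> level J n \<Longrightarrow> antichain ((\<lambda>h. h @ v) ` T)"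
proof -
  assume T: "T \<subseteq> level J n"
  have "h @ v = h' @ v" if "h \<in> T" "h' \<in> T" "prefix (h @ v) (h' @ v)" for h h'
  proof -
    have "length (h @ v) = length (h' @ v)" using T that by (auto simp: level_def)
    then show ?thesis using that(3) by (metis append_Nil2 append_eq_append_conv prefix_def)
  qed
  then show ?thesis by (auto simp: antichain_def)
qed

context self_similar_measure
begin

text \<open>Words of one letter count all have the same ratio and the same mass. Choosing the letter
  count with \<open>type_class_exists\<close> for the weights \<open>p\<^sup>q r\<^sup>T\<close> makes the local exponent of these
  words nearly \<open>\<beta>\<close> and their number nearly the inverse of their weight, which is the ratio to the
  power \<open>\<beta> q + T\<close>. A fixed suffix \<open>v\<close> costs only a constant.\<close>
lemma homogeneous_blocks:
  assumes I: "I \<subseteq> J" and PT: "(\<Sum>i\<in>I. p i powr q * r i powr T) = 1"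
    and mean: "(\<Sum>i\<in>I. p i powr q * r i powr T * (ln (p i) - \<beta> * ln (r i))) = 0"
    and q: "0 \<le> q" and t: "t < \<beta> * q + T" and \<alpha>: "\<beta> < \<alpha>" and v: "v \<in> lists J"
  shows "\<exists>\<Gamma> \<kappa> \<pi>. finite \<Gamma> \<and> \<Gamma> \<noteq> {} \<and> \<Gamma> \<subseteq> lists J \<and> antichain \<Gamma> \<and> [] \<notin> \<Gamma> \<and>
      (\<forall>g\<in>\<Gamma>. (\<exists>h\<in>lists I. g = h @ v) \<and> wt r g = \<kappa> \<and> wt p g = \<pi>) \<and>
      1 / card \<Gamma> \<le> \<kappa> powr t \<and> \<kappa> powr \<alpha> < \<pi>"
proof -
  define F where "F = \<beta> * q + T"
  define L where "L = - ln rmax"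
  have L: "0 < L" using rmin_rmax(1-3) by (simp add: L_def)
  \<comment> \<open>The first bound keeps the exponent below \<open>\<alpha>\<close>; the second limits the loss of dimension, since
    a deviation by \<open>\<epsilon> n\<close> is multiplied by \<open>q\<close> and \<open>n * L\<close> is at most the logarithmic size.\<close>
  define \<epsilon> where "\<epsilon> = min ((\<alpha> - \<beta>) * L / 2) ((F - t) * L / (2 * (q + 1)))"
  have \<epsilon>: "0 < \<epsilon>" using L \<alpha> t q by (simp add: \<epsilon>_def F_def)
  define c where "c i = ln (p i) - \<beta> * ln (r i)" for i
  define P where "P i = p i powr q * r i powr T" for i
  have Ifin: "finite I" using I J_fin finite_subset by blast
  have P_pos: "0 < P i" if "i \<in> I" for i using that I p_pos[of i] r01[of i] by (auto simp: P_def)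
  obtain n0 where n0: "\<And>n. n0 \<le> n \<Longrightarrow> \<exists>S\<subseteq>level I n. S \<noteq> {} \<and> (\<forall>u\<in>S. \<forall>w\<in>S. mset u = mset w) \<and>
     (\<forall>w\<in>S. \<bar>sum_list (map c w)\<bar> \<le> \<epsilon> * n \<and> 1 \<le> 2 * real ((n + 1) ^ card I) * card S * wt P w)"
    using type_class_exists[OF Ifin, of P c \<epsilon>] P_pos PT mean \<epsilon> by (auto simp: P_def c_def)
  define rv where "rv = wt r v"
  define pv where "pv = wt p v"
  have rv: "0 < rv" "0 < pv" using wt_r_pos wt_p_pos v by (auto simp: rv_def pv_def)
  define e where "e = (F - t) / 2"
  have e: "0 < e" using t by (simp add: e_def F_def)
  have x: "0 < rmax powr e" "rmax powr e < 1"
    using rmin_rmax(1-3) e powr_less_mono2[of e rmax 1] by auto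
  have "\<forall>\<^sub>F n in sequentially. 2 * rv powr - t * real ((n + 1) ^ card I) * (rmax powr e) ^ n < 1"
    using poly_times_geometric[OF x, of "2 * rv powr - t" "card I"] by (rule order_tendstoD) simp
  moreover have "\<forall>\<^sub>F n::nat in sequentially. (\<alpha> * ln rv - ln pv) < (\<alpha> - \<beta>) * L / 2 * n"
  proof -
    have "0 < (\<alpha> - \<beta>) * L / 2" using \<alpha> L by simp
    then have "filterlim (\<lambda>n. (\<alpha> - \<beta>) * L / 2 * real n) at_top sequentially"
      by (intro filterlim_tendsto_pos_mult_at_top[OF tendsto_const] filterlim_real_sequentially)
    then show ?thesis unfolding filterlim_at_top_dense by blast
  qed
  moreover have "\<forall>\<^sub>F n in sequentially. max n0 1 \<le> n" by (rule eventually_ge_at_top)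
  ultimately have "\<forall>\<^sub>F n in sequentially. 2 * rv powr - t * real ((n + 1) ^ card I) * (rmax powr e) ^ n < 1 \<and>
      (\<alpha> * ln rv - ln pv) < (\<alpha> - \<beta>) * L / 2 * real n \<and> max n0 1 \<le> n"
    by (intro eventually_conj)
  then obtain n where n1: "2 * rv powr - t * real ((n + 1) ^ card I) * (rmax powr e) ^ n < 1"
    and n2: "(\<alpha> * ln rv - ln pv) < (\<alpha> - \<beta>) * L / 2 * real n" and n3: "max n0 1 \<le> n"
    by (auto dest!: eventually_happens'[OF sequentially_bot])
  obtain S where S: "S \<subseteq> level I n" "S \<noteq> {}" "\<And>u w. u \<in> S \<Longrightarrow> w \<in> S \<Longrightarrow> mset u = mset w"
    "\<And>w. w \<in> S \<Longrightarrow> \<bar>sum_list (map c w)\<bar> \<le> \<epsilon> * n"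
    "\<And>w. w \<in> S \<Longrightarrow> 1 \<le> 2 * real ((n + 1) ^ card I) * card S * wt P w"
  proof -
    have "n0 \<le> n" using n3 by simp
    from n0[OF this] obtain S where S0: "S \<subseteq> level I n" "S \<noteq> {}" "\<forall>u\<in>S. \<forall>w\<in>S. mset u = mset w"
      "\<forall>w\<in>S. \<bar>sum_list (map c w)\<bar> \<le> \<epsilon> * n \<and> 1 \<le> 2 * real ((n + 1) ^ card I) * card S * wt P w"
      by blast
    show ?thesis by (rule that[OF S0(1,2)]) (use S0(3,4) in blast)+
  qed
  obtain w where w: "w \<in> S" using S by blast
  have Sl: "h \<in> lists I" "h \<in> lists J" "length h = n" if "h \<in> S" for h
  proof -
    have "h \<in> level I n" using that S(1) by blast
    then show "h \<in> lists I" "length h = n" by (simp_all add: level_def)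
    then show "h \<in> lists J" using lists_mono[OF I] by blast
  qed
  note wl = Sl[OF w]
  define k where "k = wt r w"
  have k: "0 < k" "k \<le> rmax ^ n" using wt_r_pos[OF wl(2)] wt_r_power[OF wl(2)] wl(3) by (auto simp: k_def)
  define l where "l = - ln k"
  have l: "n * L \<le> l"
  proof -
    have "ln k \<le> ln (rmax ^ n)" using k rmin_rmax(1-3) by (subst ln_le_cancel_iff) auto
    also have "\<dots> = n * ln rmax" using rmin_rmax(1-3) by (simp add: ln_realpow)
    finally show ?thesis by (simp add: l_def L_def)
  qed
  have ln_p: "ln (wt p u) = \<beta> * ln (wt r u) + sum_list (map c u)" if "u \<in> lists J" for u
    using that
  proof (induction u)
    case (Cons i u)
    then have "0 < p i" "0 < r i" "0 < wt p u" "0 < wt r u" using p_pos r01 wt_p_pos wt_r_pos by auto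
    then show ?case using Cons.IH by (simp add: ln_mult c_def algebra_simps)
  qed simp
  define s where "s = sum_list (map c w)"
  have s: "\<bar>s\<bar> \<le> \<epsilon> * n" using S(4)[OF w] by (simp add: s_def)
  have lnp: "ln (wt p w) = - \<beta> * l + s" using ln_p[OF wl(2)] by (simp add: l_def k_def s_def)
  have \<epsilon>n: "\<epsilon> * n \<le> (\<alpha> - \<beta>) * L / 2 * n" "q * (\<epsilon> * n) \<le> e * l"
  proof -
    show "\<epsilon> * n \<le> (\<alpha> - \<beta>) * L / 2 * n" unfolding \<epsilon>_def by (rule mult_right_mono[OF min.cobounded1]) simp
    have "q * \<epsilon> \<le> q * ((F - t) * L / (2 * (q + 1)))" unfolding \<epsilon>_def using q by (intro mult_left_mono min.cobounded2)
    also have "\<dots> = (e * L) * (q / (q + 1))" using q by (simp add: e_def field_simps)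
    also have "\<dots> \<le> (e * L) * 1" using q e L by (intro mult_left_mono) auto
    finally have "q * \<epsilon> * n \<le> e * L * n" by (intro mult_right_mono) auto
    also have "\<dots> \<le> e * l" using l e by (simp add: mult.commute mult.left_commute)
    finally show "q * (\<epsilon> * n) \<le> e * l" by (simp add: mult.assoc)
  qed
  define \<Gamma> where "\<Gamma> = (\<lambda>h. h @ v) ` S"
  have Sfin: "finite S" using finite_subset[OF S(1)] cut_finite[OF cut_level Ifin] by blast
  have card: "card \<Gamma> = card S" unfolding \<Gamma>_def by (intro card_image inj_onI) simp
  have cS: "0 < real (card S)" using Sfin S(2) by (simp add: card_gt_0_iff)
  have wtP: "wt P w = exp (- F * l + q * s)"
  proof -
    have "wt P w = wt p w powr q * wt r w powr T"
      using wl(2) p_pos r01 unfolding P_def by (simp add: wt_mult wt_powr)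
    also have "\<dots> = exp (q * ln (wt p w) + T * ln (wt r w))"
      using wt_p_pos[OF wl(2)] wt_r_pos[OF wl(2)] by (simp add: powr_def exp_add)
    also have "q * ln (wt p w) + T * ln (wt r w) = - F * l + q * s"
      by (simp add: lnp) (simp add: F_def l_def k_def algebra_simps)
    finally show ?thesis .
  qed
  have "1 / card S \<le> 2 * real ((n + 1) ^ card I) * wt P w"
    using S(5)[OF w] cS by (simp add: divide_le_eq algebra_simps)
  also have "\<dots> \<le> 2 * real ((n + 1) ^ card I) * exp (- t * l - e * l)"
  proof (intro mult_left_mono)
    have "q * s \<le> q * (\<epsilon> * n)" using s q by (intro mult_left_mono) auto
    then have "- F * l + q * s \<le> - F * l + e * l" using \<epsilon>n(2) by linarith
    also have "\<dots> = - t * l - e * l" by (simp add: e_def field_simps)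
    finally show "wt P w \<le> exp (- t * l - e * l)" by (simp add: wtP)
  qed auto
  also have "\<dots> = (k * rv) powr t * (2 * rv powr - t * real ((n + 1) ^ card I) * exp (- e * l))"
    using k rv by (simp add: powr_def l_def ln_mult algebra_simps flip: exp_add)
  also have "\<dots> \<le> (k * rv) powr t * 1"
  proof (intro mult_left_mono)
    have "exp (- e * l) \<le> exp (- e * (n * L))" using l e by simp
    also have "\<dots> = (rmax powr e) ^ n"
      using rmin_rmax(1-3) by (simp add: L_def powr_def mult.commute mult.left_commute flip: exp_of_nat_mult)
    finally have "2 * rv powr - t * real ((n + 1) ^ card I) * exp (- e * l)
        \<le> 2 * rv powr - t * real ((n + 1) ^ card I) * (rmax powr e) ^ n"
      by (intro mult_left_mono) auto
    then show "2 * rv powr - t * real ((n + 1) ^ card I) * exp (- e * l) \<le> 1" using n1 by linarith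
  qed auto
  finally have dim: "1 / card \<Gamma> \<le> (k * rv) powr t" by (simp add: card)
  have "(k * rv) powr \<alpha> < wt p w * pv"
  proof -
    have "a * n - a / 2 * n = a / 2 * n" for a :: real by (simp add: field_simps)
    from this[of "(\<alpha> - \<beta>) * L"]
    have "(\<alpha> - \<beta>) * L * n - (\<alpha> - \<beta>) * L / 2 * n = (\<alpha> - \<beta>) * L / 2 * n" .
    then have "\<alpha> * ln rv - ln pv < (\<alpha> - \<beta>) * L * n - (\<alpha> - \<beta>) * L / 2 * n" using n2 by linarith
    also have "\<dots> \<le> (\<alpha> - \<beta>) * l - \<epsilon> * n"
    proof -
      have "(\<alpha> - \<beta>) * (n * L) \<le> (\<alpha> - \<beta>) * l" using l \<alpha> by (intro mult_left_mono) auto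
      moreover have "(\<alpha> - \<beta>) * (n * L) = (\<alpha> - \<beta>) * L * n" by simp
      ultimately show ?thesis using \<epsilon>n(1) by linarith
    qed
    finally have "\<alpha> * ln (k * rv) < ln (wt p w * pv)"
      using s lnp k rv wt_p_pos[OF wl(2)] by (simp add: ln_mult l_def algebra_simps abs_le_iff)
    then have "exp (\<alpha> * ln (k * rv)) < exp (ln (wt p w * pv))" by simp
    then show ?thesis using k rv wt_p_pos[OF wl(2)] by (simp add: powr_def)
  qed
  moreover have "\<forall>g\<in>\<Gamma>. (\<exists>h\<in>lists I. g = h @ v) \<and> wt r g = k * rv \<and> wt p g = wt p w * pv"
  proof
    fix g assume "g \<in> \<Gamma>"
    then obtain h where h: "h \<in> S" "g = h @ v" by (auto simp: \<Gamma>_def)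
    then have "mset h = mset w" using S(3) w by blast
    then have "wt r h = k" "wt p h = wt p w" unfolding k_def by (auto intro: wt_mset)
    then show "(\<exists>h\<in>lists I. g = h @ v) \<and> wt r g = k * rv \<and> wt p g = wt p w * pv"
      using h Sl(1)[OF h(1)] by (auto simp: rv_def pv_def)
  qed
  moreover have "antichain \<Gamma>" unfolding \<Gamma>_def using S(1) by (rule antichain_append)
  moreover have "[] \<notin> \<Gamma>" using Sl(3) n3 by (force simp: \<Gamma>_def)
  moreover have "\<Gamma> \<subseteq> lists J" unfolding \<Gamma>_def using Sl(2) v by (simp add: image_subset_iff)
  moreover have "finite \<Gamma>" "\<Gamma> \<noteq> {}" using Sfin S(2) by (auto simp: \<Gamma>_def)
  ultimately show ?thesis using dim
    by (intro exI[of _ \<Gamma>] exI[of _ "k * rv"] exI[of _ "wt p w * pv"]) blast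
qed

end

section \<open>Sequences of blocks with prescribed insertions\<close>

context osc_ifs
begin

text \<open>Prescribed words at the places outside \<open>F\<close> carry no choice. If their total size on a
  logarithmic scale is small compared with the number of free places, they cost no more than the gap
  between \<open>t\<close> and \<open>t'\<close>.\<close>
lemma dim_mixed_blocks_ge:
  fixes F :: "nat \<Rightarrow> bool"
  assumes \<Gamma>: "finite \<Gamma>" "\<Gamma> \<noteq> {}" "\<Gamma> \<subseteq> lists J" "antichain \<Gamma>" "[] \<notin> \<Gamma>" "\<And>g. g \<in> \<Gamma> \<Longrightarrow> wt r g = \<kappa>"
    and z: "\<And>j. z j \<in> lists J" "\<And>j. z j \<noteq> []"
    and t: "0 < t" and card: "1 / card \<Gamma> \<le> \<kappa> powr t'"
    and sparse: "\<And>n. t * (\<Sum>j\<in>{j. j \<le> n \<and> \<not> F j}. - ln (wt r (z j)))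
                     \<le> (t' - t) * (- ln \<kappa>) * card {j. j < n \<and> F j} + D"
    and sub: "coded (\<lambda>j. if F j then \<Gamma> else {z j}) \<subseteq> A"
  shows "ereal t \<le> hausdorff_dim A"
proof -
  define \<Delta> where "\<Delta> j = (if F j then \<Gamma> else {z j})" for j
  define k where "k j = (if F j then \<kappa> else wt r (z j))" for j
  obtain g where g: "g \<in> \<Gamma>" using \<Gamma> by blast
  have \<kappa>: "0 < \<kappa>" "\<kappa> < 1" using \<Gamma> g wt_r_pos[of g] wt_r_lt1[of g] by force+
  have k: "0 < k j" for j using \<kappa> z wt_r_pos by (simp add: k_def)
  have k0: "k j \<noteq> 0" for j using k[of j] by simp
  define C where "C = exp D * \<kappa> powr - t"
  show ?thesis
  proof (rule dim_coded_ge[of \<Delta> k t C])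
    fix n
    define a where "a = card {j. j < n \<and> F j}"
    define b where "b = card {j. j \<le> n \<and> F j}"
    define s where "s = (\<Sum>j\<in>{j. j \<le> n \<and> \<not> F j}. - ln (wt r (z j)))"
    have "b \<le> a + 1"
    proof -
      have "{j. j \<le> n \<and> F j} \<subseteq> insert n {j. j < n \<and> F j}" by auto
      then have "b \<le> card (insert n {j. j < n \<and> F j})" unfolding b_def by (intro card_mono) auto
      then show ?thesis by (simp add: a_def card_insert_if split: if_splits)
    qed
    have "(\<Prod>j<n. 1 / card (\<Delta> j)) = (\<Prod>j<n. if F j then 1 / card \<Gamma> else 1)"
      by (intro prod.cong) (auto simp: \<Delta>_def)
    also have "\<dots> = (\<Prod>j\<in>{j\<in>{..<n}. F j}. 1 / card \<Gamma>)" by (rule prod.inter_filter[symmetric]) simp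
    also have "\<dots> = (1 / card \<Gamma>) ^ a" by (simp add: a_def)
    also have "\<dots> \<le> (\<kappa> powr t') ^ a" using card by (intro power_mono) auto
    also have "\<dots> = exp (a * t' * ln \<kappa>)" using \<kappa> by (simp add: powr_def mult.assoc flip: exp_of_nat_mult)
    also have "\<dots> \<le> exp (D + - t * ln \<kappa> + t * (b * ln \<kappa> - s))"
    proof -
      have "t * s \<le> (t' - t) * (- ln \<kappa>) * a + D" using sparse[of n] by (simp add: s_def a_def)
      moreover have "0 \<le> t * (- ln \<kappa>)" using t \<kappa> by (intro mult_nonneg_nonneg) auto
      then have "t * (- ln \<kappa>) * b \<le> t * (- ln \<kappa>) * (a + 1)"
        using \<open>b \<le> a + 1\<close> by (intro mult_left_mono) (auto simp flip: of_nat_Suc)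
      ultimately show ?thesis by (simp add: algebra_simps)
    qed
    also have "\<dots> = C * exp (t * (b * ln \<kappa> - s))"
      using \<kappa> by (simp add: C_def powr_def flip: exp_add)
    also have "exp (t * (b * ln \<kappa> - s)) = (\<Prod>j<Suc n. k j) powr t"
    proof -
      have "ln (\<Prod>j<Suc n. k j) = (\<Sum>j<Suc n. ln (k j))" by (intro ln_prod) (use k0 in auto)
      also have "\<dots> = (\<Sum>j\<in>{j\<in>{..<Suc n}. F j}. ln (k j)) + (\<Sum>j\<in>{j\<in>{..<Suc n}. \<not> F j}. ln (k j))"
      proof -
        let ?A = "{j\<in>{..<Suc n}. F j}" and ?B = "{j\<in>{..<Suc n}. \<not> F j}"
        have "(\<Sum>j\<in>?A \<union> ?B. ln (k j)) = (\<Sum>j\<in>?A. ln (k j)) + (\<Sum>j\<in>?B. ln (k j))"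
          by (rule sum.union_disjoint) auto
        moreover have "?A \<union> ?B = {..<Suc n}" by auto
        ultimately show ?thesis by (simp only:)
      qed
      also have "(\<Sum>j\<in>{j\<in>{..<Suc n}. F j}. ln (k j)) = b * ln \<kappa>"
        by (simp add: k_def b_def less_Suc_eq_le)
      also have "(\<Sum>j\<in>{j\<in>{..<Suc n}. \<not> F j}. ln (k j)) = - s"
        unfolding s_def by (simp add: k_def less_Suc_eq_le sum_negf)
      finally have "ln (\<Prod>j<Suc n. k j) = b * ln \<kappa> - s" by simp
      moreover have "0 < (\<Prod>j<Suc n. k j)" using k by (intro prod_pos) auto
      ultimately show ?thesis by (simp add: powr_def k0)
    qed
    finally show "(\<Prod>j<n. 1 / card (\<Delta> j)) \<le> C * (\<Prod>j<Suc n. k j) powr t" .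
  next
    show "antichain (\<Delta> j)" for j using \<Gamma> by (simp add: \<Delta>_def) (simp add: antichain_def)
    show "coded \<Delta> \<subseteq> A" using sub unfolding \<Delta>_def .
    show "[] \<notin> \<Delta> j" for j using \<Gamma>(5) z(2)[of j] by (metis \<Delta>_def singletonD)
  qed (use \<Gamma> z t \<kappa> in \<open>auto simp: \<Delta>_def k_def C_def split: if_splits\<close>)
qed

end

subsection \<open>Points of minimal exponent\<close>

context self_similar_measure
begin

text \<open>Over the letters of minimal exponent the mass of every cylinder is its size to the power
  \<open>amin\<close>, the largest mass that a cylinder of this size can have; so no neighbour is heavier.\<close>
lemma dim_at_minimal:
  assumes w: "\<And>n. w n \<in> lists J" "\<And>n. x \<in> cyl (w n)" "\<And>n. wt p (w n) = wt r (w n) powr amin"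
    and c: "0 < c" "c \<le> 1" "\<And>\<rho>. 0 < \<rho> \<Longrightarrow> \<rho> \<le> 1 \<Longrightarrow> \<exists>n. c * \<rho> \<le> wt r (w n) \<and> wt r (w n) \<le> \<rho>"
  shows "assouad_dim_at \<mu> x = ereal amin"
proof (rule antisym)
  have x: "x \<in> X" using w(1,2) cyl_subset_X by blast
  define C where "C = neighbour_bound * c powr - amin"
  have C: "1 \<le> C"
  proof -
    have "1 \<le> c powr - amin" using c amin_pos by (simp add: powr_minus_divide powr_le1)
    moreover have "1 \<le> real neighbour_bound" using neighbour_bound_pos by simp
    ultimately have "1 * 1 \<le> C" unfolding C_def by (intro mult_mono) auto
    then show ?thesis by simp
  qed
  have "assouad_bound \<mu> x C amin"
  proof (rule assouad_boundI[OF x C])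
    fix \<rho> R :: real assume \<rho>: "0 < \<rho>" "\<rho> < R" "R \<le> 1"
    obtain u where u: "u \<in> stopping J r R" "measure \<mu> (cball x R) \<le> neighbour_bound * wt p u"
      using ball_heaviest[OF x, of R R] \<rho> by auto
    have ul: "u \<in> lists J" "wt r u \<le> R" using stopping_words[OF u(1)] stopping_le[OF u(1)] by auto
    obtain n where n: "c * \<rho> \<le> wt r (w n)" "wt r (w n) \<le> \<rho>" using c(3)[of \<rho>] \<rho> by auto
    have "wt p u \<le> wt r u powr amin" using wt_p_bounds ul by blast
    also have "\<dots> \<le> R powr amin" using ul amin_pos wt_r_pos[OF ul(1)] by (intro powr_mono2) auto
    finally have "measure \<mu> (cball x R) \<le> neighbour_bound * R powr amin"
      using u(2) by (meson mult_left_mono of_nat_0_le_iff order_trans)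
    also have "\<dots> = C * (R / \<rho>) powr amin * (c * \<rho>) powr amin"
      using \<rho> c by (simp add: C_def powr_divide powr_mult powr_minus field_simps)
    also have "\<dots> \<le> C * (R / \<rho>) powr amin * wt p (w n)"
      unfolding w(3) using n c \<rho> C amin_pos by (intro mult_left_mono powr_mono2) auto
    also have "\<dots> \<le> C * (R / \<rho>) powr amin * measure \<mu> (cball x \<rho>)"
      using ball_mass_ge[OF w(1,2) n(2)] C by (intro mult_left_mono) auto
    finally show "measure \<mu> (cball x R) \<le> C * (R / \<rho>) powr amin * measure \<mu> (cball x \<rho>)" .
  qed (use amin_pos in simp)
  then show "assouad_dim_at \<mu> x \<le> ereal amin"
    unfolding assouad_dim_at_def using amin_pos C
    by (intro Inf_lower CollectI exI[of _ amin]) (auto intro!: exI[of _ C])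
  show "ereal amin \<le> assouad_dim_at \<mu> x" by (rule assouad_dim_at_ge[OF x])
qed

lemma antimono_scale:
  fixes f :: "nat \<Rightarrow> real"
  assumes "f 0 = 1" "0 < c" "\<And>n. c * f n \<le> f (Suc n)" "f \<longlonglongrightarrow> 0" "0 < \<rho>" "\<rho> \<le> 1"
  shows "\<exists>n. \<rho> \<le> f n \<and> f (Suc n) < \<rho> \<and> c * \<rho> \<le> f (Suc n)"
proof -
  obtain n where "f n < \<rho>"
    using order_tendstoD(2)[OF assms(4,5)] eventually_happens'[OF sequentially_bot] by blast
  moreover have "\<not> f 0 < \<rho>" using assms by simp
  ultimately obtain k where k: "\<not> f k < \<rho>" "f (Suc k) < \<rho>"
    using exists_least_lemma[of "\<lambda>n. f n < \<rho>"] by blast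
  then have "c * \<rho> \<le> c * f k" using assms(2) by (intro mult_left_mono) auto
  then show ?thesis using k assms(3)[of k] by (intro exI[of _ k]) auto
qed

lemma spell_size_tendsto:
  assumes "\<And>j. \<omega> j \<in> lists J" "\<And>j. \<omega> j \<noteq> []"
  shows "wt r (spell \<omega> n) \<le> rmax ^ n" "(\<lambda>n. wt r (spell \<omega> n)) \<longlonglongrightarrow> 0"
proof -
  have le: "wt r (spell \<omega> n) \<le> rmax ^ n" for n
  proof (induction n)
    case (Suc n)
    have "rmax ^ length (\<omega> n) \<le> rmax ^ 1"
      using assms(2)[of n] rmin_rmax(1-3) by (intro power_decreasing) (auto simp: Suc_le_eq)
    then have "wt r (\<omega> n) \<le> rmax" using wt_r_power[OF assms(1)[of n]] by simp
    then have "wt r (spell \<omega> n) * wt r (\<omega> n) \<le> rmax ^ n * rmax"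
      using Suc wt_r_pos[OF assms(1)[of n]] rmin_rmax(1,2) by (intro mult_mono) auto
    then show ?case by (simp add: mult.commute)
  qed simp
  then show "wt r (spell \<omega> n) \<le> rmax ^ n" .
  have "(\<lambda>n. rmax ^ n) \<longlonglongrightarrow> 0" using rmin_rmax(1-3) by (intro LIMSEQ_power_zero) auto
  moreover have "\<forall>\<^sub>F n in sequentially. norm (wt r (spell \<omega> n)) \<le> rmax ^ n"
  proof (intro always_eventually allI)
    show "norm (wt r (spell \<omega> n)) \<le> rmax ^ n" for n
      using wt_r_pos[OF spell_lists[of \<omega> J n]] assms(1) le[of n] by simp
  qed
  ultimately show "(\<lambda>n. wt r (spell \<omega> n)) \<longlonglongrightarrow> 0"
    by (rule Lim_null_comparison[rotated])
qed

lemma dim_level_amin_ge: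
  assumes T: "(\<Sum>i\<in>{i\<in>J. ln (p i) / ln (r i) = amin}. r i powr T) = 1" and t: "0 < t" "t < T"
  shows "ereal t \<le> hausdorff_dim (assouad_level_set \<mu> (ereal amin))"
proof -
  define I where "I = {i\<in>J. ln (p i) / ln (r i) = amin}"
  have IJ: "I \<subseteq> J" by (auto simp: I_def)
  have ln_I: "ln (p i) = amin * ln (r i)" "p i \<noteq> 0" if "i \<in> I" for i
    using that r01[of i] p_pos[of i] by (auto simp: I_def divide_eq_eq)
  have 1: "(\<Sum>i\<in>I. p i powr 0 * r i powr T) = 1"
    using T by (simp add: I_def[symmetric] ln_I(2) cong: sum.cong)
  have 2: "(\<Sum>i\<in>I. p i powr 0 * r i powr T * (ln (p i) - amin * ln (r i))) = 0"
    by (simp add: ln_I(1) cong: sum.cong)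
  obtain \<Gamma> \<kappa> \<pi> where G: "finite \<Gamma>" "\<Gamma> \<noteq> {}" "\<Gamma> \<subseteq> lists J" "antichain \<Gamma>" "[] \<notin> \<Gamma>"
      "\<forall>g\<in>\<Gamma>. (\<exists>h\<in>lists I. g = h @ []) \<and> wt r g = \<kappa> \<and> wt p g = \<pi>" "1 / card \<Gamma> \<le> \<kappa> powr t"
  proof -
    have "t < amin * 0 + T" "amin < amin + 1" "[] \<in> lists J" using t by simp_all
    from homogeneous_blocks[OF IJ 1 2 order_refl this] show ?thesis using that by blast
  qed
  obtain g where g: "g \<in> \<Gamma>" using G by blast
  have \<kappa>: "0 < \<kappa>" "\<kappa> \<le> 1" using G(3,6) g wt_r_pos[of g] wt_r_le1[of g] by auto
  have gI: "h \<in> lists I" if "h \<in> \<Gamma>" for h using G(6)[rule_format, OF that] by simp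
  have wt_eq: "wt p u = wt r u powr amin" if "u \<in> lists I" for u
    using that
  proof (induction u)
    case (Cons i u)
    then have "i \<in> J" "u \<in> lists J" using IJ by auto
    then have "0 < r i" "0 < wt r u" "p i = r i powr amin"
      using r01 wt_r_pos p_eq_powr[of i] Cons by (auto simp: I_def)
    then show ?case using Cons by (simp add: powr_mult)
  qed simp
  have "coded (\<lambda>_. \<Gamma>) \<subseteq> assouad_level_set \<mu> (ereal amin)"
  proof
    fix x assume "x \<in> coded (\<lambda>_. \<Gamma>)"
    then obtain \<omega> where \<omega>: "\<And>j. \<omega> j \<in> \<Gamma>" "\<And>n. x \<in> cyl (spell \<omega> n)" by (auto simp: coded_def)
    have \<omega>l: "\<omega> j \<in> lists J" "\<omega> j \<noteq> []" "\<omega> j \<in> lists I" for j using \<omega>(1)[of j] G(3,5) gI by auto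
    have "assouad_dim_at \<mu> x = ereal amin"
    proof (rule dim_at_minimal)
      show "spell \<omega> n \<in> lists J" "wt p (spell \<omega> n) = wt r (spell \<omega> n) powr amin" for n
        by (rule spell_lists[OF \<omega>l(1)], rule wt_eq[OF spell_lists[OF \<omega>l(3)]])
      fix \<rho> :: real assume \<rho>: "0 < \<rho>" "\<rho> \<le> 1"
      have "\<exists>n. \<rho> \<le> wt r (spell \<omega> n) \<and> wt r (spell \<omega> (Suc n)) < \<rho> \<and> \<kappa> * \<rho> \<le> wt r (spell \<omega> (Suc n))"
        using \<kappa>(1) \<rho> G(6)[rule_format, OF \<omega>(1)] spell_size_tendsto(2)[OF \<omega>l(1,2)]
        by (intro antimono_scale) auto
      then show "\<exists>n. \<kappa> * \<rho> \<le> wt r (spell \<omega> n) \<and> wt r (spell \<omega> n) \<le> \<rho>" by (meson less_imp_le)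
    qed (use \<omega> \<kappa> in auto)
    moreover have "x \<in> X" using \<omega>(2)[of 0] by simp
    ultimately show "x \<in> assouad_level_set \<mu> (ereal amin)" by (simp add: assouad_level_set_def spt_eq)
  qed
  then show ?thesis
    using dim_mixed_blocks_ge[of \<Gamma> \<kappa> "\<lambda>_. g" t t "\<lambda>_. True" 0] G g t by auto
qed

subsection \<open>Points of exponent strictly between the extremes\<close>

text \<open>The code of the point has a word ending in the isolating word at every scale, where the mass
  of the ball is that of the cylinder. Up to a bounded error the function \<open>S\<close> compares the mass of
  these cylinders with their size to the power \<open>\<alpha>\<close>: it never drops by more than \<open>D\<close>, which bounds
  the dimension from above, and it has arbitrarily long stretches of increase at most \<open>D\<close>, which
  bound the dimension from below.\<close>
lemma dim_at_eq_of_code: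
  assumes \<omega>: "\<And>j. \<exists>h\<in>lists J. \<omega> j = h @ isolator" and x: "\<And>n. x \<in> cyl (spell \<omega> n)"
    and c: "0 < c" "\<And>j. c \<le> wt r (\<omega> j)" and \<alpha>: "0 < \<alpha>"
    and S: "\<And>n. ln (wt p (spell \<omega> n)) - \<alpha> * ln (wt r (spell \<omega> n)) = S n"
    and drop: "\<And>n n'. n \<le> n' \<Longrightarrow> S n \<le> S n' + D"
    and flat: "\<And>i. \<exists>n. S (n + i) \<le> S n + D"
  shows "assouad_dim_at \<mu> x = ereal \<alpha>"
proof -
  have xX: "x \<in> X" using x[of 0] by simp
  have \<omega>l: "\<omega> j \<in> lists J" "\<omega> j \<noteq> []" for j using \<omega>[of j] isolator_word by auto
  define f where "f n = wt r (spell \<omega> n)" for n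
  define g where "g n = wt p (spell \<omega> n)" for n
  have sl: "spell \<omega> n \<in> lists J" for n using \<omega>l by (intro spell_lists)
  have pos: "0 < f n" "0 < g n" for n using sl wt_r_pos wt_p_pos by (auto simp: f_def g_def)
  have f_le: "f n \<le> rmax ^ n" and f_lim: "f \<longlonglongrightarrow> 0" for n
    using spell_size_tendsto[of \<omega>, OF \<omega>l] unfolding f_def by auto
  have f_step: "c * f n \<le> f (Suc n)" for n
    using c(2)[of n] pos(1)[of n] by (simp add: f_def mult.commute)
  have f_dec: "f n' \<le> f n" if "n \<le> n'" for n n'
    unfolding f_def using sl spell_prefix[OF that] by (intro wt_r_prefix)
  have gS: "g n / g n' = exp (S n - S n') * (f n / f n') powr \<alpha>" for n n'
  proof -
    have "g n = exp (S n + \<alpha> * ln (f n))" for n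
    proof -
      have "S n + \<alpha> * ln (f n) = ln (g n)" using S[of n] by (simp add: f_def g_def)
      then show ?thesis using pos(2)[of n] by simp
    qed
    moreover have "(f n / f n') powr \<alpha> = exp (\<alpha> * ln (f n) - \<alpha> * ln (f n'))"
      using pos[of n] pos[of n'] by (simp add: powr_def ln_div algebra_simps)
    ultimately show ?thesis by (simp add: algebra_simps flip: exp_add exp_diff)
  qed
  define pv where "pv = wt p isolator"
  have pv: "0 < pv" "pv \<le> 1"
  proof -
    show "0 < pv" using wt_p_pos isolator_word by (simp add: pv_def)
    have "wt p isolator \<le> wt r isolator powr amin" using wt_p_bounds isolator_word by blast
    also have "\<dots> \<le> 1" using wt_r_le1[OF isolator_word(1)] wt_r_pos[OF isolator_word(1)] amin_pos by (intro powr_le1) auto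
    finally show "pv \<le> 1" by (simp add: pv_def)
  qed
  have upper: "measure \<mu> (cball x \<rho>) \<le> g n / pv" if \<rho>: "\<rho> \<le> f n" for n \<rho>
  proof (cases n)
    case 0
    have "measure \<mu> (cball x \<rho>) \<le> 1" using prob by (rule prob_space.prob_le_1)
    also have "\<dots> \<le> 1 / pv" using pv by simp
    finally show ?thesis using 0 by (simp add: g_def)
  next
    case (Suc k)
    obtain h where h: "h \<in> lists J" "\<omega> k = h @ isolator" using \<omega> by blast
    have "measure \<mu> (cball x \<rho>) \<le> wt p (spell \<omega> k @ h)"
      using h sl[of k] x[of n] \<rho> Suc by (intro isolated_ball_mass) (auto simp: f_def)
    also have "\<dots> = g n / pv" using pv Suc h by (simp add: g_def pv_def)
    finally show ?thesis .
  qed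
  have lower: "g n \<le> measure \<mu> (cball x \<rho>)" if "f n \<le> \<rho>" for n \<rho>
    using ball_mass_ge[OF sl x] that by (simp add: f_def g_def)
  have c1: "c \<le> 1" using c(2)[of 0] wt_r_le1[OF \<omega>l(1)[of 0]] by simp
  have scale: "\<exists>n. \<rho> \<le> f n \<and> f (Suc n) < \<rho> \<and> c * \<rho> \<le> f (Suc n)" if "0 < \<rho>" "\<rho> \<le> 1" for \<rho>
    by (rule antimono_scale[OF _ c(1) f_step f_lim that]) (simp add: f_def)
  define C where "C = exp D / pv * (1 / c\<^sup>2) powr \<alpha>"
  have "0 \<le> D" using drop[of 0 0] by simp
  have C: "1 \<le> C"
  proof -
    have "1 \<le> (1 / c\<^sup>2) powr \<alpha>" using c(1) c1 \<alpha> by (intro ge_one_powr_ge_zero) (auto simp: power_le_one)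
    moreover have "1 \<le> exp D / pv" using \<open>0 \<le> D\<close> pv by (simp add: le_divide_eq order_trans[of pv 1])
    ultimately have "1 * 1 \<le> C" unfolding C_def by (intro mult_mono) auto
    then show ?thesis by simp
  qed
  have "assouad_bound \<mu> x C \<alpha>"
  proof (rule assouad_boundI[OF xX C])
    fix \<rho> R :: real assume \<rho>: "0 < \<rho>" "\<rho> < R" "R \<le> 1"
    obtain n where n: "R \<le> f n" "f (Suc n) < R" using scale[of R] \<rho> by auto
    obtain k where k: "\<rho> \<le> f k" "f (Suc k) < \<rho>" "c * \<rho> \<le> f (Suc k)" using scale[of \<rho>] \<rho> by auto
    have "n \<le> Suc k"
    proof (rule ccontr)
      assume "\<not> n \<le> Suc k"
      then have "f n \<le> f (Suc k)" by (intro f_dec) simp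
      then show False using n k \<rho> by simp
    qed
    have "measure \<mu> (cball x R) \<le> g n / pv" using upper n by simp
    also have "\<dots> = exp (S n - S (Suc k)) * (f n / f (Suc k)) powr \<alpha> / pv * g (Suc k)"
      using pos(2)[of "Suc k"] by (simp flip: gS)
    also have "\<dots> \<le> exp D * (1 / c\<^sup>2 * (R / \<rho>)) powr \<alpha> / pv * measure \<mu> (cball x \<rho>)"
    proof (intro mult_mono divide_right_mono powr_mono2)
      show "exp (S n - S (Suc k)) \<le> exp D" using drop[OF \<open>n \<le> Suc k\<close>] by simp
      have "c * f n \<le> R" using f_step[of n] n(2) by simp
      then have "f n / f (Suc k) \<le> (R / c) / (c * \<rho>)"
        using k(3) c(1) \<rho> pos by (intro frac_le) (auto simp: field_simps)
      also have "\<dots> = 1 / c\<^sup>2 * (R / \<rho>)" by (simp add: power2_eq_square)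
      finally show "f n / f (Suc k) \<le> 1 / c\<^sup>2 * (R / \<rho>)" .
      show "g (Suc k) \<le> measure \<mu> (cball x \<rho>)" using lower k by simp
    qed (use pos \<alpha> pv in \<open>auto simp: less_imp_le\<close>)
    also have "\<dots> = C * (R / \<rho>) powr \<alpha> * measure \<mu> (cball x \<rho>)"
      using c(1) \<rho> by (simp add: C_def powr_mult[of "1 / c\<^sup>2" "R / \<rho>"] mult.assoc del: times_divide_eq_left times_divide_eq_right) (simp add: mult.commute)
    finally show "measure \<mu> (cball x R) \<le> C * (R / \<rho>) powr \<alpha> * measure \<mu> (cball x \<rho>)" .
  qed (use \<alpha> in simp)
  then have le: "assouad_dim_at \<mu> x \<le> ereal \<alpha>"
    unfolding assouad_dim_at_def using \<alpha> C
    by (intro Inf_lower CollectI exI[of _ \<alpha>]) (auto intro!: exI[of _ C])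
  have "\<alpha> \<le> s" if b: "assouad_bound \<mu> x K s" "0 < K" for K s
  proof (rule ccontr)
    assume "\<not> \<alpha> \<le> s"
    then have s: "0 < \<alpha> - s" by simp
    define y where "y = (1 / rmax) powr (\<alpha> - s)"
    have "1 < y" unfolding y_def using s rmin_rmax(1-3) powr_less_mono2[of "\<alpha> - s" 1 "1 / rmax"] by simp
    then obtain i where i: "K * exp D / pv < y ^ i" using real_arch_pow by blast
    have "i \<noteq> 0 \<or> K * exp D / pv < 1" using i by (cases i) auto
    define i' where "i' = Suc i"
    have i': "K * exp D / pv < y ^ i'" using i \<open>1 < y\<close> by (simp add: i'_def) (smt (verit) mult_less_cancel_right1 power_strict_mono zero_less_power)
    obtain n where n: "S (n + i') \<le> S n + D" using flat by blast
    have ratio: "1 / rmax ^ i' \<le> f n / f (n + i')"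
    proof -
      have "f (n + i') \<le> rmax ^ i' * f n" for i'
      proof (induction i')
        case (Suc j)
        have "rmax ^ length (\<omega> (n + j)) \<le> rmax ^ 1"
          using \<omega>l(2)[of "n + j"] rmin_rmax(1-3) by (intro power_decreasing) (auto simp: Suc_le_eq)
        then have "wt r (\<omega> (n + j)) \<le> rmax" using wt_r_power[OF \<omega>l(1)[of "n + j"]] by simp
        then have "wt r (\<omega> (n + j)) * f (n + j) \<le> rmax * (rmax ^ j * f n)"
          using Suc pos[of "n + j"] rmin_rmax(1-3) by (intro mult_mono) auto
        then show ?case by (simp add: f_def mult.commute mult.left_commute)
      qed simp
      from this[of i'] show ?thesis using pos[of "n + i'"] rmin_rmax(1-3) by (simp add: field_simps)
    qed
    have "f (n + i') < f n"
    proof -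
      have "1 < 1 / rmax ^ i'"
        using rmin_rmax(1-3) power_Suc_less_one[of rmax i] by (simp add: i'_def del: power_Suc)
      then have "1 < f n / f (n + i')" using ratio by simp
      then show ?thesis using pos[of "n + i'"] by simp
    qed
    then have "measure \<mu> (cball x (f n)) \<le> K * (f n / f (n + i')) powr s * measure \<mu> (cball x (f (n + i')))"
      using b[unfolded assouad_bound_iff[OF xX]] pos by blast
    also have "\<dots> \<le> K * (f n / f (n + i')) powr s * (g (n + i') / pv)"
      using upper[of "f (n + i')" "n + i'"] b(2) by (intro mult_left_mono) auto
    finally have "g n \<le> K * (f n / f (n + i')) powr s * (g (n + i') / pv)"
      using lower[of n "f n"] by simp
    then have "g n / g (n + i') \<le> K * (f n / f (n + i')) powr s / pv"
      using pos[of "n + i'"] by (simp add: divide_le_eq)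
    moreover have "exp (- D) * (f n / f (n + i')) powr \<alpha> \<le> g n / g (n + i')"
      unfolding gS using n by (intro mult_right_mono) auto
    ultimately have "exp (- D) * (f n / f (n + i')) powr \<alpha> \<le> K * (f n / f (n + i')) powr s / pv" by linarith
    then have "(f n / f (n + i')) powr \<alpha> \<le> K * exp D / pv * (f n / f (n + i')) powr s"
      by (simp add: exp_minus field_simps)
    moreover have "(f n / f (n + i')) powr \<alpha> = (f n / f (n + i')) powr (\<alpha> - s) * (f n / f (n + i')) powr s"
      by (simp flip: powr_add)
    moreover have "0 < (f n / f (n + i')) powr s" using pos[of n] pos[of "n + i'"] by simp
    ultimately have "(f n / f (n + i')) powr (\<alpha> - s) \<le> K * exp D / pv"
      by (metis mult_le_cancel_right_pos)
    moreover have "y ^ i' \<le> (f n / f (n + i')) powr (\<alpha> - s)"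
    proof -
      have "y ^ i' = (1 / rmax ^ i') powr (\<alpha> - s)"
        using rmin_rmax(1-3) unfolding y_def
        by (simp add: powr_divide powr_power powr_powr mult.commute power_divide flip: powr_realpow)
      also have "\<dots> \<le> (f n / f (n + i')) powr (\<alpha> - s)"
        using ratio s rmin_rmax(1-3) by (intro powr_mono2) auto
      finally show ?thesis .
    qed
    ultimately show False using i' by simp
  qed
  then have "ereal \<alpha> \<le> assouad_dim_at \<mu> x" unfolding assouad_dim_at_def by (intro Inf_greatest) auto
  then show ?thesis using le by (rule antisym[rotated])
qed

end

text \<open>A set of density at most \<open>1 / K\<close> that contains arbitrarily long intervals.\<close>
definition runs :: "nat \<Rightarrow> nat set" where
  "runs K = {j. \<exists>i. K * i\<^sup>2 \<le> j \<and> j < K * i\<^sup>2 + i}"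

lemma runs_density:
  assumes "0 < K" shows "K * card {j. j < n \<and> j \<in> runs K} \<le> n"
proof (cases "{j. j < n \<and> j \<in> runs K} = {}")
  case False
  define I where "I = {i. K * i\<^sup>2 < n}"
  have "i < n" if "i \<in> I" for i
  proof -
    have "i \<le> i\<^sup>2" by (simp add: power2_eq_square)
    also have "\<dots> \<le> K * i\<^sup>2" using assms by simp
    finally show ?thesis using that by (simp add: I_def)
  qed
  then have I: "finite I" by (meson finite_nat_set_iff_bounded)
  obtain i0 j0 where "K * i0\<^sup>2 \<le> j0" "j0 < n" using False by (auto simp: runs_def)
  then have "i0 \<in> I" by (simp add: I_def)
  define k where "k = Max I"
  have k: "k \<in> I" "\<And>i. i \<in> I \<Longrightarrow> i \<le> k" using I \<open>i0 \<in> I\<close> by (auto simp: k_def intro: Max_in)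
  have "{j. j < n \<and> j \<in> runs K} \<subseteq> (\<Union>i\<le>k. {K * i\<^sup>2..<K * i\<^sup>2 + i})"
  proof
    fix j assume "j \<in> {j. j < n \<and> j \<in> runs K}"
    then obtain i where i: "j < n" "K * i\<^sup>2 \<le> j" "j < K * i\<^sup>2 + i" by (auto simp: runs_def)
    then have "i \<in> I" by (simp add: I_def)
    then show "j \<in> (\<Union>i\<le>k. {K * i\<^sup>2..<K * i\<^sup>2 + i})" using i k(2) by auto
  qed
  then have "card {j. j < n \<and> j \<in> runs K} \<le> card (\<Union>i\<le>k. {K * i\<^sup>2..<K * i\<^sup>2 + i})"
    by (intro card_mono) auto
  also have "\<dots> \<le> (\<Sum>i\<le>k. card {K * i\<^sup>2..<K * i\<^sup>2 + i})" by (rule card_UN_le) simp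
  also have "\<dots> = (\<Sum>i\<le>k. i)" by simp
  also have "\<dots> \<le> k\<^sup>2" by (induction k) (auto simp: power2_eq_square)
  finally have "K * card {j. j < n \<and> j \<in> runs K} \<le> K * k\<^sup>2" by (intro mult_left_mono) auto
  moreover have "K * k\<^sup>2 < n" using k(1) by (simp add: I_def)
  ultimately show ?thesis by linarith
next
  case True
  show ?thesis unfolding True by simp
qed

lemma card_less_Suc_filter:
  "card {j. j < Suc n \<and> P j} = card {j. j < n \<and> P j} + (if P n then 1 else 0)"
proof -
  have "{j. j < Suc n \<and> P j} = (if P n then insert n {j. j < n \<and> P j} else {j. j < n \<and> P j})"
    by (auto simp: less_Suc_eq)
  then show ?thesis by simp
qed

text \<open>Steps \<open>+ \<sigma>\<close> and \<open>- b\<close> chosen greedily so that the walk stays close to a target that grows with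
  slope \<open>\<sigma>\<close> outside \<open>runs K\<close> and is constant on \<open>runs K\<close>. So the walk never drops far, it has
  arbitrarily long flat stretches, and most of its steps go up.\<close>
lemma greedy_walk:
  fixes \<sigma> b :: real and K :: nat
  assumes \<sigma>: "0 < \<sigma>" and b: "0 < b" and K: "0 < K"
  shows "\<exists>(F :: nat \<Rightarrow> bool) S. S 0 = 0 \<and> (\<forall>n. S (Suc n) = (if F n then S n + \<sigma> else S n - b)) \<and>
     (\<forall>n n'. n \<le> n' \<longrightarrow> S n \<le> S n' + 2 * (b + \<sigma>)) \<and>
     (\<forall>i. \<exists>n. S (n + i) \<le> S n + 2 * (b + \<sigma>)) \<and>
     (\<forall>n. real (card {j. j < n \<and> \<not> F j}) \<le> real n / real K + 1)"
proof -
  define u where "u n = card {j. j < n \<and> j \<in> runs K}" for n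
  define g where "g n = \<sigma> * (real n - u n)" for n
  have u_Suc: "u (Suc n) = u n + (if n \<in> runs K then 1 else 0)" for n
    unfolding u_def by (rule card_less_Suc_filter)
  have g_Suc: "g n \<le> g (Suc n) \<and> g (Suc n) \<le> g n + \<sigma>" for n
    using \<sigma> by (simp add: g_def u_Suc algebra_simps)
  have g_mono: "g n \<le> g n'" if "n \<le> n'" for n n'
    using that g_Suc by (meson lift_Suc_mono_le)
  define S where "S = rec_nat 0 (\<lambda>n s. if s \<le> g n then s + \<sigma> else s - b)"
  define F where "F n \<longleftrightarrow> S n \<le> g n" for n
  have S0: "S 0 = 0" by (simp add: S_def)
  have S_Suc: "S (Suc n) = (if F n then S n + \<sigma> else S n - b)" for n by (simp add: S_def F_def)
  have near: "g n - (b + \<sigma>) \<le> S n \<and> S n \<le> g n + \<sigma>" for n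
  proof (induction n)
    case 0
    then show ?case using \<sigma> b by (simp add: S0 g_def u_def)
  next
    case (Suc n)
    then show ?case using g_Suc[of n] \<sigma> b by (auto simp: S_Suc F_def)
  qed
  have near1: "g n - (b + \<sigma>) \<le> S n" and near2: "S n \<le> g n + \<sigma>" for n using near by auto
  have drop: "S n \<le> S n' + 2 * (b + \<sigma>)" if "n \<le> n'" for n n'
    using near2[of n] near1[of n'] g_mono[OF that] \<sigma> b by (simp add: algebra_simps)
  have flat: "S (n + i) \<le> S n + 2 * (b + \<sigma>)" if n: "n = K * i\<^sup>2" for i n
  proof -
    have "u (n + l) = u n + l" if "l \<le> i" for l
      using that
    proof (induction l)
      case (Suc l)
      then have "n + l \<in> runs K" using n by (auto simp: runs_def intro!: exI[of _ i])
      then show ?case using Suc by (simp add: u_Suc)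
    qed simp
    then have "g (n + i) = g n" by (simp add: g_def)
    then show ?thesis using near1[of n] near2[of "n + i"] \<sigma> b by (simp add: algebra_simps)
  qed
  have dens: "real (card {j. j < n \<and> \<not> F j}) \<le> real n / real K + 1" for n
  proof -
    define m where "m = card {j. j < n \<and> \<not> F j}"
    have "S n = \<sigma> * (real n - card {j. j < n \<and> \<not> F j}) - b * card {j. j < n \<and> \<not> F j}" for n
      by (induction n) (auto simp: S0 S_Suc card_less_Suc_filter algebra_simps)
    then have "\<sigma> * (real n - m) - b * m \<ge> \<sigma> * (real n - u n) - (b + \<sigma>)"
      using near[of n] by (simp add: m_def g_def)
    then have "(b + \<sigma>) * m \<le> \<sigma> * u n + (b + \<sigma>)" by (simp add: algebra_simps)
    also have "\<dots> \<le> (b + \<sigma>) * u n + (b + \<sigma>)" using b by (simp add: mult_right_mono)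
    finally have "(b + \<sigma>) * m \<le> (b + \<sigma>) * (u n + 1)" by (simp add: algebra_simps)
    then have "real m \<le> u n + 1" using b \<sigma> by (subst (asm) mult_le_cancel_left_pos) auto
    moreover have "real (K * u n) \<le> real n" using runs_density[OF K, of n] unfolding u_def of_nat_le_iff .
    then have "real (u n) \<le> real n / real K" using K by (simp add: le_divide_eq mult.commute)
    ultimately show ?thesis by (simp add: m_def)
  qed
  show ?thesis
    by (intro exI[of _ F] exI[of _ S]) (use S0 S_Suc drop flat dens in blast)
qed

context self_similar_measure
begin

text \<open>The free blocks make the mass decay slower than the exponent \<open>\<alpha>\<close> does, and the block of a long run
  of a letter of maximal exponent makes it decay faster. A greedy mixture of the two keeps the
  exponent at most \<open>\<alpha>\<close> and makes it equal to \<open>\<alpha>\<close> along long stretches, while the second block remains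
  rare.\<close>
lemma dim_level_mid_ge:
  assumes PT: "(\<Sum>i\<in>J. p i powr q * r i powr T) = 1"
    and mean: "(\<Sum>i\<in>J. p i powr q * r i powr T * (ln (p i) - \<beta> * ln (r i))) = 0"
    and q: "0 \<le> q" and t: "0 < t" "t < \<beta> * q + T" and \<alpha>: "\<beta> < \<alpha>" "\<alpha> < amax" "0 < \<alpha>"
  shows "ereal t \<le> hausdorff_dim (assouad_level_set \<mu> (ereal \<alpha>))"
proof -
  define t' where "t' = (t + (\<beta> * q + T)) / 2"
  have t': "t < t'" "t' < \<beta> * q + T" using t by (auto simp: t'_def)
  obtain \<Gamma> \<kappa> \<pi> where G: "finite \<Gamma>" "\<Gamma> \<noteq> {}" "\<Gamma> \<subseteq> lists J" "antichain \<Gamma>" "[] \<notin> \<Gamma>"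
      "\<forall>g\<in>\<Gamma>. (\<exists>h\<in>lists J. g = h @ isolator) \<and> wt r g = \<kappa> \<and> wt p g = \<pi>" "1 / card \<Gamma> \<le> \<kappa> powr t'"
      "\<kappa> powr \<alpha> < \<pi>"
    using homogeneous_blocks[OF order_refl PT mean q t'(2) \<alpha>(1) isolator_word(1)] by blast
  obtain g where g: "g \<in> \<Gamma>" using G by blast
  have gl: "g \<in> lists J" "g \<noteq> []" using g G by auto
  have \<kappa>: "0 < \<kappa>" "\<kappa> < 1" using gl G(6) g wt_r_pos[of g] wt_r_lt1[of g] by auto
  have \<pi>: "0 < \<pi>" using gl G(6) g wt_p_pos[of g] by auto
  define \<sigma> where "\<sigma> = ln \<pi> - \<alpha> * ln \<kappa>"
  have \<sigma>: "0 < \<sigma>"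
  proof -
    have "ln (\<kappa> powr \<alpha>) < ln \<pi>" using G(8) \<kappa> \<pi> by (subst ln_less_cancel_iff) auto
    then show ?thesis using \<kappa> by (simp add: \<sigma>_def ln_powr)
  qed
  obtain i where i: "i \<in> J" "ln (p i) / ln (r i) = amax" using amin_amax(4) by blast
  have pi: "ln (p i) = amax * ln (r i)" using i r01[of i] by (auto simp: divide_eq_eq)
  define s0 where "s0 = ln (wt p isolator) - \<alpha> * ln (wt r isolator)"
  define e where "e = (amax - \<alpha>) * (- ln (r i))"
  have e: "0 < e" unfolding e_def using \<alpha> r01[OF i(1)] by (intro mult_pos_pos) auto
  \<comment> \<open>The run is so long that it outweighs the isolator behind it.\<close>
  obtain L :: nat where L: "s0 < L * e" using ex_less_of_nat_mult[OF e] by blast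
  define B where "B = replicate L i @ isolator"
  have Bl: "B \<in> lists J" "B \<noteq> []" using i isolator_word by (auto simp: B_def)
  define b where "b = - (ln (wt p B) - \<alpha> * ln (wt r B))"
  have b: "0 < b"
  proof -
    have "0 < p i" "0 < r i" "0 < wt p isolator" "0 < wt r isolator"
      using i p_pos r01 wt_p_pos wt_r_pos isolator_word by auto
    then have "b = L * e - s0"
      by (simp add: b_def B_def wt_replicate ln_mult ln_realpow pi e_def s0_def algebra_simps)
    then show ?thesis using L by simp
  qed
  define lB where "lB = - ln (wt r B)"
  have lB: "0 < lB" using wt_r_pos[OF Bl(1)] wt_r_lt1[OF Bl] by (simp add: lB_def)
  define G0 where "G0 = (t' - t) * (- ln \<kappa>)"
  have G0: "0 < G0" unfolding G0_def using t'(1) \<kappa> by (intro mult_pos_pos) auto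
  obtain K0 :: nat where K0: "2 * t * lB / G0 < K0" using reals_Archimedean2 by blast
  define K where "K = max 2 K0"
  have K: "0 < K" "2 \<le> real K" "2 * t * lB < G0 * K"
  proof -
    show "0 < K" "2 \<le> real K" by (auto simp: K_def)
    have "2 * t * lB / G0 < K" using K0 by (simp add: K_def)
    then show "2 * t * lB < G0 * K" using G0 by (simp add: divide_less_eq mult.commute)
  qed
  obtain F :: "nat \<Rightarrow> bool" and S where FS: "S 0 = 0"
      "\<forall>n. S (Suc n) = (if F n then S n + \<sigma> else S n - b)"
      "\<forall>n n'. n \<le> n' \<longrightarrow> S n \<le> S n' + 2 * (b + \<sigma>)" "\<forall>i. \<exists>n. S (n + i) \<le> S n + 2 * (b + \<sigma>)"
      "\<forall>n. real (card {j. j < n \<and> \<not> F j}) \<le> real n / real K + 1"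
    using greedy_walk[OF \<sigma> b K(1)] by (elim exE conjE) blast
  have "coded (\<lambda>j. if F j then \<Gamma> else {B}) \<subseteq> assouad_level_set \<mu> (ereal \<alpha>)"
  proof
    fix x assume "x \<in> coded (\<lambda>j. if F j then \<Gamma> else {B})"
    then obtain \<omega> where \<omega>: "\<And>j. \<omega> j \<in> (if F j then \<Gamma> else {B})" "\<And>n. x \<in> cyl (spell \<omega> n)"
      unfolding coded_def by blast
    have \<omega>F: "F j \<Longrightarrow> \<omega> j \<in> \<Gamma>" "\<not> F j \<Longrightarrow> \<omega> j = B" for j using \<omega>(1)[of j] by auto
    have \<omega>l: "\<omega> j \<in> lists J" for j using \<omega>F[of j] G(3) Bl by (cases "F j") auto
    have "assouad_dim_at \<mu> x = ereal \<alpha>"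
    proof (rule dim_at_eq_of_code[where \<omega> = \<omega> and S = S and D = "2 * (b + \<sigma>)" and c = "min \<kappa> (wt r B)"])
      show "\<exists>h\<in>lists J. \<omega> j = h @ isolator" for j
      proof (cases "F j")
        case True
        then show ?thesis using \<omega>F G(6) by blast
      next
        case False
        then show ?thesis using \<omega>F(2)[OF False] i by (intro bexI[of _ "replicate L i"]) (auto simp: B_def)
      qed
      show "0 < min \<kappa> (wt r B)" using \<kappa> wt_r_pos[OF Bl(1)] by simp
      show "min \<kappa> (wt r B) \<le> wt r (\<omega> j)" for j
        using \<omega>F[of j] G(6) by (cases "F j") auto
      show "ln (wt p (spell \<omega> n)) - \<alpha> * ln (wt r (spell \<omega> n)) = S n" for n
      proof (induction n)
        case (Suc n)
        have "spell \<omega> n \<in> lists J" by (rule spell_lists[OF \<omega>l])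
        then have "0 < wt p (spell \<omega> n)" "0 < wt r (spell \<omega> n)" "0 < wt p (\<omega> n)" "0 < wt r (\<omega> n)"
          using wt_p_pos wt_r_pos \<omega>l by auto
        then have "ln (wt p (spell \<omega> (Suc n))) - \<alpha> * ln (wt r (spell \<omega> (Suc n)))
            = S n + (ln (wt p (\<omega> n)) - \<alpha> * ln (wt r (\<omega> n)))"
          using Suc by (simp add: ln_mult algebra_simps)
        also have "\<dots> = S (Suc n)"
          using \<omega>F[of n] G(6) FS(2) by (cases "F n") (auto simp: \<sigma>_def b_def)
        finally show ?case .
      qed (simp add: FS(1))
    qed (use \<omega>(2) FS(3,4) \<alpha>(3) in auto)
    moreover have "x \<in> X" using \<omega>(2)[of 0] by simp
    ultimately show "x \<in> assouad_level_set \<mu> (ereal \<alpha>)" by (simp add: assouad_level_set_def spt_eq)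
  qed
  then show ?thesis
  proof (rule dim_mixed_blocks_ge[where \<Gamma> = \<Gamma> and \<kappa> = \<kappa> and z = "\<lambda>_. B" and t' = t' and F = F
        and D = "2 * t * lB + G0", rotated -1])
    fix n
    define m where "m = card {j. j < n \<and> \<not> F j}"
    define a where "a = card {j. j < n \<and> F j}"
    have "card {j. j \<le> n \<and> \<not> F j} \<le> m + 1"
      unfolding m_def using card_less_Suc_filter[of n "\<lambda>j. \<not> F j"] by (simp add: less_Suc_eq_le)
    then have "t * lB * card {j. j \<le> n \<and> \<not> F j} \<le> t * lB * (m + 1)"
      using t lB by (intro mult_left_mono) (auto simp flip: of_nat_Suc)
    moreover have "t * lB * (m + 1) = t * lB * m + t * lB" "t * lB * (n / K + 1) = t * lB * (n / K) + t * lB"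
      by (simp_all add: algebra_simps)
    moreover have m: "m \<le> n / K + 1" using FS(5) by (simp add: m_def)
    then have "t * lB * m \<le> t * lB * (n / K + 1)" using t lB by (intro mult_left_mono) auto
    moreover have "t * lB * (n / K) \<le> G0 * (n / 2)"
    proof -
      have "(2 * t * lB) * n \<le> (G0 * K) * n" using K(3) by (intro mult_right_mono) auto
      then show ?thesis using K(1) by (simp add: field_simps)
    qed
    moreover have "real a + m = n"
    proof -
      have "a + m = card ({j. j < n \<and> F j} \<union> {j. j < n \<and> \<not> F j})"
        unfolding a_def m_def by (intro card_Un_disjoint[symmetric]) auto
      also have "{j. j < n \<and> F j} \<union> {j. j < n \<and> \<not> F j} = {..<n}" by auto
      finally show ?thesis by (simp flip: of_nat_add)
    qed
    moreover have "n / K \<le> n / 2" using K(2) by (intro divide_left_mono) auto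
    ultimately have "n / 2 \<le> a + 1" "t * lB * card {j. j \<le> n \<and> \<not> F j} \<le> G0 * (n / 2) + 2 * t * lB"
      using m by linarith+
    then have "t * lB * card {j. j \<le> n \<and> \<not> F j} \<le> G0 * (a + 1) + 2 * t * lB"
      using mult_left_mono[of "n / 2" "a + 1" G0] G0 by linarith
    then show "t * (\<Sum>j\<in>{j. j \<le> n \<and> \<not> F j}. - ln (wt r B))
        \<le> (t' - t) * (- ln \<kappa>) * card {j. j < n \<and> F j} + (2 * t * lB + G0)"
      unfolding lB_def[symmetric] G0_def[symmetric] a_def[symmetric] by (simp add: algebra_simps)
  qed (use G Bl t in auto)
qed

subsection \<open>Points of the largest exponent\<close>

lemma assouad_bound_mono:
  assumes "x \<in> X" "assouad_bound \<mu> x C s" "C \<le> C'" "s \<le> s'" "0 \<le> C'"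
  shows "assouad_bound \<mu> x C' s'"
  unfolding assouad_bound_iff[OF assms(1)]
proof (intro allI impI)
  fix \<rho> R :: real assume \<rho>: "0 < \<rho> \<and> \<rho> < R"
  have "measure \<mu> (cball x R) \<le> C * (R / \<rho>) powr s * measure \<mu> (cball x \<rho>)"
    using assms(2)[unfolded assouad_bound_iff[OF assms(1)]] \<rho> by blast
  also have "\<dots> \<le> C' * (R / \<rho>) powr s' * measure \<mu> (cball x \<rho>)"
    using \<rho> assms by (intro mult_right_mono mult_mono powr_mono) auto
  finally show "measure \<mu> (cball x R) \<le> C' * (R / \<rho>) powr s' * measure \<mu> (cball x \<rho>)" .
qed

text \<open>A dimension below the global one would give a bound whose exponent and constant can be raised to
  a member of a countable family, and each member of this family is violated at all points that
  pass through one particular word.\<close>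
lemma bad_words_exist:
  "\<exists>z :: nat \<Rightarrow> nat list. (\<forall>n. z n \<in> lists J \<and> z n \<noteq> []) \<and>
     (\<forall>x\<in>X. (\<forall>n. \<exists>a\<in>lists J. x \<in> cyl (a @ z n)) \<longrightarrow> assouad_dim_at \<mu> x = assouad_dim \<mu>)"
proof -
  have "\<exists>t :: nat \<Rightarrow> real. (\<forall>n. ereal (t n) < assouad_dim \<mu>) \<and> (\<forall>s. ereal s < assouad_dim \<mu> \<longrightarrow> (\<exists>n. s \<le> t n))"
  proof (cases "assouad_dim \<mu> = \<infinity>")
    case True
    then show ?thesis by (intro exI[of _ real]) (auto intro: real_arch_simple)
  next
    case False
    then have d: "assouad_dim \<mu> = ereal amax" using assouad_dim_cases by blast
    have "\<exists>n. s \<le> amax - inverse (Suc n)" if "s < amax" for s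
      using reals_Archimedean[of "amax - s"] that by (auto simp: algebra_simps intro!: less_imp_le)
    then show ?thesis unfolding d by (intro exI[of _ "\<lambda>n. amax - inverse (real (Suc n))"]) auto
  qed
  then obtain t :: "nat \<Rightarrow> real" where t: "\<And>n. ereal (t n) < assouad_dim \<mu>"
      "\<And>s. ereal s < assouad_dim \<mu> \<Longrightarrow> \<exists>n. s \<le> t n" by metis
  define z where "z n k = (SOME z. z \<in> lists J \<and>
      (\<forall>a\<in>lists J. \<forall>x\<in>cyl (a @ z). \<not> assouad_bound \<mu> x (real k) (t n)))" for n k
  have "z n k \<in> lists J \<and> (\<forall>a\<in>lists J. \<forall>x\<in>cyl (a @ z n k). \<not> assouad_bound \<mu> x (real k) (t n))" for n k
    unfolding z_def by (rule someI_ex) (use bad_word[OF t(1)] in blast)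
  then have z: "\<And>n k. z n k \<in> lists J"
      "\<And>n k a x. a \<in> lists J \<Longrightarrow> x \<in> cyl (a @ z n k) \<Longrightarrow> \<not> assouad_bound \<mu> x (real k) (t n)" by blast+
  define y where "y j = (case prod_decode j of (n, k) \<Rightarrow> z n k @ isolator)" for j
  have y: "y j \<in> lists J" "y j \<noteq> []" for j
    using z(1) isolator_word by (auto simp: y_def split: prod.split)
  have "assouad_dim_at \<mu> x = assouad_dim \<mu>" if x: "x \<in> X" "\<And>j. \<exists>a\<in>lists J. x \<in> cyl (a @ y j)" for x
  proof (rule ccontr)
    assume "assouad_dim_at \<mu> x \<noteq> assouad_dim \<mu>"
    then have "assouad_dim_at \<mu> x < assouad_dim \<mu>" using assouad_dim_at_le[OF x(1)] by simp
    then obtain s C where s: "ereal s < assouad_dim \<mu>" "0 < C" "assouad_bound \<mu> x C s"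
      unfolding assouad_dim_at_def Inf_less_iff by auto
    obtain n where n: "s \<le> t n" using t(2)[OF s(1)] by blast
    obtain k where k: "C \<le> real k" using real_arch_simple by blast
    obtain a where a: "a \<in> lists J" "x \<in> cyl (a @ y (prod_encode (n, k)))" using x(2) by blast
    then have "x \<in> cyl ((a @ z n k) @ isolator)" by (simp add: y_def)
    then have "x \<in> cyl (a @ z n k)"
      using cyl_prefix[of "(a @ z n k) @ isolator" "a @ z n k"] a(1) z(1)[of n k] isolator_word by auto
    then show False using z(2)[OF a(1)] assouad_bound_mono[OF x(1) s(3) k n] by simp
  qed
  then show ?thesis using y by (intro exI[of _ y]) blast
qed

text \<open>The global dimension bounds the pointwise one from above, so it is enough to insert the words of
  \<open>bad_words_exist\<close> rarely enough into sequences of blocks of maximal dimension.\<close>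
lemma dim_level_top_ge:
  assumes PT: "(\<Sum>i\<in>J. p i powr 0 * r i powr T) = 1"
    and mean: "(\<Sum>i\<in>J. p i powr 0 * r i powr T * (ln (p i) - \<beta> * ln (r i))) = 0"
    and t: "0 < t" "t < T"
  shows "ereal t \<le> hausdorff_dim (assouad_level_set \<mu> (assouad_dim \<mu>))"
proof -
  define t' where "t' = (t + T) / 2"
  have t': "t < t'" "t' < \<beta> * 0 + T" using t by (auto simp: t'_def)
  have "\<beta> < \<beta> + 1" "[] \<in> lists J" by simp_all
  from homogeneous_blocks[OF order_refl PT mean order_refl t'(2) this]
  obtain \<Gamma> \<kappa> \<pi> where G: "finite \<Gamma>" "\<Gamma> \<noteq> {}" "\<Gamma> \<subseteq> lists J" "antichain \<Gamma>" "[] \<notin> \<Gamma>"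
      "\<forall>g\<in>\<Gamma>. (\<exists>h\<in>lists J. g = h @ []) \<and> wt r g = \<kappa> \<and> wt p g = \<pi>" "1 / card \<Gamma> \<le> \<kappa> powr t'"
    by blast
  obtain g where g: "g \<in> \<Gamma>" using G by blast
  have \<kappa>: "0 < \<kappa>" "\<kappa> < 1" using G(3,5,6) g wt_r_pos[of g] wt_r_lt1[of g] by auto
  obtain z :: "nat \<Rightarrow> nat list" where z: "\<And>n. z n \<in> lists J" "\<And>n. z n \<noteq> []"
    "\<And>x. x \<in> X \<Longrightarrow> (\<And>n. \<exists>a\<in>lists J. x \<in> cyl (a @ z n)) \<Longrightarrow> assouad_dim_at \<mu> x = assouad_dim \<mu>"
    using bad_words_exist by metis
  define l where "l k = - ln (wt r (z k))" for k
  have l: "0 \<le> l k" for k using wt_r_pos[OF z(1)] wt_r_le1[OF z(1)] by (simp add: l_def)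
  define E where "E = (t' - t) * (- ln \<kappa>) / t"
  have E: "0 < E" unfolding E_def using t'(1) t \<kappa> by (intro divide_pos_pos mult_pos_pos) auto
  \<comment> \<open>The \<open>k\<close>-th word is inserted at a place that exceeds the total logarithmic size of all
    insertions so far, divided by \<open>E\<close>.\<close>
  define N where "N k = k + nat \<lceil>(\<Sum>i\<le>k. l i) / E\<rceil>" for k
  have N_mono: "strict_mono N"
  proof (rule strict_monoI_Suc)
    fix k
    have "(\<Sum>i\<le>k. l i) / E \<le> (\<Sum>i\<le>Suc k. l i) / E" using l E by (intro divide_right_mono) auto
    then have "nat \<lceil>(\<Sum>i\<le>k. l i) / E\<rceil> \<le> nat \<lceil>(\<Sum>i\<le>Suc k. l i) / E\<rceil>" by (intro nat_mono ceiling_mono)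
    then show "N k < N (Suc k)" unfolding N_def by linarith
  qed
  have N_size: "(\<Sum>i\<le>k. l i) \<le> E * (N k - k)" for k
  proof -
    have "(\<Sum>i\<le>k. l i) / E \<le> nat \<lceil>(\<Sum>i\<le>k. l i) / E\<rceil>" by linarith
    then have "(\<Sum>i\<le>k. l i) \<le> E * nat \<lceil>(\<Sum>i\<le>k. l i) / E\<rceil>" using E by (simp add: divide_le_eq mult.commute)
    then show ?thesis by (simp add: N_def)
  qed
  have N_inj: "inj N" using N_mono strict_mono_imp_inj_on by blast
  define F where "F j \<longleftrightarrow> j \<notin> range N" for j
  define y where "y j = z (inv N j)" for j
  have y: "y j \<in> lists J" "y j \<noteq> []" for j using z by (auto simp: y_def)
  have yN: "y (N k) = z k" for k using N_inj by (simp add: y_def)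
  have "coded (\<lambda>j. if F j then \<Gamma> else {y j}) \<subseteq> assouad_level_set \<mu> (assouad_dim \<mu>)"
  proof
    fix x assume "x \<in> coded (\<lambda>j. if F j then \<Gamma> else {y j})"
    then obtain \<omega> where \<omega>: "\<And>j. \<omega> j \<in> (if F j then \<Gamma> else {y j})" "\<And>n. x \<in> cyl (spell \<omega> n)"
      unfolding coded_def by blast
    have \<omega>l: "\<omega> j \<in> lists J" for j using \<omega>(1)[of j] G(3) y by (cases "F j") auto
    have "\<exists>a\<in>lists J. x \<in> cyl (a @ z k)" for k
    proof (intro bexI[of _ "spell \<omega> (N k)"])
      have "\<omega> (N k) = z k" using \<omega>(1)[of "N k"] by (simp add: F_def yN)
      then show "x \<in> cyl (spell \<omega> (N k) @ z k)" using \<omega>(2)[of "Suc (N k)"] by simp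
      show "spell \<omega> (N k) \<in> lists J" by (rule spell_lists[OF \<omega>l])
    qed
    moreover have "x \<in> X" using \<omega>(2)[of 0] by simp
    ultimately show "x \<in> assouad_level_set \<mu> (assouad_dim \<mu>)"
      using z(3) by (simp add: assouad_level_set_def spt_eq)
  qed
  then show ?thesis
  proof (rule dim_mixed_blocks_ge[where \<Gamma> = \<Gamma> and \<kappa> = \<kappa> and z = y and t' = t' and F = F and D = 0, rotated -1])
    fix n
    show "t * (\<Sum>j\<in>{j. j \<le> n \<and> \<not> F j}. - ln (wt r (y j)))
        \<le> (t' - t) * (- ln \<kappa>) * card {j. j < n \<and> F j} + 0"
    proof (cases "{j. j \<le> n \<and> \<not> F j} = {}")
      case True
      have "0 \<le> (t' - t) * (- ln \<kappa>)" using t' \<kappa> by (intro mult_nonneg_nonneg) auto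
      then have "0 \<le> (t' - t) * (- ln \<kappa>) * real (card {j. j < n \<and> F j})"
        by (rule mult_nonneg_nonneg) simp
      then show ?thesis unfolding True by simp
    next
      case False
      then obtain k0 where "N k0 \<le> n" by (auto simp: F_def)
      moreover have "\<And>k. N k \<le> n \<Longrightarrow> k \<le> n" using strict_mono_imp_increasing[OF N_mono] order_trans by blast
      ultimately obtain k where k: "N k \<le> n" "\<And>k'. N k' \<le> n \<Longrightarrow> k' \<le> k"
        using Greatest_le_nat[of "\<lambda>k. N k \<le> n" _ n] GreatestI_nat[of "\<lambda>k. N k \<le> n" k0 n] by blast
      have eq: "{j. j \<le> n \<and> \<not> F j} = N ` {..k}"
      proof (intro equalityI subsetI)
        fix j assume "j \<in> {j. j \<le> n \<and> \<not> F j}"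
        then obtain k' where "j = N k'" "N k' \<le> n" by (auto simp: F_def)
        then show "j \<in> N ` {..k}" using k(2) by auto
      next
        fix j assume "j \<in> N ` {..k}"
        then obtain k' where "j = N k'" "k' \<le> k" by auto
        then show "j \<in> {j. j \<le> n \<and> \<not> F j}"
          using k(1) strict_mono_less_eq[OF N_mono, of k' k] by (auto simp: F_def)
      qed
      have "(\<Sum>j\<in>{j. j \<le> n \<and> \<not> F j}. - ln (wt r (y j))) = (\<Sum>i\<le>k. l i)"
        unfolding eq using N_inj by (subst sum.reindex) (auto simp: l_def yN intro: inj_on_subset[OF N_inj])
      also have "\<dots> \<le> E * (N k - k)" by (rule N_size)
      also have "\<dots> \<le> E * card {j. j < n \<and> F j}"
      proof (intro mult_left_mono)
        have "{..<n} \<subseteq> {j. j < n \<and> F j} \<union> N ` {..k}" using eq by auto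
        then have "{..<N k} \<subseteq> {j. j < n \<and> F j} \<union> N ` {..<k}"
        proof -
          have "j \<in> {j. j < n \<and> F j} \<union> N ` {..<k}" if j: "j < N k" for j
          proof (cases "F j")
            case True
            then show ?thesis using j k(1) by simp
          next
            case False
            then obtain k' where "j = N k'" by (auto simp: F_def)
            then show ?thesis using j strict_mono_less[OF N_mono, of k' k] by auto
          qed
          then show ?thesis by auto
        qed
        then have "card {..<N k} \<le> card ({j. j < n \<and> F j} \<union> N ` {..<k})" by (intro card_mono) auto
        also have "\<dots> \<le> card {j. j < n \<and> F j} + card (N ` {..<k})" by (rule card_Un_le)
        also have "card (N ` {..<k}) \<le> k" using card_image_le[of "{..<k}" N] by simp
        finally show "real (N k - k) \<le> real (card {j. j < n \<and> F j})" by simp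
      qed (use E in simp)
      finally have "(\<Sum>j\<in>{j. j \<le> n \<and> \<not> F j}. - ln (wt r (y j))) \<le> E * card {j. j < n \<and> F j}" .
      then have "t * (\<Sum>j\<in>{j. j \<le> n \<and> \<not> F j}. - ln (wt r (y j))) \<le> t * (E * card {j. j < n \<and> F j})"
        using t by (intro mult_left_mono) auto
      also have "\<dots> = (t' - t) * (- ln \<kappa>) * card {j. j < n \<and> F j} + 0" using t by (simp add: E_def)
      finally show ?thesis .
    qed
  qed (use G y t in auto)
qed

end

section \<open>The dimension of the level sets\<close>

lemma ereal_le_if_smaller_le:
  assumes "0 \<le> D" "\<And>t. 0 < t \<Longrightarrow> t < v \<Longrightarrow> ereal t \<le> D" shows "ereal v \<le> D"
proof (rule ccontr)
  assume "\<not> ereal v \<le> D"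
  then have "D < ereal v" by simp
  then obtain t where t: "D < ereal t" "ereal t < ereal v" using ereal_dense2 by blast
  have "0 < ereal t" using assms(1) t(1) by (rule order.strict_trans1)
  then show False using assms(2)[of t] t by auto
qed

context multifractal
begin

definition spec :: "real \<Rightarrow> ereal" where "spec \<alpha> = (INF q. ereal (\<alpha> * q + \<tau> q))"
definition spec_bar :: "real \<Rightarrow> ereal" where "spec_bar \<alpha> = (SUP \<beta>\<in>{amin..\<alpha>}. spec \<beta>)"

lemma mean_zero: "(\<Sum>i\<in>J. p i powr q * r i powr \<tau> q * (ln (p i) - slope q * ln (r i))) = 0"
  using slope_mean[of q] by (simp add: tilt_def)

lemma value_nonneg: "amin \<le> \<alpha> \<Longrightarrow> 0 \<le> q \<Longrightarrow> 0 \<le> \<alpha> * q + \<tau> q"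
  using tau_lower[of q] mult_right_mono[of amin \<alpha> q] by linarith

lemma level_subset: "assouad_level_set \<mu> \<alpha> \<subseteq> assouad_sublevel_set \<mu> \<alpha>"
  by (auto simp: assouad_level_set_def assouad_sublevel_set_def)

text \<open>Exponents slightly below \<open>\<alpha>\<close> are approximated by blocks, and the minimum of
  \<open>\<alpha> q + \<tau> q\<close> depends continuously on \<open>\<alpha>\<close> because the minimisers stay bounded.\<close>
lemma dim_level_ge_value:
  assumes \<alpha>: "amin < \<alpha>" "\<alpha> < amax" and q: "0 \<le> q" "slope q \<le> \<alpha>" "(\<alpha> - slope q) * q = 0"
  shows "ereal (\<alpha> * q + \<tau> q) \<le> hausdorff_dim (assouad_level_set \<mu> (ereal \<alpha>))"
proof (rule ereal_le_if_smaller_le[OF hausdorff_dim_nonneg])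
  fix t assume t: "0 < t" "t < \<alpha> * q + \<tau> q"
  define v where "v = \<alpha> * q + \<tau> q"
  define d where "d = (\<alpha> - amin) / 2"
  have d: "0 < d" using \<alpha> by (simp add: d_def)
  have t0: "0 \<le> \<tau> 0" using tau_lower[of 0] by simp
  \<comment> \<open>The minimiser for \<open>\<alpha> - \<eta>\<close> will be at most \<open>\<tau> 0 / d\<close>, so that lowering \<open>\<alpha>\<close> by \<open>\<eta>\<close> lowers the
    value by less than \<open>v - t\<close>.\<close>
  define \<eta> where "\<eta> = min d ((v - t) * d / (2 * (\<tau> 0 + 1)))"
  have \<eta>: "0 < \<eta>" "\<eta> \<le> d" using d t t0 by (auto simp: \<eta>_def v_def)
  obtain q' where q': "0 \<le> q'" "slope q' \<le> \<alpha> - \<eta>" "(\<alpha> - \<eta> - slope q') * q' = 0"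
    using minimiser_exists[of "\<alpha> - \<eta>"] \<eta> d by (auto simp: d_def)
  have eq': "slope q' * q' = (\<alpha> - \<eta>) * q'" using q'(3) by (simp add: algebra_simps)
  have "d * q' \<le> (\<alpha> - \<eta> - amin) * q'" using \<eta> q' by (intro mult_right_mono) (auto simp: d_def)
  also have "\<dots> = slope q' * q' - amin * q'" using eq' by (simp add: algebra_simps)
  also have "\<dots> \<le> \<tau> 0" using tangent[of q' 0] tau_lower[of q'] by simp
  finally have dq': "d * q' \<le> \<tau> 0" .
  have "d * (\<eta> * q') \<le> \<eta> * \<tau> 0"
    using mult_left_mono[OF dq', of \<eta>] \<eta> by (simp add: mult.left_commute)
  also have "\<dots> \<le> (v - t) * d / (2 * (\<tau> 0 + 1)) * \<tau> 0"
    using t0 by (intro mult_right_mono) (auto simp: \<eta>_def)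
  also have "\<dots> = d * ((v - t) * (\<tau> 0 / (2 * (\<tau> 0 + 1))))" by simp
  also have "\<dots> < d * ((v - t) * 1)"
    using d t t0 by (intro mult_strict_left_mono) (auto simp: v_def)
  finally have small: "\<eta> * q' < v - t" using d by (subst (asm) mult_less_cancel_left_pos) auto
  have "v = slope q * q + \<tau> q" using q(3) by (simp add: v_def algebra_simps)
  also have "\<dots> \<le> slope q * q' + \<tau> q'" by (rule tangent)
  also have "\<dots> \<le> \<alpha> * q' + \<tau> q'" using q(2) q'(1) by (simp add: mult_right_mono)
  finally have "v - \<eta> * q' \<le> slope q' * q' + \<tau> q'" using eq' by (simp add: algebra_simps)
  then have "t < slope q' * q' + \<tau> q'" using small by linarith
  then show "ereal t \<le> hausdorff_dim (assouad_level_set \<mu> (ereal \<alpha>))"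
    using dim_level_mid_ge[OF tau_sum mean_zero q'(1) t(1)] q'(2) \<eta> \<alpha> amin_pos by auto
qed

text \<open>For every exponent up to \<open>\<alpha>\<close>, the value at \<open>q \<ge> 0\<close> bounds the infimum; for the exponent
  \<open>slope q\<close>, which is at most \<open>\<alpha>\<close>, \<open>tangent\<close> shows that the infimum is attained at \<open>q\<close>.\<close>
lemma spec_bar_eq_value:
  assumes q: "0 \<le> q" "slope q \<le> \<alpha>" "(\<alpha> - slope q) * q = 0"
  shows "spec_bar \<alpha> = ereal (\<alpha> * q + \<tau> q)"
proof (rule antisym)
  show "spec_bar \<alpha> \<le> ereal (\<alpha> * q + \<tau> q)"
    unfolding spec_bar_def
  proof (rule SUP_least)
    fix \<beta> assume "\<beta> \<in> {amin..\<alpha>}"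
    then have "\<beta> * q + \<tau> q \<le> \<alpha> * q + \<tau> q" using q(1) by (simp add: mult_right_mono)
    then show "spec \<beta> \<le> ereal (\<alpha> * q + \<tau> q)" unfolding spec_def by (intro INF_lower2[of q]) auto
  qed
  have "ereal (\<alpha> * q + \<tau> q) \<le> spec (slope q)"
    unfolding spec_def
  proof (rule INF_greatest)
    fix q'
    have "\<alpha> * q + \<tau> q = slope q * q + \<tau> q" using q(3) by (simp add: algebra_simps)
    then have "\<alpha> * q + \<tau> q \<le> slope q * q' + \<tau> q'" using tangent[of q q'] by linarith
    then show "ereal (\<alpha> * q + \<tau> q) \<le> ereal (slope q * q' + \<tau> q')" by (simp only: ereal_less_eq)
  qed
  also have "\<dots> \<le> spec_bar \<alpha>"
    unfolding spec_bar_def using slope_bounds(1)[of q] q(2) by (intro SUP_upper) auto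
  finally show "ereal (\<alpha> * q + \<tau> q) \<le> spec_bar \<alpha>" .
qed

text \<open>As \<open>q \<longlonglongrightarrow> \<infinity>\<close> the weights of the letters of larger exponent vanish, so \<open>amin q + \<tau> q\<close> tends to
  the similarity dimension of the letters of minimal exponent.\<close>
lemma spec_amin_le:
  assumes T: "(\<Sum>i\<in>{i\<in>J. ln (p i) / ln (r i) = amin}. r i powr T) = 1"
  shows "spec amin \<le> ereal T"
proof (rule ereal_le_epsilon2)
  fix e :: real assume e: "0 < e"
  define I where "I = {i\<in>J. ln (p i) / ln (r i) = amin}"
  define f where "f n i = p i powr real n * r i powr (T + e - amin * real n)" for n :: nat and i
  define lm where "lm i = (if i \<in> I then r i powr (T + e) else 0)" for i
  have "(\<lambda>n. f n i) \<longlonglongrightarrow> lm i" if i: "i \<in> J" for i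
  proof -
    define c where "c = p i / r i powr amin"
    have pos: "0 < p i" "0 < r i" "r i < 1" using p_pos r01 i by auto
    have f: "f n i = c ^ n * r i powr (T + e)" for n
    proof -
      have "r i powr (T + e - amin * real n) = r i powr (T + e) / (r i powr amin) ^ n"
        using pos by (simp add: powr_diff powr_powr flip: powr_realpow)
      then show ?thesis using pos by (simp add: f_def c_def powr_realpow power_divide)
    qed
    show ?thesis
    proof (cases "i \<in> I")
      case True
      then have "c = 1" using p_eq_powr[OF i] pos by (simp add: c_def I_def)
      then show ?thesis using True by (simp add: f lm_def)
    next
      case False
      have "p i \<noteq> r i powr amin"
      proof
        assume "p i = r i powr amin"
        then have "ln (p i) = amin * ln (r i)" using pos by (simp add: ln_powr)
        then show False using False i pos by (auto simp: I_def)
      qed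
      then have "p i < r i powr amin" using p_bounds[OF i] by simp
      then have "0 \<le> c" "c < 1" using pos by (auto simp: c_def)
      then have "(\<lambda>n. c ^ n * r i powr (T + e)) \<longlonglongrightarrow> 0 * r i powr (T + e)"
        by (intro tendsto_intros LIMSEQ_power_zero) auto
      then show ?thesis using False by (simp add: f lm_def)
    qed
  qed
  then have "(\<lambda>n. \<Sum>i\<in>J. f n i) \<longlonglongrightarrow> (\<Sum>i\<in>J. lm i)" by (rule tendsto_sum)
  moreover have "(\<Sum>i\<in>J. lm i) < 1"
  proof -
    have Isub: "I \<subseteq> J" "finite I" "I \<noteq> {}" using J_fin amin_amax(3) by (auto simp: I_def)
    have "(\<Sum>i\<in>J. lm i) = (\<Sum>i\<in>I. r i powr (T + e))"
      using J_fin Isub by (simp add: lm_def sum.If_cases Int_absorb1 Int_def[symmetric] flip: sum.inter_restrict)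
    also have "\<dots> < (\<Sum>i\<in>I. r i powr T)"
      using Isub r01 e by (intro sum_strict_mono powr_less_mono') auto
    also have "\<dots> = 1" using T by (simp add: I_def)
    finally show ?thesis .
  qed
  ultimately have "\<forall>\<^sub>F n in sequentially. (\<Sum>i\<in>J. f n i) < 1" by (rule order_tendstoD(2))
  then obtain n where n: "(\<Sum>i\<in>J. f n i) < 1" using eventually_happens'[OF sequentially_bot] by blast
  have "\<tau> n \<le> T + e - amin * n"
  proof (rule ccontr)
    assume "\<not> \<tau> n \<le> T + e - amin * n"
    then have "(\<Sum>i\<in>J. p i powr n * r i powr \<tau> n) \<le> (\<Sum>i\<in>J. f n i)"
      unfolding f_def using r01 by (intro sum_mono mult_left_mono powr_mono') (auto simp: less_imp_le)
    then show False using tau_sum n by simp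
  qed
  then have "amin * n + \<tau> n \<le> T + e" by simp
  then show "spec amin \<le> ereal T + ereal e"
    unfolding spec_def by (intro INF_lower2[of "real n"]) auto
qed

lemma sum_r_tau0: "(\<Sum>i\<in>J. r i powr \<tau> 0) = 1"
proof -
  have "(\<Sum>i\<in>J. p i powr 0 * r i powr \<tau> 0) = (\<Sum>i\<in>J. r i powr \<tau> 0)"
    by (intro sum.cong refl) (use p_pos in force)
  then show ?thesis using tau_sum[of 0] by simp
qed

lemma minimal_letters_dimension_exists:
  "\<exists>T\<ge>0. (\<Sum>i\<in>{i\<in>J. ln (p i) / ln (r i) = amin}. r i powr T) = 1"
proof -
  define I where "I = {i\<in>J. ln (p i) / ln (r i) = amin}"
  have I: "I \<subseteq> J" "finite I" "I \<noteq> {}" using J_fin amin_amax(3) by (auto simp: I_def)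
  define h where "h T = (\<Sum>i\<in>I. r i powr T)" for T
  have "0 < card I" using I by (simp add: card_gt_0_iff)
  moreover have "h 0 = card I" proof -
    have "r i powr 0 = 1" if "i \<in> I" for i using r01[of i] I(1) that by auto
    then show ?thesis by (simp add: h_def del: powr_zero_eq_one)
  qed
  ultimately have "1 \<le> h 0" by simp
  moreover have "h (\<tau> 0) \<le> 1"
    unfolding h_def sum_r_tau0[symmetric] using I J_fin by (intro sum_mono2) auto
  moreover have "continuous_on {0..\<tau> 0} h"
    unfolding h_def using I r01 by (intro continuous_intros) force+
  moreover have "0 \<le> \<tau> 0" using tau_lower[of 0] by simp
  ultimately obtain T where "0 \<le> T" "h T = 1" using IVT2'[of h "\<tau> 0" 1 0] by auto
  then show ?thesis by (auto simp: h_def I_def)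
qed

lemma dim_level_sets:
  assumes "amin \<le> \<alpha>" "\<alpha> < amax"
  shows "hausdorff_dim (assouad_level_set \<mu> (ereal \<alpha>)) = spec_bar \<alpha> \<and>
         hausdorff_dim (assouad_sublevel_set \<mu> (ereal \<alpha>)) = spec_bar \<alpha>"
proof -
  let ?D = "hausdorff_dim (assouad_level_set \<mu> (ereal \<alpha>))"
  let ?U = "hausdorff_dim (assouad_sublevel_set \<mu> (ereal \<alpha>))"
  have DU: "?D \<le> ?U" by (intro hausdorff_dim_mono level_subset)
  have "spec_bar \<alpha> \<le> ?D \<and> ?U \<le> spec_bar \<alpha>"
  proof (cases "\<alpha> = amin")
    case False
    then have \<alpha>: "amin < \<alpha>" using assms by simp
    obtain q where q: "0 \<le> q" "slope q \<le> \<alpha>" "(\<alpha> - slope q) * q = 0" using minimiser_exists[OF \<alpha>] by blast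
    show ?thesis
      unfolding spec_bar_eq_value[OF q]
      using dim_level_ge_value[OF \<alpha> assms(2) q] dim_sublevel_le[OF q(1) tau_sum value_nonneg[OF assms(1) q(1)]]
      by blast
  next
    case True
    have sb: "spec_bar \<alpha> = spec amin" by (simp add: spec_bar_def True)
    obtain T where T: "0 \<le> T" "(\<Sum>i\<in>{i\<in>J. ln (p i) / ln (r i) = amin}. r i powr T) = 1"
      using minimal_letters_dimension_exists by blast
    have "spec amin \<le> ereal T" by (rule spec_amin_le[OF T(2)])
    also have "ereal T \<le> ?D"
      unfolding True by (rule ereal_le_if_smaller_le[OF hausdorff_dim_nonneg dim_level_amin_ge[OF T(2)]])
    finally have "spec amin \<le> ?D" .
    moreover have "?U \<le> spec amin"
      unfolding spec_def
    proof (rule INF_greatest)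
      fix q
      show "?U \<le> ereal (amin * q + \<tau> q)"
      proof (cases "0 \<le> q")
        case q: True
        then show ?thesis using dim_sublevel_le[OF q tau_sum value_nonneg[OF assms(1) q]] True by simp
      next
        case False
        have "?U \<le> ereal (\<alpha> * 0 + \<tau> 0)"
          by (rule dim_sublevel_le[OF order_refl tau_sum value_nonneg[OF assms(1) order_refl]])
        also have "\<alpha> * 0 + \<tau> 0 \<le> slope 0 * q + \<tau> q" using tangent[of 0 q] by simp
        also have "\<dots> \<le> amin * q + \<tau> q"
          using slope_bounds(1)[of 0] False by (simp add: mult_right_mono_neg)
        finally show ?thesis by simp
      qed
    qed
    ultimately show ?thesis using sb by simp
  qed
  then show ?thesis using DU by (meson antisym order_trans)
qed

lemma dim_top_level_sets:
  "hausdorff_dim (assouad_level_set \<mu> (assouad_dim \<mu>)) = hausdorff_dim X"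
  "hausdorff_dim (assouad_sublevel_set \<mu> (assouad_dim \<mu>)) = hausdorff_dim X"
proof -
  have "assouad_sublevel_set \<mu> (assouad_dim \<mu>) = X"
    using assouad_dim_at_le by (auto simp: assouad_sublevel_set_def spt_eq)
  then show U: "hausdorff_dim (assouad_sublevel_set \<mu> (assouad_dim \<mu>)) = hausdorff_dim X" by simp
  have "hausdorff_dim X \<le> ereal (\<tau> 0)" using dim_X_le[OF sum_r_tau0] tau_lower[of 0] by simp
  also have "\<dots> \<le> hausdorff_dim (assouad_level_set \<mu> (assouad_dim \<mu>))"
    by (rule ereal_le_if_smaller_le[OF hausdorff_dim_nonneg dim_level_top_ge[OF tau_sum mean_zero]])
  finally show "hausdorff_dim (assouad_level_set \<mu> (assouad_dim \<mu>)) = hausdorff_dim X"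
    using hausdorff_dim_mono[OF level_subset, of "assouad_dim \<mu>"] U by (intro antisym) auto
qed

end

theorem theorem1p2:
  fixes \<phi> :: "nat \<Rightarrow> 'a::euclidean_space \<Rightarrow> 'a"
    and r p :: "nat \<Rightarrow> real" and m :: nat
    and X :: "'a set" and \<mu> :: "'a measure"
  assumes "self_similar_ifs m \<phi> r"
    and "open_set_condition m \<phi>"
    and "is_self_similar_set m \<phi> X" and "diameter X = 1"
    and "probability_vector m p" and "\<forall>i\<in>{1..m}. 0 < p i"
    and "is_self_similar_measure m \<phi> p \<mu>"
  shows "(\<forall>\<alpha>. alpha_min m p r \<le> \<alpha> \<and> \<alpha> < alpha_max m p r \<longrightarrow>
            hausdorff_dim (assouad_level_set \<mu> (ereal \<alpha>)) = spectrum_bar m p r \<alpha> \<and>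
            hausdorff_dim (assouad_sublevel_set \<mu> (ereal \<alpha>)) = spectrum_bar m p r \<alpha>) \<and>
         hausdorff_dim (assouad_level_set \<mu> (assouad_dim \<mu>)) = hausdorff_dim X \<and>
         hausdorff_dim (assouad_sublevel_set \<mu> (assouad_dim \<mu>)) = hausdorff_dim X \<and>
         (\<forall>\<alpha>::ereal. 0 \<le> \<alpha> \<and>
            \<alpha> \<notin> {ereal (alpha_min m p r)..ereal (alpha_max m p r)} \<union> {assouad_dim \<mu>} \<longrightarrow>
            assouad_level_set \<mu> \<alpha> = {})"
proof -
  have ne: "{1..m} \<noteq> {}" using assms(3) unfolding is_self_similar_set_def by blast
  then have m: "1 \<le> m" by simp
  have r: "\<forall>i\<in>{1..m}. 0 < r i \<and> r i < 1" using assms(1) by (simp add: self_similar_ifs_def)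
  have tau: "(\<Sum>i\<in>{1..m}. p i powr q * r i powr tau m p r q) = 1" for q
    unfolding tau_def by (rule theI') (rule tau_exists_unique[OF m assms(6) r])
  interpret prob_space \<mu> using assms(7) unfolding is_self_similar_measure_def by blast
  interpret multifractal "{1..m}" r \<phi> X p \<mu> "tau m p r"
  proof
    show "\<exists>U. U \<noteq> {} \<and> open U \<and> (\<forall>i\<in>{1..m}. \<phi> i ` U \<subseteq> U) \<and>
        (\<forall>i\<in>{1..m}. \<forall>j\<in>{1..m}. i \<noteq> j \<longrightarrow> \<phi> i ` U \<inter> \<phi> j ` U = {})"
      using assms(2) unfolding open_set_condition_def by blast
    show "X \<noteq> {}" "compact X" "X = (\<Union>i\<in>{1..m}. \<phi> i ` X)"
      using assms(3) unfolding is_self_similar_set_def by blast+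
    show "sets \<mu> = sets borel"
      using assms(7) unfolding is_self_similar_measure_def by blast
    show "measure \<mu> A = (\<Sum>i\<in>{1..m}. p i * measure \<mu> (\<phi> i -` A))" if "A \<in> sets borel" for A
      using assms(7) that unfolding is_self_similar_measure_def by blast
  qed (use ne r assms(1,4,5,6) tau in \<open>auto simp: self_similar_ifs_def probability_vector_def\<close>)
  have alpha_eq: "alpha_min m p r = amin" "alpha_max m p r = amax"
    unfolding alpha_min_def alpha_max_def amin_def amax_def by (rule refl)+
  have spec_eq: "spectrum_bar m p r \<alpha> = spec_bar \<alpha>" for \<alpha>
    unfolding spectrum_bar_def spectrum_def spec_bar_def spec_def alpha_eq by (rule refl)
  show ?thesis
    unfolding alpha_eq spec_eq using dim_level_sets dim_top_level_sets assouad_level_set_empty by blast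
qed

end
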